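(* Let $M$ be a Riemannian Einstein manifold of dimension $m+1\ge 3$ with scalar curvature $S$, let $\Sigma$ be a smooth, oriented, compact hypersurface (without boundary) in $M$, and let $v$ be a smooth section of the restriction of $TM$ to $\Sigma$. Let $V', H', I'$ be the variations, under the deformation of $\Sigma$ defined by $v$, of the volume bounded by $\Sigma$, of the mean curvature of $\Sigma$ and of the induced metric on $\Sigma$. Then $$\frac{S}{m+1}\,V' = \int_{\Sigma} \Big(H' + \frac12 \langle I', I\!I\rangle\Big)\, dA .$$
   Context: Let $D$ be the Levi-Civita connection of $M$, $I$ the metric induced on $\Sigma$, $n$ the oriented unit normal to $\Sigma$ (pointing out of the domain bounded by $\Sigma$), and $dA$ the area element of $I$. The shape operator is $BX=-D_Xn$ for $X\in T\Sigma$; the second fundamental form is $I\!I(X,Y)=I(X,BY)$; the mean curvature is the trace $H=\mathrm{tr}(B)$ (not divided by $m$). $\langle\cdot,\cdot\rangle$ on symmetric 2-tensors is the inner product induced by $I$. The deformation defined by $v$ is a smooth family of immersions $\phi_s:\Sigma\to M$, with $\phi_0$ the inclusion and $\partial_s\phi_s|_{s=0}=v$; $H'$ and $I'$ are the derivatives at $s=0$ of the mean curvature of $\phi_s$ (a function on $\Sigma$) and of the pulled-back induced metric $\phi_s^*g$ (a symmetric 2-tensor on $\Sigma$). $V'$ is the derivative at $s=0$ of the bounded volume; thus if $v=w+fn$ with $w$ tangent to $\Sigma$, then $V'=\int_\Sigma f\,dA$. This last expression defines $V'$ also when $\Sigma$ does not bound a domain of finite volume. The Einstein condition is $\mathrm{ric}=\frac{S}{m+1}g$.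 *)

theory Defs
  imports "HOL-Analysis.Analysis"
begin

section \<open>Smooth functions on open sets\<close>

text \<open>The following notions are only used for open sets \<open>U\<close>. A function is \<open>C\<^sup>k\<^sup>+\<^sup>1\<close> if it
  is differentiable and all its partial derivatives are \<open>C\<^sup>k\<close>.\<close>

primrec Ck_on :: "nat \<Rightarrow> ('a::euclidean_space \<Rightarrow> 'b::real_normed_vector) \<Rightarrow> 'a set \<Rightarrow> bool" where
  "Ck_on 0 f U \<longleftrightarrow> continuous_on U f"
| "Ck_on (Suc k) f U \<longleftrightarrow> (\<forall>x\<in>U. f differentiable (at x)) \<and>
     (\<forall>e\<in>Basis. Ck_on k (\<lambda>x. frechet_derivative f (at x) e) U)"

definition smooth_on :: "('a::euclidean_space \<Rightarrow> 'b::real_normed_vector) \<Rightarrow> 'a set \<Rightarrow> bool" where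
  "smooth_on f U \<longleftrightarrow> (\<forall>k. Ck_on k f U)"


section \<open>Manifolds\<close>

text \<open>A chart is a pair of its domain and its coordinate map. A manifold is a subset of a Hausdorff
  second countable space, with the subspace topology, and with a smooth atlas
  (not required to be maximal).\<close>

type_synonym ('a, 'n) chart = "'a set \<times> ('a \<Rightarrow> real^'n)"

definition chart_range :: "('a, 'n::finite) chart \<Rightarrow> (real^'n) set" where
  "chart_range c = snd c ` fst c"

definition chart_inv :: "('a, 'n::finite) chart \<Rightarrow> real^'n \<Rightarrow> 'a" where
  "chart_inv c = inv_into (fst c) (snd c)"

definition overlap :: "('a, 'n::finite) chart \<Rightarrow> ('a, 'n) chart \<Rightarrow> (real^'n) set" where
  "overlap c c' = snd c ` (fst c \<inter> fst c')"

definition transition :: "('a, 'n::finite) chart \<Rightarrow> ('a, 'n) chart \<Rightarrow> real^'n \<Rightarrow> real^'n" where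
  "transition c c' = snd c' \<circ> chart_inv c"

definition smooth_manifold ::
  "'a::{t2_space,second_countable_topology} set \<Rightarrow> ('a, 'n::finite) chart set \<Rightarrow> bool" where
  "smooth_manifold M A \<longleftrightarrow>
     (\<Union>c\<in>A. fst c) = M \<and>
     (\<forall>c\<in>A. openin (top_of_set M) (fst c) \<and> open (chart_range c) \<and>
            homeomorphism (fst c) (chart_range c) (snd c) (chart_inv c)) \<and>
     (\<forall>c\<in>A. \<forall>c'\<in>A. smooth_on (transition c c') (overlap c c'))"

text \<open>Some chart around \<open>p\<close>; it is only used to evaluate quantities at \<open>p\<close> that do not depend
  on the choice of coordinates.\<close>

definition chart_at :: "('a, 'n::finite) chart set \<Rightarrow> 'a \<Rightarrow> ('a, 'n) chart" where
  "chart_at A p = (SOME c. c \<in> A \<and> p \<in> fst c)"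


section \<open>Riemannian metrics, Levi-Civita connection and curvature\<close>

text \<open>A metric is given by its matrix in each chart \<open>c\<close> of the atlas, as a function on
  \<open>chart_range c\<close>; these matrices have to transform as a covariant 2-tensor.\<close>

type_synonym ('a, 'n) metric = "('a, 'n) chart \<Rightarrow> real^'n \<Rightarrow> real^'n^'n"

definition riemannian_metric ::
  "('a, 'n::finite) chart set \<Rightarrow> ('a, 'n) metric \<Rightarrow> bool" where
  "riemannian_metric A g \<longleftrightarrow>
     (\<forall>c\<in>A. smooth_on (g c) (chart_range c) \<and>
        (\<forall>x\<in>chart_range c. transpose (g c x) = g c x \<and>
           (\<forall>X. X \<noteq> 0 \<longrightarrow> X \<bullet> (g c x *v X) > 0))) \<and>
     (\<forall>c\<in>A. \<forall>c'\<in>A. \<forall>x\<in>overlap c c'. \<forall>X Y.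
        X \<bullet> (g c x *v Y) =
          frechet_derivative (transition c c') (at x) X \<bullet>
            (g c' (transition c c' x) *v frechet_derivative (transition c c') (at x) Y))"

definition partial :: "'n::finite \<Rightarrow> (real^'n \<Rightarrow> real) \<Rightarrow> real^'n \<Rightarrow> real" where
  "partial i f x = frechet_derivative f (at x) (axis i 1)"

text \<open>\<open>christoffel G x k i j\<close> is the component along the \<open>k\<close>-th coordinate field of the Levi-Civita
  derivative of the \<open>j\<close>-th coordinate field in the direction of the \<open>i\<close>-th one, for the metric
  with matrix \<open>G\<close>.\<close>

definition christoffel ::
  "(real^'n \<Rightarrow> real^'n^'n) \<Rightarrow> real^'n \<Rightarrow> 'n::finite \<Rightarrow> 'n \<Rightarrow> 'n \<Rightarrow> real" where
  "christoffel G x k i j = (\<Sum>l\<in>UNIV. matrix_inv (G x) $ k $ l *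
     (partial i (\<lambda>y. G y $ j $ l) x + partial j (\<lambda>y. G y $ i $ l) x
        - partial l (\<lambda>y. G y $ i $ j) x)) / 2"

text \<open>The defining properties of the Levi-Civita connection: it is torsion-free and metric.\<close>

lemma partial_cong:
  assumes "open U" "x \<in> U" "\<And>y. y \<in> U \<Longrightarrow> f y = f' y"
  shows "partial i f x = partial i f' x"
proof -
  have "(f has_derivative D) (at x) \<longleftrightarrow> (f' has_derivative D) (at x)" for D
    using has_derivative_transform_within_open[OF _ assms(1,2), of f D UNIV f']
      has_derivative_transform_within_open[OF _ assms(1,2), of f' D UNIV f] assms(3) by auto
  then show ?thesis
    unfolding partial_def frechet_derivative_def by presburger
qed

lemma christoffel_torsion_free:
  assumes "open U" "x \<in> U" "\<And>y. y \<in> U \<Longrightarrow> transpose (G y) = G y"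
  shows "christoffel G x k i j = christoffel G x k j i"
proof -
  have sym: "G y $ i $ j = G y $ j $ i" if "y \<in> U" for y
    using assms(3)[OF that] by (simp add: transpose_def vec_eq_iff)
  have "partial l (\<lambda>y. G y $ i $ j) x = partial l (\<lambda>y. G y $ j $ i) x" for l
    by (rule partial_cong[OF assms(1,2)]) (rule sym)
  then show ?thesis
    by (simp add: christoffel_def add.commute)
qed

lemma christoffel_metric:
  fixes G :: "real^'n \<Rightarrow> real^'n::finite^'n"
  assumes "open U" "x \<in> U" and sym: "\<And>y. y \<in> U \<Longrightarrow> transpose (G y) = G y"
    and inv: "invertible (G x)"
  shows "partial k (\<lambda>y. G y $ i $ j) x =
    (\<Sum>l\<in>UNIV. christoffel G x l k i * G x $ l $ j) + (\<Sum>l\<in>UNIV. christoffel G x l k j * G x $ i $ l)"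
proof -
  have s: "G y $ i $ j = G y $ j $ i" if "y \<in> U" for y i j
    using sym[OF that] by (simp add: transpose_def vec_eq_iff)
  define P where "P = (\<lambda>i a b. partial i (\<lambda>y. G y $ a $ b) x)"
  have Ps: "P i a b = P i b a" for i a b
    unfolding P_def by (rule partial_cong[OF assms(1,2)]) (rule s)
  have GI: "G x ** matrix_inv (G x) = mat 1"
    using someI_ex[OF inv[unfolded invertible_def]] by (simp add: matrix_inv_def)
  have GI': "(\<Sum>l\<in>UNIV. G x $ a $ l * matrix_inv (G x) $ l $ b) = (if a = b then 1 else 0)" for a b
    using arg_cong[OF GI, of "\<lambda>A. A $ a $ b"] by (simp add: matrix_matrix_mult_def mat_def)
  have low: "(\<Sum>l\<in>UNIV. christoffel G x l a b * G x $ c $ l) = (P a b c + P b a c - P c a b) / 2"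
    for a b c
  proof -
    have "(\<Sum>l\<in>UNIV. christoffel G x l a b * G x $ c $ l) =
      (\<Sum>l\<in>UNIV. \<Sum>q\<in>UNIV. (G x $ c $ l * matrix_inv (G x) $ l $ q) * ((P a b q + P b a q - P q a b) / 2))"
      unfolding christoffel_def P_def
      by (intro sum.cong refl) (simp add: sum_distrib_left sum_divide_distrib mult_ac)
    also have "\<dots> = (\<Sum>q\<in>UNIV. (\<Sum>l\<in>UNIV. G x $ c $ l * matrix_inv (G x) $ l $ q) * ((P a b q + P b a q - P q a b) / 2))"
      unfolding sum_distrib_right by (rule sum.swap)
    also have "\<dots> = (\<Sum>q\<in>UNIV. if c = q then (P a b q + P b a q - P q a b) / 2 else 0)"
      unfolding GI' by (intro sum.cong refl) simp
    finally show ?thesis by simp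
  qed
  have "(\<Sum>l\<in>UNIV. christoffel G x l k i * G x $ l $ j) = (P k i j + P i k j - P j k i) / 2"
    using low[where a = k and b = i and c = j] s[OF assms(2), of _ j] by simp
  moreover have "partial k (\<lambda>y. G y $ i $ j) x = P k i j"
    by (simp add: P_def)
  ultimately show ?thesis
    unfolding low using Ps[of k i j] Ps[of i k j] Ps[of j k i] by argo
qed

text \<open>With \<open>R(X,Y) Z = D\<^sub>X D\<^sub>Y Z - D\<^sub>Y D\<^sub>X Z - D\<^sub>[\<^sub>X\<^sub>,\<^sub>Y\<^sub>] Z\<close>,
  \<open>riemann G x l k i j\<close> is the \<open>l\<close>-th component of \<open>R(\<partial>\<^sub>i,\<partial>\<^sub>j) \<partial>\<^sub>k\<close>.\<close>

definition riemann ::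
  "(real^'n \<Rightarrow> real^'n^'n) \<Rightarrow> real^'n \<Rightarrow> 'n::finite \<Rightarrow> 'n \<Rightarrow> 'n \<Rightarrow> 'n \<Rightarrow> real" where
  "riemann G x l k i j =
     partial i (\<lambda>y. christoffel G y l j k) x - partial j (\<lambda>y. christoffel G y l i k) x +
     (\<Sum>p\<in>UNIV. christoffel G x l i p * christoffel G x p j k
              - christoffel G x l j p * christoffel G x p i k)"

text \<open>The Ricci tensor \<open>ric(Y,Z)\<close> is the trace of \<open>X \<mapsto> R(X,Y) Z\<close>.\<close>

definition ricci :: "(real^'n \<Rightarrow> real^'n^'n) \<Rightarrow> real^'n \<Rightarrow> real^'n^'n::finite" where
  "ricci G x = (\<chi> j k. \<Sum>i\<in>UNIV. riemann G x i k i j)"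

definition scalar_curvature :: "(real^'n \<Rightarrow> real^'n^'n) \<Rightarrow> real^'n::finite \<Rightarrow> real" where
  "scalar_curvature G x = (\<Sum>i\<in>UNIV. \<Sum>j\<in>UNIV. matrix_inv (G x) $ i $ j * ricci G x $ i $ j)"

definition einstein :: "('a, 'n::finite) chart set \<Rightarrow> ('a, 'n) metric \<Rightarrow> bool" where
  "einstein A g \<longleftrightarrow> (\<forall>c\<in>A. \<forall>x\<in>chart_range c.
     ricci (g c) x = (scalar_curvature (g c) x / real CARD('n)) *\<^sub>R g c x)"


section \<open>Maps between manifolds and vector fields along them\<close>

definition local_rep ::
  "('a, 'm::finite) chart \<Rightarrow> ('a, 'n::finite) chart \<Rightarrow> ('a \<Rightarrow> 'a) \<Rightarrow> real^'m \<Rightarrow> real^'n" where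
  "local_rep b c F = snd c \<circ> F \<circ> chart_inv b"

definition smooth_map ::
  "'a::topological_space set \<Rightarrow> ('a, 'm::finite) chart set \<Rightarrow> 'a set \<Rightarrow> ('a, 'n::finite) chart set \<Rightarrow>
   ('a \<Rightarrow> 'a) \<Rightarrow> bool" where
  "smooth_map \<Sigma> B M A F \<longleftrightarrow> F ` \<Sigma> \<subseteq> M \<and> continuous_on \<Sigma> F \<and>
     (\<forall>b\<in>B. \<forall>c\<in>A. smooth_on (local_rep b c F) (snd b ` {p \<in> fst b. F p \<in> fst c}))"

definition immersion ::
  "'a::topological_space set \<Rightarrow> ('a, 'm::finite) chart set \<Rightarrow> 'a set \<Rightarrow> ('a, 'n::finite) chart set \<Rightarrow>
   ('a \<Rightarrow> 'a) \<Rightarrow> bool" where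
  "immersion \<Sigma> B M A F \<longleftrightarrow> smooth_map \<Sigma> B M A F \<and>
     (\<forall>b\<in>B. \<forall>c\<in>A. \<forall>p\<in>fst b. F p \<in> fst c \<longrightarrow>
        inj (frechet_derivative (local_rep b c F) (at (snd b p))))"

text \<open>Since \<open>\<Sigma>\<close> carries the subspace topology, this makes it an embedded submanifold.\<close>

definition hypersurface ::
  "'a::{t2_space,second_countable_topology} set \<Rightarrow> ('a, 'm::finite) chart set \<Rightarrow>
   'a set \<Rightarrow> ('a, 'n::finite) chart set \<Rightarrow> bool" where
  "hypersurface \<Sigma> B M A \<longleftrightarrow> CARD('n) = CARD('m) + 1 \<and>
     smooth_manifold \<Sigma> B \<and> \<Sigma> \<subseteq> M \<and> immersion \<Sigma> B M A (\<lambda>p. p)"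

text \<open>A vector field along \<open>F\<close>, i.e. a section of the pullback of the tangent bundle by \<open>F\<close>, is given
  by its components \<open>v c p\<close> at \<open>p\<close> in each chart \<open>c\<close> around \<open>F p\<close>.\<close>

type_synonym ('a, 'n) vfield = "('a, 'n) chart \<Rightarrow> 'a \<Rightarrow> real^'n"

definition vector_field_along ::
  "'a set \<Rightarrow> ('a, 'n::finite) chart set \<Rightarrow> ('a \<Rightarrow> 'a) \<Rightarrow> ('a, 'n) vfield \<Rightarrow> bool" where
  "vector_field_along \<Sigma> A F v \<longleftrightarrow>
     (\<forall>c\<in>A. \<forall>c'\<in>A. \<forall>p\<in>\<Sigma>. F p \<in> fst c \<inter> fst c' \<longrightarrow>
        v c' p = frechet_derivative (transition c c') (at (snd c (F p))) (v c p))"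

definition smooth_vector_field_along ::
  "'a set \<Rightarrow> ('a, 'm::finite) chart set \<Rightarrow> ('a, 'n::finite) chart set \<Rightarrow>
   ('a \<Rightarrow> 'a) \<Rightarrow> ('a, 'n) vfield \<Rightarrow> bool" where
  "smooth_vector_field_along \<Sigma> B A F v \<longleftrightarrow> vector_field_along \<Sigma> A F v \<and>
     (\<forall>b\<in>B. \<forall>c\<in>A. smooth_on (v c \<circ> chart_inv b) (snd b ` {p \<in> fst b. F p \<in> fst c}))"

definition unit_normal_along ::
  "'a set \<Rightarrow> ('a, 'm::finite) chart set \<Rightarrow> ('a, 'n::finite) chart set \<Rightarrow> ('a, 'n) metric \<Rightarrow>
   ('a \<Rightarrow> 'a) \<Rightarrow> ('a, 'n) vfield \<Rightarrow> bool" where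
  "unit_normal_along \<Sigma> B A g F n \<longleftrightarrow> vector_field_along \<Sigma> A F n \<and>
     (\<forall>p\<in>\<Sigma>. \<forall>b\<in>B. \<forall>c\<in>A. p \<in> fst b \<and> F p \<in> fst c \<longrightarrow>
        n c p \<bullet> (g c (snd c (F p)) *v n c p) = 1 \<and>
        (\<forall>X. frechet_derivative (local_rep b c F) (at (snd b p)) X \<bullet>
               (g c (snd c (F p)) *v n c p) = 0))"


section \<open>Geometry of an immersed hypersurface\<close>

text \<open>Throughout, \<open>F\<close> is an immersion of \<open>\<Sigma>\<close> and \<open>n\<close> a unit normal field along \<open>F\<close>.
  The following tensors are expressed in a chart \<open>b\<close> of \<open>\<Sigma>\<close>, at the point with coordinates \<open>x\<close>.\<close>

definition induced_metric ::
  "('a, 'n::finite) chart set \<Rightarrow> ('a, 'n) metric \<Rightarrow> ('a \<Rightarrow> 'a) \<Rightarrow>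
   ('a, 'm::finite) chart \<Rightarrow> real^'m \<Rightarrow> real^'m^'m" where
  "induced_metric A g F b x =
     (let c = chart_at A (F (chart_inv b x)); dF = frechet_derivative (local_rep b c F) (at x)
      in \<chi> i j. dF (axis i 1) \<bullet> (g c (local_rep b c F x) *v dF (axis j 1)))"

text \<open>The covariant derivative, in the direction of \<open>X\<close>, of the vector field \<open>n\<close> along \<open>F\<close>, with respect
  to the Levi-Civita connection of the ambient manifold. The result is in components with respect to
  the chart \<open>c\<close> of the ambient manifold.\<close>

definition covariant_derivative_along ::
  "('a, 'n::finite) metric \<Rightarrow> ('a \<Rightarrow> 'a) \<Rightarrow> ('a, 'n) vfield \<Rightarrow>
   ('a, 'm::finite) chart \<Rightarrow> ('a, 'n) chart \<Rightarrow> real^'m \<Rightarrow> real^'m \<Rightarrow> real^'n" where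
  "covariant_derivative_along g F n b c x X =
     frechet_derivative (n c \<circ> chart_inv b) (at x) X +
     (\<chi> k. \<Sum>i\<in>UNIV. \<Sum>j\<in>UNIV. christoffel (g c) (local_rep b c F x) k i j *
        frechet_derivative (local_rep b c F) (at x) X $ i * n c (chart_inv b x) $ j)"

text \<open>The endomorphism \<open>B\<close> of the tangent spaces of \<open>\<Sigma>\<close> such that \<open>dF (B X) = - D\<^sub>X n\<close>.\<close>

definition shape_operator ::
  "('a, 'n::finite) chart set \<Rightarrow> ('a, 'n) metric \<Rightarrow> ('a \<Rightarrow> 'a) \<Rightarrow> ('a, 'n) vfield \<Rightarrow>
   ('a, 'm::finite) chart \<Rightarrow> real^'m \<Rightarrow> real^'m^'m" where
  "shape_operator A g F n b x =
     (let c = chart_at A (F (chart_inv b x))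
      in THE S. \<forall>X. frechet_derivative (local_rep b c F) (at x) (S *v X) =
                     - covariant_derivative_along g F n b c x X)"

text \<open>The matrix of \<open>(X,Y) \<mapsto> I(X, B Y)\<close>.\<close>

definition second_fundamental_form ::
  "('a, 'n::finite) chart set \<Rightarrow> ('a, 'n) metric \<Rightarrow> ('a \<Rightarrow> 'a) \<Rightarrow> ('a, 'n) vfield \<Rightarrow>
   ('a, 'm::finite) chart \<Rightarrow> real^'m \<Rightarrow> real^'m^'m" where
  "second_fundamental_form A g F n b x = induced_metric A g F b x ** shape_operator A g F n b x"

definition mean_curvature ::
  "('a, 'm::finite) chart set \<Rightarrow> ('a, 'n::finite) chart set \<Rightarrow> ('a, 'n) metric \<Rightarrow>
   ('a \<Rightarrow> 'a) \<Rightarrow> ('a, 'n) vfield \<Rightarrow> 'a \<Rightarrow> real" where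
  "mean_curvature B A g F n p =
     (let b = chart_at B p in trace (shape_operator A g F n b (snd b p)))"

text \<open>The inner product of 2-tensors \<open>h\<close> and \<open>k\<close> induced by the inner product with matrix \<open>G\<close>.\<close>

definition tensor_inner :: "real^'m^'m \<Rightarrow> real^'m^'m \<Rightarrow> real^'m^'m::finite \<Rightarrow> real" where
  "tensor_inner G h k = (\<Sum>i\<in>UNIV. \<Sum>j\<in>UNIV. \<Sum>a\<in>UNIV. \<Sum>b\<in>UNIV.
     matrix_inv G $ i $ a * matrix_inv G $ j $ b * h $ i $ j * k $ a $ b)"

text \<open>\<open>\<mu>\<close> is the area element of the metric \<open>h\<close> on the manifold \<open>\<Sigma>\<close>: the Borel measure
  with density \<open>sqrt (det h)\<close> in every chart.\<close>

definition area_element ::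
  "'a::topological_space set \<Rightarrow> ('a, 'm::finite) chart set \<Rightarrow> ('a, 'm) metric \<Rightarrow> 'a measure \<Rightarrow> bool"
  where
  "area_element \<Sigma> B h \<mu> \<longleftrightarrow> sets \<mu> = sets (restrict_space borel \<Sigma>) \<and>
     (\<forall>b\<in>B. \<forall>E\<in>sets \<mu>. E \<subseteq> fst b \<longrightarrow>
        emeasure \<mu> E = (\<integral>\<^sup>+x\<in>snd b ` E. ennreal (sqrt (det (h b x))) \<partial>lborel))"


section \<open>Deformations and first variations\<close>

text \<open>\<open>\<phi>\<close> is a smooth family of immersions, with \<open>\<phi> 0\<close> the inclusion and with initial velocity \<open>v\<close>.\<close>

definition deformation ::
  "'a::topological_space set \<Rightarrow> ('a, 'm::finite) chart set \<Rightarrow> 'a set \<Rightarrow> ('a, 'n::finite) chart set \<Rightarrow>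
   ('a, 'n) vfield \<Rightarrow> real \<Rightarrow> (real \<Rightarrow> 'a \<Rightarrow> 'a) \<Rightarrow> bool" where
  "deformation \<Sigma> B M A v \<epsilon> \<phi> \<longleftrightarrow> \<epsilon> > 0 \<and>
     continuous_on ({-\<epsilon><..<\<epsilon>} \<times> \<Sigma>) (\<lambda>(s, p). \<phi> s p) \<and>
     (\<forall>b\<in>B. \<forall>c\<in>A. smooth_on (\<lambda>(s, x). local_rep b c (\<phi> s) x)
        {(s, x). s \<in> {-\<epsilon><..<\<epsilon>} \<and> x \<in> chart_range b \<and> \<phi> s (chart_inv b x) \<in> fst c}) \<and>
     (\<forall>s\<in>{-\<epsilon><..<\<epsilon>}. immersion \<Sigma> B M A (\<phi> s)) \<and>
     (\<forall>p\<in>\<Sigma>. \<phi> 0 p = p) \<and>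
     (\<forall>p\<in>\<Sigma>. \<forall>c\<in>A. p \<in> fst c \<longrightarrow> ((\<lambda>s. snd c (\<phi> s p)) has_vector_derivative v c p) (at 0))"

text \<open>\<open>\<nu> s\<close> is the unit normal field of \<open>\<phi> s\<close> compatible with the orientation given by the unit
  normal \<open>n\<close> of \<open>\<Sigma>\<close>: by continuity in \<open>s\<close> it is determined by \<open>\<nu> 0 = n\<close>.\<close>

definition deformed_normal ::
  "'a::topological_space set \<Rightarrow> ('a, 'm::finite) chart set \<Rightarrow> ('a, 'n::finite) chart set \<Rightarrow>
   ('a, 'n) metric \<Rightarrow> ('a, 'n) vfield \<Rightarrow> real \<Rightarrow> (real \<Rightarrow> 'a \<Rightarrow> 'a) \<Rightarrow>
   (real \<Rightarrow> ('a, 'n) vfield) \<Rightarrow> bool" where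
  "deformed_normal \<Sigma> B A g n \<epsilon> \<phi> \<nu> \<longleftrightarrow>
     (\<forall>s\<in>{-\<epsilon><..<\<epsilon>}. unit_normal_along \<Sigma> B A g (\<phi> s) (\<nu> s)) \<and>
     (\<forall>b\<in>B. \<forall>c\<in>A. smooth_on (\<lambda>(s, x). \<nu> s c (chart_inv b x))
        {(s, x). s \<in> {-\<epsilon><..<\<epsilon>} \<and> x \<in> chart_range b \<and> \<phi> s (chart_inv b x) \<in> fst c}) \<and>
     (\<forall>p\<in>\<Sigma>. \<forall>c\<in>A. p \<in> fst c \<longrightarrow> \<nu> 0 c p = n c p)"

text \<open>The function \<open>f\<close> such that \<open>v = w + f n\<close> with \<open>w\<close> tangent to \<open>\<Sigma>\<close>.\<close>

definition normal_component ::
  "('a, 'm::finite) chart set \<Rightarrow> ('a, 'n::finite) chart set \<Rightarrow>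
   ('a, 'n) vfield \<Rightarrow> ('a, 'n) vfield \<Rightarrow> 'a \<Rightarrow> real" where
  "normal_component B A n v p =
     (let b = chart_at B p; c = chart_at A p
      in THE a. \<exists>X. v c p = frechet_derivative (local_rep b c (\<lambda>q. q)) (at (snd b p)) X + a *\<^sub>R n c p)"

definition volume_variation ::
  "('a, 'm::finite) chart set \<Rightarrow> ('a, 'n::finite) chart set \<Rightarrow>
   ('a, 'n) vfield \<Rightarrow> ('a, 'n) vfield \<Rightarrow> 'a measure \<Rightarrow> real" where
  "volume_variation B A n v dA = (\<integral>p. normal_component B A n v p \<partial>dA)"

definition mean_curvature_variation ::
  "('a, 'm::finite) chart set \<Rightarrow> ('a, 'n::finite) chart set \<Rightarrow> ('a, 'n) metric \<Rightarrow>
   (real \<Rightarrow> 'a \<Rightarrow> 'a) \<Rightarrow> (real \<Rightarrow> ('a, 'n) vfield) \<Rightarrow> 'a \<Rightarrow> real" where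
  "mean_curvature_variation B A g \<phi> \<nu> p = deriv (\<lambda>s. mean_curvature B A g (\<phi> s) (\<nu> s) p) 0"

definition metric_variation ::
  "('a, 'n::finite) chart set \<Rightarrow> ('a, 'n) metric \<Rightarrow> (real \<Rightarrow> 'a \<Rightarrow> 'a) \<Rightarrow>
   ('a, 'm::finite) chart \<Rightarrow> real^'m \<Rightarrow> real^'m^'m" where
  "metric_variation A g \<phi> b x = vector_derivative (\<lambda>s. induced_metric A g (\<phi> s) b x) (at 0)"

text \<open>The function \<open>\<langle>I', II\<rangle>\<close> on \<open>\<Sigma>\<close>, where \<open>\<Sigma>\<close> has the unit normal \<open>n\<close>.\<close>

definition metric_variation_inner_II ::
  "('a, 'm::finite) chart set \<Rightarrow> ('a, 'n::finite) chart set \<Rightarrow> ('a, 'n) metric \<Rightarrow>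
   ('a, 'n) vfield \<Rightarrow> (real \<Rightarrow> 'a \<Rightarrow> 'a) \<Rightarrow> 'a \<Rightarrow> real" where
  "metric_variation_inner_II B A g n \<phi> p =
     (let b = chart_at B p; x = snd b p
      in tensor_inner (induced_metric A g (\<lambda>q. q) b x) (metric_variation A g \<phi> b x)
           (second_fundamental_form A g (\<lambda>q. q) n b x))"

end

(*
  Write D for the Levi-Civita connection, N_s for the unit normal of the deformed hypersurface and
  Y = D_s N_s at s = 0, which is a tangent field since <N_s, N_s> = 1. Differentiating
  d phi_s (B_s X) = - D_X N_s covariantly in s, exchanging D_s and D_X at the cost of a curvature term
  and taking the trace gives, pointwise on the hypersurface,
    H' + 1/2 <I', II> = ric(v, n) - div Y.
  Here the term -tr(X |-> (D_{BX} v)^T) cancels against 1/2 <I', II> because B is self-adjoint, and the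
  trace of the curvature over the tangent space is the full Ricci trace because <R(n, v) n, n> = 0;
  the Codazzi equation is not needed. The Einstein condition turns ric(v, n) into S/(m+1) <v, n>, and
  div Y integrates to 0.
*)
theory Submission
  imports Defs
begin

section \<open>Calculus of smooth functions\<close>

text \<open>The definitions evaluate a tensor at a point in a chart chosen arbitrarily and anew at
  every point, so nothing can be differentiated through them directly. Around a given point they are
  therefore rewritten with one fixed chart on either side, which rests on the transformation law of
  the Christoffel symbols. In such charts the deformation is a map \<Phi>(s, x) on an open subset of
  R x R^m, and D_s, D_X are covariant derivatives along this one map in the directions (1, 0) and
  (0, X). Their exchange is then a single identity between partial derivatives, for fields that live
  only along the map. The divergence of Y is expressed by the area density: if y denotes its
  coordinates, then div Y = tr(dy) + 1/2 tr(I^-1 dI(y)) = sum_j d_j(sqrt(det I) y_j) / sqrt(det I).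
  After cutting off with a partition of unity, the numerator is a sum of partial derivatives of
  compactly supported functions on R^m, and these integrate to 0 by translation invariance of
  Lebesgue measure.\<close>

declare transpose_matrix_vector [simp del]

abbreviation Dif :: "('a::real_normed_vector \<Rightarrow> 'b::real_normed_vector) \<Rightarrow> 'a \<Rightarrow> 'a \<Rightarrow> 'b" where
  "Dif f x \<equiv> frechet_derivative f (at x)"

lemma Dif_eq: "(f has_derivative f') (at x) \<Longrightarrow> Dif f x = f'"
  using frechet_derivative_at by metis

lemma has_derivative_cong_open:
  assumes "open U" "x \<in> U" "\<And>y. y \<in> U \<Longrightarrow> f y = g y"
  shows "(f has_derivative f') (at x) \<longleftrightarrow> (g has_derivative f') (at x)"
  using has_derivative_transform_within_open[OF _ assms(1,2), of f f' UNIV g]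
    has_derivative_transform_within_open[OF _ assms(1,2), of g f' UNIV f] assms(3) by auto

lemma Dif_cong_open:
  assumes "open U" "x \<in> U" "\<And>y. y \<in> U \<Longrightarrow> f y = g y"
  shows "Dif f x = Dif g x"
  unfolding frechet_derivative_def using has_derivative_cong_open[OF assms] by simp

lemma differentiable_cong_open:
  assumes "open U" "x \<in> U" "\<And>y. y \<in> U \<Longrightarrow> f y = g y"
  shows "f differentiable (at x) \<longleftrightarrow> g differentiable (at x)"
  unfolding differentiable_def using has_derivative_cong_open[OF assms] by simp

lemma Ck_on_cong:
  assumes "open U" "\<And>x. x \<in> U \<Longrightarrow> f x = g x" "Ck_on k f U"
  shows "Ck_on k g U"
  using assms(2,3)
proof (induction k arbitrary: f g)
  case 0
  then show ?case by (simp cong: continuous_on_cong)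
next
  case (Suc k)
  have "Ck_on k (\<lambda>x. Dif g x e) U" if "e \<in> Basis" for e
    using Suc.IH[of "\<lambda>x. Dif f x e"] Dif_cong_open[OF assms(1) _ Suc.prems(1)] Suc.prems(2) that
    by auto
  then show ?case
    using Suc.prems(2) differentiable_cong_open[OF assms(1) _ Suc.prems(1)] by auto
qed

lemma Ck_on_subset:
  assumes "Ck_on k f U" "V \<subseteq> U"
  shows "Ck_on k f V"
  using assms(1)
proof (induction k arbitrary: f)
  case 0
  then show ?case using assms(2) continuous_on_subset by auto
next
  case (Suc k)
  then show ?case using assms(2) by auto
qed

text \<open>The closure properties below are inductions on \<open>k\<close>. Their steps know the
  derivative as a formula in the \<open>Dif\<close> of the constituents, and on an open set this
  formula may replace \<open>Dif\<close> of the compound function.\<close>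

lemma Ck_on_SucI:
  assumes "open U" "\<And>x. x \<in> U \<Longrightarrow> (f has_derivative f' x) (at x)"
    "\<And>e. e \<in> Basis \<Longrightarrow> Ck_on k (\<lambda>x. f' x e) U"
  shows "Ck_on (Suc k) f U"
proof -
  have "Ck_on k (\<lambda>x. Dif f x e) U" if "e \<in> Basis" for e
    by (rule Ck_on_cong[OF assms(1) _ assms(3)[OF that]]) (simp add: Dif_eq[OF assms(2)])
  then show ?thesis
    using assms(2) by (auto intro: differentiableI)
qed

lemma Ck_on_SucD:
  assumes "Ck_on (Suc k) f U" "x \<in> U"
  shows "(f has_derivative Dif f x) (at x)"
  using assms by (auto simp: frechet_derivative_works)

lemma Ck_on_Suc_imp: "Ck_on (Suc k) f U \<Longrightarrow> Ck_on k f U"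
proof (induction k arbitrary: f)
  case 0
  then show ?case
    by (auto intro!: continuous_at_imp_continuous_on differentiable_imp_continuous_within)
next
  case (Suc k)
  from Suc.prems show ?case
    using Suc.IH by (simp del: Ck_on.simps(1))
qed

lemma Ck_on_const [simp]: "open U \<Longrightarrow> Ck_on k (\<lambda>x. c) U"
proof (induction k arbitrary: c)
  case (Suc k)
  show ?case
    by (rule Ck_on_SucI[where f' = "\<lambda>_ _. 0"]) (use Suc in \<open>auto intro!: derivative_eq_intros\<close>)
qed auto

lemma Ck_on_add:
  assumes "open U" "Ck_on k f U" "Ck_on k g U"
  shows "Ck_on k (\<lambda>x. f x + g x) U"
  using assms(2,3)
proof (induction k arbitrary: f g)
  case (Suc k)
  show ?case
  proof (rule Ck_on_SucI[OF assms(1)])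
    show "((\<lambda>x. f x + g x) has_derivative (\<lambda>h. Dif f x h + Dif g x h)) (at x)" if "x \<in> U" for x
      using Ck_on_SucD[OF Suc.prems(1) that] Ck_on_SucD[OF Suc.prems(2) that]
      by (rule has_derivative_add)
  qed (use Suc in auto)
qed (auto intro: continuous_intros)

lemma Ck_on_bounded_linear:
  assumes "open U" "bounded_linear h" "Ck_on k f U"
  shows "Ck_on k (\<lambda>x. h (f x)) U"
  using assms(3)
proof (induction k arbitrary: f)
  case 0
  then show ?case
    using bounded_linear.continuous_on[OF assms(2)] by simp
next
  case (Suc k)
  show ?case
  proof (rule Ck_on_SucI[OF assms(1)])
    show "((\<lambda>x. h (f x)) has_derivative (\<lambda>e. h (Dif f x e))) (at x)" if "x \<in> U" for x
      using bounded_linear.has_derivative[OF assms(2) Ck_on_SucD[OF Suc.prems that]] .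
  qed (use Suc in auto)
qed

lemma Ck_on_bilinear:
  assumes "open U" "bounded_bilinear h" "Ck_on k f U" "Ck_on k g U"
  shows "Ck_on k (\<lambda>x. h (f x) (g x)) U"
  using assms(3,4)
proof (induction k arbitrary: f g)
  case 0
  then show ?case
    using bounded_bilinear.continuous_on[OF assms(2)] by auto
next
  case (Suc k)
  show ?case
  proof (rule Ck_on_SucI[OF assms(1)])
    show "((\<lambda>x. h (f x) (g x)) has_derivative (\<lambda>e. h (f x) (Dif g x e) + h (Dif f x e) (g x))) (at x)"
      if "x \<in> U" for x
      using bounded_bilinear.FDERIV[OF assms(2) Ck_on_SucD[OF Suc.prems(1) that] Ck_on_SucD[OF Suc.prems(2) that]] .
    show "Ck_on k (\<lambda>x. h (f x) (Dif g x e) + h (Dif f x e) (g x)) U" if "e \<in> Basis" for e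
      by (intro Ck_on_add assms(1) Suc.IH) (use Suc.prems that Ck_on_Suc_imp in auto)
  qed
qed

lemma Ck_on_sum:
  assumes "open U" "\<And>i. i \<in> I \<Longrightarrow> Ck_on k (f i) U"
  shows "Ck_on k (\<lambda>x. \<Sum>i\<in>I. f i x) U"
  using assms(2)
  by (induction I rule: infinite_finite_induct) (auto simp: assms(1) intro!: Ck_on_add)

text \<open>\<open>Ck_on\<close> speaks only of basis directions; by linearity any fixed direction
  is a combination of these with constant coefficients.\<close>

lemma Ck_on_linear_arg:
  assumes "open U" "\<And>e. e \<in> Basis \<Longrightarrow> Ck_on k (\<lambda>x. L x e) U" "\<And>x. x \<in> U \<Longrightarrow> linear (L x)"
  shows "Ck_on k (\<lambda>x. L x (e :: 'a::euclidean_space)) U"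
proof -
  have "L x e = (\<Sum>b\<in>Basis. (e \<bullet> b) *\<^sub>R L x b)" if "x \<in> U" for x
    using linear_sum[OF assms(3)[OF that], of "\<lambda>b. (e \<bullet> b) *\<^sub>R b" Basis]
    by (simp add: euclidean_representation linear_scale[OF assms(3)[OF that]])
  moreover have "Ck_on k (\<lambda>x. \<Sum>b\<in>Basis. (e \<bullet> b) *\<^sub>R L x b) U"
    by (intro Ck_on_sum assms(1) Ck_on_bounded_linear[OF assms(1) bounded_linear_scaleR_right] assms(2))
  ultimately show ?thesis
    using Ck_on_cong[OF assms(1), of "\<lambda>x. \<Sum>b\<in>Basis. (e \<bullet> b) *\<^sub>R L x b" "\<lambda>x. L x e"] by simp
qed

lemma Ck_on_Dif:
  assumes "open U" "Ck_on (Suc k) f U"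
  shows "Ck_on k (\<lambda>x. Dif f x e) U"
  by (rule Ck_on_linear_arg[OF assms(1)])
    (use assms(2) Ck_on_SucD[OF assms(2)] has_derivative_linear in auto)

lemma Ck_on_compose:
  fixes f :: "'a::euclidean_space \<Rightarrow> 'b::euclidean_space" and g :: "'b \<Rightarrow> 'c::real_normed_vector"
  assumes "open U" "open V" "f ` U \<subseteq> V" "Ck_on k f U" "Ck_on k g V"
  shows "Ck_on k (\<lambda>x. g (f x)) U"
  using assms(4,5)
proof (induction k arbitrary: g)
  case 0
  then show ?case
    using continuous_on_compose2[of V g U f] assms(3) by auto
next
  case (Suc k)
  show ?case
  proof (rule Ck_on_SucI[OF assms(1)])
    show "((\<lambda>x. g (f x)) has_derivative (\<lambda>e. Dif g (f x) (Dif f x e))) (at x)" if "x \<in> U" for x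
    proof -
      have "f x \<in> V" using assms(3) that by blast
      then show ?thesis
        using has_derivative_compose[OF Ck_on_SucD[OF Suc.prems(1) that] Ck_on_SucD[OF Suc.prems(2)]] by blast
    qed
    fix e :: 'a assume "e \<in> Basis"
    then have e: "Ck_on k (\<lambda>x. Dif f x e) U"
      using Suc.prems(1) by simp
    \<comment> \<open>In the chain rule the direction \<open>Dif f x e\<close> moves with
      \<open>x\<close>. Expanding it in the basis leaves the derivatives of \<open>g\<close> in
      fixed directions, composed with \<open>f\<close>, to which the induction hypothesis
      applies.\<close>
    have "Ck_on k (\<lambda>x. \<Sum>b\<in>Basis. (Dif f x e \<bullet> b) *\<^sub>R Dif g (f x) b) U"
      using Suc.prems(2)
      by (intro Ck_on_sum assms(1) Ck_on_bilinear[OF assms(1) bounded_bilinear_scaleR]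
          Ck_on_bounded_linear[OF assms(1) bounded_linear_inner_left e] Suc.IH Ck_on_Suc_imp[OF Suc.prems(1)]) auto
    moreover have "(\<Sum>b\<in>Basis. (Dif f x e \<bullet> b) *\<^sub>R Dif g (f x) b) = Dif g (f x) (Dif f x e)"
      if "x \<in> U" for x
    proof -
      have l: "linear (Dif g (f x))"
        using Ck_on_SucD[OF Suc.prems(2)] assms(3) that has_derivative_linear by blast
      show ?thesis
        using linear_sum[OF l, of "\<lambda>b. (Dif f x e \<bullet> b) *\<^sub>R b" Basis]
        by (simp add: euclidean_representation linear_scale[OF l])
    qed
    ultimately show "Ck_on k (\<lambda>x. Dif g (f x) (Dif f x e)) U"
      by (rule Ck_on_cong[OF assms(1), rotated])
  qed
qed

text \<open>The derivative of 1/f is a polynomial in 1/f and the derivative of f, so each order of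
  1/f is obtained from the previous order of 1/f itself.\<close>

lemma Ck_on_inverse:
  fixes f :: "'a::euclidean_space \<Rightarrow> real"
  assumes "open U" "Ck_on k f U" "\<And>x. x \<in> U \<Longrightarrow> f x \<noteq> 0"
  shows "Ck_on k (\<lambda>x. inverse (f x)) U"
  using assms(2)
proof (induction k)
  case 0
  then show ?case using assms(3) by (auto intro: continuous_intros)
next
  case (Suc k)
  note IH = Suc.IH[OF Ck_on_Suc_imp[OF Suc.prems]]
  show ?case
  proof (rule Ck_on_SucI[OF assms(1)])
    show "((\<lambda>x. inverse (f x)) has_derivative (\<lambda>e. - (inverse (f x) * Dif f x e * inverse (f x)))) (at x)"
      if "x \<in> U" for x
      using Deriv.has_derivative_inverse[OF assms(3)[OF that] Ck_on_SucD[OF Suc.prems that]] .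
    show "Ck_on k (\<lambda>x. - (inverse (f x) * Dif f x e * inverse (f x))) U" if "e \<in> Basis" for e
      using Suc.prems that
      by (intro Ck_on_bounded_linear[OF assms(1) bounded_linear_minus[OF bounded_linear_ident]]
          Ck_on_bilinear[OF assms(1) bounded_bilinear_mult] IH) auto
  qed
qed

text \<open>As for the inverse: the derivative of the root involves only the root, one order lower,
  and the derivative of \<open>f\<close>.\<close>

lemma Ck_on_sqrt:
  fixes f :: "'a::euclidean_space \<Rightarrow> real"
  assumes "open U" "Ck_on k f U" "\<And>x. x \<in> U \<Longrightarrow> f x > 0"
  shows "Ck_on k (\<lambda>x. sqrt (f x)) U"
  using assms(2)
proof (induction k)
  case 0
  then show ?case by (auto intro: continuous_intros)
next
  case (Suc k)
  note IH = Suc.IH[OF Ck_on_Suc_imp[OF Suc.prems]]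
  show ?case
  proof (rule Ck_on_SucI[OF assms(1)])
    show "((\<lambda>x. sqrt (f x)) has_derivative (\<lambda>e. Dif f x e * (inverse (sqrt (f x)) / 2))) (at x)"
      if "x \<in> U" for x
      using assms(3)[OF that]
      by (auto intro!: derivative_eq_intros Ck_on_SucD[OF Suc.prems that] simp: field_simps)
    have "Ck_on k (\<lambda>x. inverse (sqrt (f x)) / 2) U"
      using assms(3) by (intro Ck_on_bounded_linear[OF assms(1) bounded_linear_divide]
          Ck_on_inverse[OF assms(1)] IH) force
    then show "Ck_on k (\<lambda>x. Dif f x e * (inverse (sqrt (f x)) / 2)) U" if "e \<in> Basis" for e
      using Suc.prems that
      by (intro Ck_on_bilinear[OF assms(1) bounded_bilinear_mult]) auto
  qed
qed

section \<open>Closure properties of smooth functions\<close>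

lemma smooth_on_cong:
  "open U \<Longrightarrow> (\<And>x. x \<in> U \<Longrightarrow> f x = g x) \<Longrightarrow> smooth_on f U \<Longrightarrow> smooth_on g U"
  using Ck_on_cong unfolding smooth_on_def by blast

lemma smooth_on_subset: "smooth_on f U \<Longrightarrow> V \<subseteq> U \<Longrightarrow> smooth_on f V"
  using Ck_on_subset unfolding smooth_on_def by blast

lemma smooth_onD:
  "smooth_on f U \<Longrightarrow> x \<in> U \<Longrightarrow> (f has_derivative Dif f x) (at x)"
  using Ck_on_SucD[of 0] unfolding smooth_on_def by blast

lemma smooth_on_continuous_on: "smooth_on f U \<Longrightarrow> continuous_on U f"
  unfolding smooth_on_def by (metis Ck_on.simps(1))

lemma smooth_on_Dif: "open U \<Longrightarrow> smooth_on f U \<Longrightarrow> smooth_on (\<lambda>x. Dif f x e) U"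
  using Ck_on_Dif unfolding smooth_on_def by blast

lemma smooth_on_const: "open U \<Longrightarrow> smooth_on (\<lambda>x. c) U"
  unfolding smooth_on_def by simp

lemma smooth_on_bounded_linear:
  "open U \<Longrightarrow> bounded_linear h \<Longrightarrow> smooth_on f U \<Longrightarrow> smooth_on (\<lambda>x. h (f x)) U"
  using Ck_on_bounded_linear unfolding smooth_on_def by blast

lemma smooth_on_bilinear:
  "open U \<Longrightarrow> bounded_bilinear h \<Longrightarrow> smooth_on f U \<Longrightarrow> smooth_on g U \<Longrightarrow> smooth_on (\<lambda>x. h (f x) (g x)) U"
  using Ck_on_bilinear unfolding smooth_on_def by blast

lemma smooth_on_add:
  "open U \<Longrightarrow> smooth_on f U \<Longrightarrow> smooth_on g U \<Longrightarrow> smooth_on (\<lambda>x. f x + g x) U"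
  using Ck_on_add unfolding smooth_on_def by blast

lemma smooth_on_minus: "open U \<Longrightarrow> smooth_on f U \<Longrightarrow> smooth_on (\<lambda>x. - f x) U"
  using smooth_on_bounded_linear[OF _ bounded_linear_minus[OF bounded_linear_ident]] by blast

lemma smooth_on_diff:
  "open U \<Longrightarrow> smooth_on f U \<Longrightarrow> smooth_on g U \<Longrightarrow> smooth_on (\<lambda>x. f x - g x) U"
  using smooth_on_add[of U f "\<lambda>x. - g x"] smooth_on_minus by auto

lemma smooth_on_sum:
  "open U \<Longrightarrow> (\<And>i. i \<in> I \<Longrightarrow> smooth_on (f i) U) \<Longrightarrow> smooth_on (\<lambda>x. \<Sum>i\<in>I. f i x) U"
  unfolding smooth_on_def using Ck_on_sum[of U I] by blast

lemma smooth_on_mult: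
  fixes f g :: "_ \<Rightarrow> real"
  shows "open U \<Longrightarrow> smooth_on f U \<Longrightarrow> smooth_on g U \<Longrightarrow> smooth_on (\<lambda>x. f x * g x) U"
  using smooth_on_bilinear[OF _ bounded_bilinear_mult] by blast

lemma smooth_on_divide_const:
  fixes f :: "_ \<Rightarrow> real"
  shows "open U \<Longrightarrow> smooth_on f U \<Longrightarrow> smooth_on (\<lambda>x. f x / c) U"
  using smooth_on_bounded_linear[OF _ bounded_linear_divide] by blast

lemma smooth_on_prod:
  fixes f :: "'i \<Rightarrow> _ \<Rightarrow> real"
  assumes "open U" "\<And>i. i \<in> I \<Longrightarrow> smooth_on (f i) U"
  shows "smooth_on (\<lambda>x. \<Prod>i\<in>I. f i x) U"
  using assms(2)
  by (induction I rule: infinite_finite_induct) (auto simp: assms(1) smooth_on_const intro!: smooth_on_mult)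

lemma smooth_on_compose:
  fixes f :: "'a::euclidean_space \<Rightarrow> 'b::euclidean_space"
  shows "open U \<Longrightarrow> open V \<Longrightarrow> f ` U \<subseteq> V \<Longrightarrow> smooth_on f U \<Longrightarrow> smooth_on g V \<Longrightarrow> smooth_on (\<lambda>x. g (f x)) U"
  using Ck_on_compose unfolding smooth_on_def by blast

lemma smooth_on_inverse:
  fixes f :: "_ \<Rightarrow> real"
  shows "open U \<Longrightarrow> smooth_on f U \<Longrightarrow> (\<And>x. x \<in> U \<Longrightarrow> f x \<noteq> 0) \<Longrightarrow> smooth_on (\<lambda>x. inverse (f x)) U"
  using Ck_on_inverse unfolding smooth_on_def by blast

lemma smooth_on_sqrt:
  fixes f :: "_ \<Rightarrow> real"
  shows "open U \<Longrightarrow> smooth_on f U \<Longrightarrow> (\<And>x. x \<in> U \<Longrightarrow> f x > 0) \<Longrightarrow> smooth_on (\<lambda>x. sqrt (f x)) U"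
  using Ck_on_sqrt unfolding smooth_on_def by blast

lemma smooth_on_nth: "open U \<Longrightarrow> smooth_on f U \<Longrightarrow> smooth_on (\<lambda>x. f x $ i) U"
  for f :: "_ \<Rightarrow> ('b::euclidean_space) ^ 'n"
  using smooth_on_bounded_linear[OF _ bounded_linear_vec_nth] by blast

section \<open>Smoothness and derivatives of vector and matrix expressions\<close>

lemma bounded_linear_axis: "bounded_linear (axis i :: 'b::real_normed_vector \<Rightarrow> 'b ^ 'n)"
proof (rule bounded_linear_intro[where K = 1])
  fix x :: 'b
  have "(\<Sum>j\<in>UNIV. (norm (axis i x $ j :: 'b))\<^sup>2) = (\<Sum>j\<in>UNIV. if j = i then (norm x)\<^sup>2 else 0)"
    by (rule sum.cong) (auto simp: axis_def)
  then show "norm (axis i x :: 'b ^ 'n) \<le> norm x * 1"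
    by (simp add: norm_vec_def L2_set_def)
qed (auto simp: axis_def vec_eq_iff)

lemma vec_lambda_sum_axis: "(\<chi> i. f i) = (\<Sum>i\<in>UNIV. axis i (f i :: 'b::real_normed_vector))"
  by (simp add: vec_eq_iff axis_def if_distrib cong: if_cong)

lemma smooth_on_vec_lambda:
  fixes f :: "'n::finite \<Rightarrow> _ \<Rightarrow> 'b::euclidean_space"
  assumes "open U" "\<And>i. smooth_on (f i) U"
  shows "smooth_on (\<lambda>x. \<chi> i. f i x) U"
  unfolding vec_lambda_sum_axis
  by (intro smooth_on_sum assms smooth_on_bounded_linear[OF _ bounded_linear_axis])

lemma has_derivative_vec_lambda:
  assumes "\<And>i. ((\<lambda>x. f i x) has_derivative f' i) F"
  shows "((\<lambda>x. (\<chi> i. f i x) :: 'b::real_normed_vector ^ 'n) has_derivative (\<lambda>h. \<chi> i. f' i h)) F"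
  unfolding vec_lambda_sum_axis
  by (intro has_derivative_sum bounded_linear.has_derivative[OF bounded_linear_axis] assms)

lemma bounded_bilinear_matrix_mult:
  "bounded_bilinear ((**) :: real^'a^'b \<Rightarrow> real^'c^'a \<Rightarrow> real^'c^'b)"
proof -
  have "bilinear ((**) :: real^'a^'b \<Rightarrow> real^'c^'a \<Rightarrow> real^'c^'b)"
    unfolding bilinear_def
    by (auto intro!: linearI simp: matrix_matrix_mult_def vec_eq_iff distrib_left distrib_right
        sum.distrib sum_distrib_left mult.assoc mult.left_commute)
  then show ?thesis
    by (simp add: bilinear_conv_bounded_bilinear)
qed

lemma bounded_bilinear_matrix_vector_mult:
  "bounded_bilinear ((*v) :: real^'a^'b \<Rightarrow> real^'a \<Rightarrow> real^'b)"
proof -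
  have "bilinear ((*v) :: real^'a^'b \<Rightarrow> real^'a \<Rightarrow> real^'b)"
    unfolding bilinear_def
    by (auto intro!: linearI simp: matrix_vector_mult_def vec_eq_iff distrib_left distrib_right
        sum.distrib sum_distrib_left mult.assoc mult.left_commute)
  then show ?thesis
    by (simp add: bilinear_conv_bounded_bilinear)
qed

lemma bounded_linear_transpose: "bounded_linear (transpose :: real^'a^'b \<Rightarrow> real^'b^'a)"
proof -
  have "linear (transpose :: real^'a^'b \<Rightarrow> real^'b^'a)"
    by (rule linearI) (simp_all add: transpose_def vec_eq_iff)
  then show ?thesis by (simp add: linear_conv_bounded_linear)
qed

lemma bounded_linear_trace: "bounded_linear (trace :: real^'a^'a \<Rightarrow> real)"
proof -
  have "linear (trace :: real^'a^'a \<Rightarrow> real)"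
    by (rule linearI) (simp_all add: trace_def sum.distrib sum_distrib_left)
  then show ?thesis by (simp add: linear_conv_bounded_linear)
qed

lemmas matrix_mult_simps =
  bounded_bilinear.add_left[OF bounded_bilinear_matrix_mult]
  bounded_bilinear.add_right[OF bounded_bilinear_matrix_mult]
  bounded_bilinear.diff_left[OF bounded_bilinear_matrix_mult]
  bounded_bilinear.diff_right[OF bounded_bilinear_matrix_mult]
  bounded_bilinear.minus_left[OF bounded_bilinear_matrix_mult]
  bounded_bilinear.minus_right[OF bounded_bilinear_matrix_mult]

lemmas has_derivative_matrix_mult = bounded_bilinear.FDERIV[OF bounded_bilinear_matrix_mult]
lemmas has_derivative_matrix_vector_mult = bounded_bilinear.FDERIV[OF bounded_bilinear_matrix_vector_mult]
lemmas has_derivative_transpose = bounded_linear.has_derivative[OF bounded_linear_transpose]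
lemmas smooth_on_matrix_mult = smooth_on_bilinear[OF _ bounded_bilinear_matrix_mult]
lemmas smooth_on_matrix_vector_mult = smooth_on_bilinear[OF _ bounded_bilinear_matrix_vector_mult]
lemmas smooth_on_transpose = smooth_on_bounded_linear[OF _ bounded_linear_transpose]
lemmas smooth_on_inner = smooth_on_bilinear[OF _ bounded_bilinear_inner]

lemma smooth_on_det:
  fixes f :: "_ \<Rightarrow> real^'n^'n"
  shows "open U \<Longrightarrow> smooth_on f U \<Longrightarrow> smooth_on (\<lambda>x. det (f x)) U"
  unfolding det_def
  by (intro smooth_on_sum smooth_on_mult smooth_on_const smooth_on_prod smooth_on_nth) auto

lemma matrix_inv_mult:
  fixes A :: "real^'n^'n"
  assumes "invertible A"
  shows "A ** matrix_inv A = mat 1" "matrix_inv A ** A = mat 1"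
  using someI_ex[OF assms[unfolded invertible_def]] by (auto simp: matrix_inv_def)

text \<open>Cramer's rule for the \<open>j\<close>-th unit vector. It exhibits the entries of the
  inverse as quotients of determinants, which makes the inverse of a smooth matrix function
  smooth.\<close>

lemma matrix_inv_component:
  fixes A :: "real^'n^'n"
  assumes "invertible A"
  shows "matrix_inv A $ k $ j = det (\<chi> i l. if l = k then axis j 1 $ i else A $ i $ l) * inverse (det A)"
proof -
  have "det A \<noteq> 0"
    using assms invertible_det_nz by blast
  moreover have "A *v (matrix_inv A *v axis j 1) = axis j 1"
    using matrix_inv_mult[OF assms] by (simp add: matrix_vector_mul_assoc)
  ultimately have "matrix_inv A *v axis j 1 =
      (\<chi> k. det (\<chi> i l. if l = k then axis j 1 $ i else A $ i $ l) / det A)"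
    using cramer by blast
  moreover have "(matrix_inv A *v axis j 1) $ k = matrix_inv A $ k $ j"
    by (simp add: matrix_vector_mult_basis column_def)
  ultimately show ?thesis
    by (simp add: divide_inverse)
qed

lemma smooth_on_matrix_inv:
  fixes f :: "_ \<Rightarrow> real^'n^'n"
  assumes "open U" "smooth_on f U" "\<And>x. x \<in> U \<Longrightarrow> invertible (f x)"
  shows "smooth_on (\<lambda>x. matrix_inv (f x)) U"
proof (rule smooth_on_cong[OF assms(1)])
  show "(\<chi> k j. det (\<chi> i l. if l = k then axis j 1 $ i else f x $ i $ l) * inverse (det (f x))) = matrix_inv (f x)"
    if "x \<in> U" for x
    by (simp add: vec_eq_iff matrix_inv_component[OF assms(3)[OF that]])
  have "smooth_on (\<lambda>x. if l = k then c else f x $ i $ l) U" for k i l c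
    by (cases "l = k") (auto intro!: smooth_on_const smooth_on_nth assms)
  then show "smooth_on (\<lambda>x. \<chi> k j. det (\<chi> i l. if l = k then axis j 1 $ i else f x $ i $ l) * inverse (det (f x))) U"
    using assms(3)
    by (intro smooth_on_vec_lambda smooth_on_mult smooth_on_inverse smooth_on_det assms)
      (auto simp flip: invertible_det_nz)
qed

lemma smooth_on_matrix:
  fixes L :: "_ \<Rightarrow> real^'a \<Rightarrow> real^'b"
  assumes "open U" "\<And>e. smooth_on (\<lambda>x. L x e) U"
  shows "smooth_on (\<lambda>x. matrix (L x)) U"
  unfolding matrix_def by (intro smooth_on_vec_lambda smooth_on_nth assms)

text \<open>The second difference of \<open>f\<close> over a small parallelogram is symmetric in the
  two sides. The mean value theorem, applied twice in either order, turns it into h^2 times a mixed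
  derivative at a nearby point, so by continuity the two mixed derivatives agree.\<close>

lemma real_symmetric_second_derivative:
  fixes f :: "'a::euclidean_space \<Rightarrow> real"
  assumes U: "open U" and x: "x \<in> U" and f: "smooth_on f U"
  shows "Dif (\<lambda>y. Dif f y a) x b = Dif (\<lambda>y. Dif f y b) x a"
proof (rule ccontr)
  define P where "P a b = (\<lambda>y. Dif (\<lambda>y. Dif f y a) y b)" for a b
  assume "\<not> ?thesis"
  then have ne: "P a b x \<noteq> P b a x" by (simp add: P_def)
  \<comment> \<open>With half the gap as tolerance, values of the two mixed derivatives taken close
    to \<open>x\<close> cannot coincide.\<close>
  define d where "d = \<bar>P a b x - P b a x\<bar> / 2"
  have d: "d > 0" using ne by (simp add: d_def)
  have "continuous_on U (P a b)" for a b
    unfolding P_def by (intro smooth_on_continuous_on smooth_on_Dif U f)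
  then have "continuous (at x) (P a b)" for a b
    using U x continuous_on_eq_continuous_at by blast
  then have ev: "\<forall>\<^sub>F y in at x. dist (P a b y) (P a b x) < d" for a b
    using d unfolding continuous_at tendsto_iff by blast
  have "\<forall>\<^sub>F y in at x. y \<in> U" using U x by (simp add: eventually_at_topological) blast
  with ev[of a b] ev[of b a]
  have "\<forall>\<^sub>F y in at x. dist (P a b y) (P a b x) < d \<and> dist (P b a y) (P b a x) < d \<and> y \<in> U"
    by eventually_elim simp
  then obtain r where r: "r > 0" and rr: "\<And>y. y \<noteq> x \<Longrightarrow> dist y x < r \<Longrightarrow>
      dist (P a b y) (P a b x) < d \<and> dist (P b a y) (P b a x) < d \<and> y \<in> U"
    unfolding eventually_at by auto
  have near: "dist (P a b y) (P a b x) < d \<and> dist (P b a y) (P b a x) < d \<and> y \<in> U" if "dist y x < r" for y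
    using rr[of y] that x d by (cases "y = x") auto
  \<comment> \<open>Keeps the parallelogram within distance r/2 of \<open>x\<close>; the summand 1
    makes the denominator positive also for zero directions.\<close>
  define h where "h = r / (2 * (norm a + norm b + 1))"
  have h: "h > 0" using r by (simp add: h_def add_nonneg_pos)
  have close: "dist (x + s *\<^sub>R a + t *\<^sub>R b) x < r" if "0 \<le> s" "s \<le> h" "0 \<le> t" "t \<le> h" for s t
  proof -
    have "norm (s *\<^sub>R a + t *\<^sub>R b) \<le> s * norm a + t * norm b"
      using that norm_triangle_ineq[of "s *\<^sub>R a" "t *\<^sub>R b"] by simp
    also have "\<dots> \<le> h * norm a + h * norm b"
      using that by (intro add_mono mult_right_mono) auto
    also have "\<dots> \<le> h * (norm a + norm b + 1)" using h by (simp add: algebra_simps)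
    also have "\<dots> = r / 2"
    proof -
      have "k > 0 \<Longrightarrow> r / (2 * k) * k = r / 2" for k :: real by simp
      then show ?thesis unfolding h_def by (simp only: add_nonneg_pos norm_ge_zero add_nonneg_nonneg zero_less_one)
    qed
    also have "\<dots> < r" using r by simp
    finally show ?thesis by (simp add: dist_norm add.assoc)
  qed
  \<comment> \<open>\<open>a\<close> and \<open>b\<close> are rebound here, so that the claim can be
    used for both orders of differentiation with the same \<open>h\<close>.\<close>
  have gen: "\<exists>y. dist y x < r \<and> f (x + h *\<^sub>R a + h *\<^sub>R b) - f (x + h *\<^sub>R a) - f (x + h *\<^sub>R b) + f x = h * (h * P a b y)"
    if close: "\<And>s t. 0 \<le> s \<Longrightarrow> s \<le> h \<Longrightarrow> 0 \<le> t \<Longrightarrow> t \<le> h \<Longrightarrow> dist (x + s *\<^sub>R a + t *\<^sub>R b) x < r"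
      and near: "\<And>y. dist y x < r \<Longrightarrow> y \<in> U" for a b
  proof -
    have der: "((\<lambda>s. F (p + s *\<^sub>R q)) has_derivative (\<lambda>k. k * Dif F (p + s *\<^sub>R q) q)) (at s within T)"
      if "p + s *\<^sub>R q \<in> U" and F: "smooth_on F U" for F :: "'a \<Rightarrow> real" and p q s T
    proof -
      have D: "(F has_derivative Dif F (p + s *\<^sub>R q)) (at (p + s *\<^sub>R q))"
        using smooth_onD[OF F that(1)] .
      have "((\<lambda>s. F (p + s *\<^sub>R q)) has_derivative (\<lambda>k. Dif F (p + s *\<^sub>R q) (k *\<^sub>R q))) (at s within T)"
        by (rule has_derivative_compose[where f = "\<lambda>s. p + s *\<^sub>R q" and g = F, OF _ D])
          (auto intro!: derivative_eq_intros)
      then show ?thesis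
        by (simp add: linear_scale[OF has_derivative_linear[OF D]])
    qed
    define u where "u s = f (x + h *\<^sub>R b + s *\<^sub>R a) - f (x + s *\<^sub>R a)" for s
    have U1: "x + h *\<^sub>R b + s *\<^sub>R a \<in> U" "x + s *\<^sub>R a \<in> U" if "0 \<le> s" "s \<le> h" for s
      using close[of s h, THEN near] close[of s 0, THEN near] that h by (auto simp: algebra_simps)
    have ud: "(u has_derivative (\<lambda>k. k * Dif f (x + h *\<^sub>R b + s *\<^sub>R a) a - k * Dif f (x + s *\<^sub>R a) a)) (at s within {0..h})"
      if "0 \<le> s" "s \<le> h" for s
      unfolding u_def by (intro has_derivative_diff der U1 that f)
    have "\<exists>s\<in>{0<..<h}. u h - u 0 =
        (h - 0) * Dif f (x + h *\<^sub>R b + s *\<^sub>R a) a - (h - 0) * Dif f (x + s *\<^sub>R a) a"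
      by (rule mvt_simple[OF h ud])
    then obtain s where s: "0 < s" "s < h"
      and us: "u h - u 0 = h * (Dif f (x + h *\<^sub>R b + s *\<^sub>R a) a - Dif f (x + s *\<^sub>R a) a)"
      by (auto simp: right_diff_distrib)
    define w where "w t = Dif f (x + s *\<^sub>R a + t *\<^sub>R b) a" for t
    have U2: "x + s *\<^sub>R a + t *\<^sub>R b \<in> U" if "0 \<le> t" "t \<le> h" for t
      using close[of s t] that s near by auto
    have wd: "(w has_derivative (\<lambda>k. k * P a b (x + s *\<^sub>R a + t *\<^sub>R b))) (at t within {0..h})"
      if "0 \<le> t" "t \<le> h" for t
      unfolding w_def P_def by (intro der U2 that smooth_on_Dif U f)
    have "\<exists>t\<in>{0<..<h}. w h - w 0 = (h - 0) * P a b (x + s *\<^sub>R a + t *\<^sub>R b)"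
      by (rule mvt_simple[OF h wd])
    then obtain t where t: "0 < t" "t < h" and wt: "w h - w 0 = h * P a b (x + s *\<^sub>R a + t *\<^sub>R b)"
      by auto
    have "u h - u 0 = h * (w h - w 0)"
      unfolding us w_def by (simp add: add_ac)
    then show ?thesis
      using close[of s t] s t unfolding wt by (intro exI[of _ "x + s *\<^sub>R a + t *\<^sub>R b"]) (simp add: u_def algebra_simps)
  qed
  obtain y where y: "dist y x < r"
    "f (x + h *\<^sub>R a + h *\<^sub>R b) - f (x + h *\<^sub>R a) - f (x + h *\<^sub>R b) + f x = h * (h * P a b y)"
    using gen[OF close] near by blast
  have close': "dist (x + s *\<^sub>R b + t *\<^sub>R a) x < r" if "0 \<le> s" "s \<le> h" "0 \<le> t" "t \<le> h" for s t
    using close[of t s] that by (simp add: add_ac)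
  obtain y' where y': "dist y' x < r"
    "f (x + h *\<^sub>R b + h *\<^sub>R a) - f (x + h *\<^sub>R b) - f (x + h *\<^sub>R a) + f x = h * (h * P b a y')"
    using gen[OF close'] near by blast
  have "h * (h * P a b y) = h * (h * P b a y')"
    using y(2) y'(2) by (simp add: algebra_simps)
  then have "P a b y = P b a y'" using h by simp
  then show False
    using near[OF y(1)] near[OF y'(1)] unfolding d_def dist_real_def by argo
qed

lemma Dif_bounded_linear:
  assumes "bounded_linear h" "(f has_derivative f') (at x)"
  shows "Dif (\<lambda>y. h (f y)) x = (\<lambda>e. h (f' e))"
  by (rule Dif_eq[OF bounded_linear.has_derivative[OF assms]])

lemma symmetric_second_derivative:
  fixes f :: "'a::euclidean_space \<Rightarrow> 'b::euclidean_space"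
  assumes U: "open U" and x: "x \<in> U" and f: "smooth_on f U"
  shows "Dif (\<lambda>y. Dif f y a) x b = Dif (\<lambda>y. Dif f y b) x a"
proof (rule euclidean_eqI)
  fix k :: 'b
  have 1: "Dif (\<lambda>z. f z \<bullet> k) y = (\<lambda>e. Dif f y e \<bullet> k)" if "y \<in> U" for y
    by (rule Dif_bounded_linear[OF bounded_linear_inner_left smooth_onD[OF f that]])
  have 2: "Dif (\<lambda>y. Dif (\<lambda>z. f z \<bullet> k) y a) x b = Dif (\<lambda>y. Dif f y a) x b \<bullet> k" for a b
  proof -
    have "Dif (\<lambda>y. Dif (\<lambda>z. f z \<bullet> k) y a) x b = Dif (\<lambda>y. Dif f y a \<bullet> k) x b"
      by (subst Dif_cong_open[OF U x, of _ "\<lambda>y. Dif f y a \<bullet> k"]) (simp_all add: 1)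
    then show ?thesis
      using Dif_bounded_linear[OF bounded_linear_inner_left smooth_onD[OF smooth_on_Dif[OF U f] x]]
      by simp
  qed
  show "Dif (\<lambda>y. Dif f y a) x b \<bullet> k = Dif (\<lambda>y. Dif f y b) x a \<bullet> k"
    using real_symmetric_second_derivative[OF U x smooth_on_bounded_linear[OF U bounded_linear_inner_left f]]
    unfolding 2[symmetric] .
qed

lemma matrix_eq_columns: "(\<And>i. A *v axis i 1 = B *v axis i 1) \<Longrightarrow> A = B"
  for A B :: "real^'n^'m"
  by (simp add: vec_eq_iff matrix_vector_mult_basis column_def)

text \<open>Since \<open>H = (H ** matrix_inv A) ** A\<close>, row \<open>i\<close> of
  \<open>H\<close> is a combination of the rows of \<open>A\<close>, and only the coefficient of row
  \<open>i\<close> itself survives in the determinant.\<close>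

lemma det_row_replace:
  fixes A H :: "real^'n^'n"
  assumes "invertible A"
  shows "det (\<chi> r c. if r = i then H $ i $ c else A $ r $ c) = (H ** matrix_inv A) $ i $ i * det A"
proof -
  let ?x = "(H ** matrix_inv A) $ i"
  have "transpose A *v ?x = H $ i"
  proof -
    have "H = (H ** matrix_inv A) ** A"
      using matrix_inv_mult(2)[OF assms] by (simp flip: matrix_mul_assoc)
    then have "H $ i $ c = ((H ** matrix_inv A) ** A) $ i $ c" for c by simp
    then have "H $ i $ c = (\<Sum>k\<in>UNIV. (H ** matrix_inv A) $ i $ k * A $ k $ c)" for c
      unfolding matrix_matrix_mult_def[of "H ** matrix_inv A" A] by simp
    then show ?thesis
      unfolding vec_eq_iff matrix_vector_mult_def transpose_def by (simp add: mult.commute)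
  qed
  moreover have "(\<Sum>j\<in>UNIV. ?x $ j *s row j A) = transpose A *v ?x"
    unfolding vec_eq_iff matrix_vector_mult_def transpose_def row_def vector_scalar_mult_def
    by (simp add: mult.commute)
  ultimately have H: "H $ i = (\<Sum>j\<in>UNIV. ?x $ j *s row j A)"
    by simp
  have "det (\<chi> r. if r = i then H $ i else row r A) = ?x $ i * det A"
    unfolding H using cramer_lemma_transpose[of i ?x A] by simp
  also have "(\<chi> r. if r = i then H $ i else row r A) = (\<chi> r c. if r = i then H $ i $ c else A $ r $ c)"
    by (simp add: vec_eq_iff row_def)
  finally show ?thesis .
qed

text \<open>Jacobi's formula. The Leibniz expansion is differentiated one factor at a time;
  collecting the terms by the row of the differentiated factor gives determinants with a single row
  replaced.\<close>

lemma has_derivative_det: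
  fixes f :: "'a::real_normed_vector \<Rightarrow> real^'n^'n"
  assumes f: "(f has_derivative f') (at x within S)" and inv: "invertible (f x)"
  shows "((\<lambda>y. det (f y)) has_derivative (\<lambda>h. det (f x) * trace (matrix_inv (f x) ** f' h))) (at x within S)"
proof -
  have c: "((\<lambda>y. f y $ i $ j) has_derivative (\<lambda>h. f' h $ i $ j)) (at x within S)" for i j
    by (intro bounded_linear.has_derivative[OF bounded_linear_vec_nth] f)
  have "((\<lambda>y. det (f y)) has_derivative (\<lambda>h. \<Sum>p | p permutes UNIV.
      of_int (sign p) * (\<Sum>i\<in>UNIV. f' h $ i $ p i * (\<Prod>j\<in>UNIV - {i}. f x $ j $ p j)))) (at x within S)"
    unfolding det_def by (intro has_derivative_sum has_derivative_mult_right has_derivative_prod c)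
  moreover have "(\<Sum>p | p permutes UNIV.
      of_int (sign p) * (\<Sum>i\<in>UNIV. f' h $ i $ p i * (\<Prod>j\<in>UNIV - {i}. f x $ j $ p j))) =
      det (f x) * trace (matrix_inv (f x) ** f' h)" for h
  proof -
    have p: "(\<Prod>r\<in>UNIV. if r = i then f' h $ i $ p r else f x $ r $ p r) =
        f' h $ i $ p i * (\<Prod>j\<in>UNIV - {i}. f x $ j $ p j)" for i and p :: "'n \<Rightarrow> 'n"
      by (subst prod.remove[of _ i]) (auto intro!: prod.cong)
    have "(\<Sum>p | p permutes UNIV.
      of_int (sign p) * (\<Sum>i\<in>UNIV. f' h $ i $ p i * (\<Prod>j\<in>UNIV - {i}. f x $ j $ p j))) =
      (\<Sum>i\<in>UNIV. det (\<chi> r c. if r = i then f' h $ i $ c else f x $ r $ c))"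
      unfolding det_def by (simp add: sum_distrib_left p[symmetric] if_distrib[where f = "\<lambda>v. v $ _"] cong: if_cong)
        (rule sum.swap)
    also have "\<dots> = trace (f' h ** matrix_inv (f x)) * det (f x)"
      by (simp add: det_row_replace[OF inv] trace_def sum_distrib_right)
    finally show ?thesis
      by (simp add: trace_mul_sym[of "f' h"] mult.commute)
  qed
  ultimately show ?thesis by (simp only:)
qed

section \<open>Connections in coordinates\<close>

lemma Dif_axis_expansion:
  fixes f :: "real^'n \<Rightarrow> real"
  assumes "(f has_derivative f') (at x)"
  shows "Dif f x a = (\<Sum>i\<in>UNIV. partial i f x * a $ i)"
proof -
  have l: "linear f'" using assms has_derivative_linear by blast
  have "f' a = f' (\<Sum>i\<in>UNIV. a $ i *\<^sub>R axis i 1)"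
    by (simp add: basis_expansion[of a, unfolded scalar_mult_eq_scaleR])
  also have "\<dots> = (\<Sum>i\<in>UNIV. a $ i *\<^sub>R f' (axis i 1))"
    by (simp add: linear_sum[OF l] linear_scale[OF l])
  finally show ?thesis
    by (simp add: partial_def Dif_eq[OF assms] mult.commute)
qed

definition metric_on :: "(real^'n \<Rightarrow> real^'n^'n) \<Rightarrow> (real^'n) set \<Rightarrow> bool" where
  "metric_on G U \<longleftrightarrow> open U \<and> smooth_on G U \<and>
     (\<forall>x\<in>U. transpose (G x) = G x \<and> (\<forall>X. X \<noteq> 0 \<longrightarrow> X \<bullet> (G x *v X) > 0))"

text \<open>\<open>conn G x a\<close> is the matrix of the Christoffel map \<open>b \<mapsto> \<Gamma>(a, b)\<close>, and \<open>curv G x a b\<close> that of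
  \<open>R(a, b)\<close>.\<close>

definition conn :: "(real^'n \<Rightarrow> real^'n^'n) \<Rightarrow> real^'n \<Rightarrow> real^'n \<Rightarrow> real^'n^'n" where
  "conn G x a = (\<chi> k j. \<Sum>i\<in>UNIV. christoffel G x k i j * a $ i)"

definition curv :: "(real^'n \<Rightarrow> real^'n^'n) \<Rightarrow> real^'n \<Rightarrow> real^'n \<Rightarrow> real^'n \<Rightarrow> real^'n^'n" where
  "curv G x a b = (\<chi> l k. \<Sum>i\<in>UNIV. \<Sum>j\<in>UNIV. riemann G x l k i j * a $ i * b $ j)"

lemma posdef_invertible:
  fixes A :: "real^'n^'n"
  assumes "\<And>X. X \<noteq> 0 \<Longrightarrow> X \<bullet> (A *v X) > 0"
  shows "invertible A"
proof -
  have "A *v X = 0 \<Longrightarrow> X = 0" for X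
    using assms[of X] by (cases "X = 0") auto
  then show ?thesis
    by (simp add: invertible_left_inverse matrix_left_invertible_ker)
qed

lemma inner_matrix_transpose: "(A *v x) \<bullet> y = x \<bullet> (transpose A *v y)" for A :: "real^'a^'b"
  by (simp add: dot_lmul_matrix[symmetric] inner_commute)

lemma matrix_eq_inner: "(\<And>x y. x \<bullet> (A *v y) = x \<bullet> (B *v y)) \<Longrightarrow> A = B" for A B :: "real^'a^'b"
  by (metis matrix_eq vector_eq_rdot inner_commute)

section \<open>Levi-Civita connection and curvature of a metric on an open set\<close>

context
  fixes G :: "real^'n::finite \<Rightarrow> real^'n^'n" and U :: "(real^'n) set"
  assumes G: "metric_on G U"
begin

lemma metric_open: "open U" and metric_smooth: "smooth_on G U"
  using G by (auto simp: metric_on_def)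

lemma metric_symmetric: "x \<in> U \<Longrightarrow> transpose (G x) = G x"
  and metric_pos: "x \<in> U \<Longrightarrow> X \<noteq> 0 \<Longrightarrow> X \<bullet> (G x *v X) > 0"
  using G by (auto simp: metric_on_def)

lemma metric_invertible: "x \<in> U \<Longrightarrow> invertible (G x)"
  by (rule posdef_invertible) (rule metric_pos)

lemma metric_inner_commute: "x \<in> U \<Longrightarrow> a \<bullet> (G x *v b) = b \<bullet> (G x *v a)"
  by (metis inner_commute inner_matrix_transpose metric_symmetric)

lemma smooth_on_christoffel: "smooth_on (\<lambda>x. christoffel G x k i j) U"
proof -
  have "smooth_on (\<lambda>x. partial l (\<lambda>y. G y $ a $ b) x) U" for l a b
    unfolding partial_def
    by (intro smooth_on_Dif smooth_on_nth metric_open metric_smooth)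
  then show ?thesis
    unfolding christoffel_def
    by (intro smooth_on_divide_const smooth_on_sum smooth_on_mult smooth_on_nth smooth_on_add
        smooth_on_diff smooth_on_matrix_inv metric_open metric_smooth metric_invertible) auto
qed

lemma smooth_on_conn: "smooth_on (\<lambda>x. conn G x a) U"
  unfolding conn_def
  by (intro smooth_on_vec_lambda smooth_on_sum smooth_on_mult smooth_on_christoffel smooth_on_const
      metric_open)

lemma conn_torsion_free:
  assumes "x \<in> U"
  shows "conn G x a *v b = conn G x b *v a"
proof -
  have "(conn G x a *v b) $ k = (conn G x b *v a) $ k" for k
  proof -
    have "(conn G x a *v b) $ k = (\<Sum>j\<in>UNIV. \<Sum>i\<in>UNIV. christoffel G x k i j * a $ i * b $ j)"
      by (simp add: matrix_vector_mult_def conn_def sum_distrib_right)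
    also have "\<dots> = (\<Sum>i\<in>UNIV. \<Sum>j\<in>UNIV. christoffel G x k i j * a $ i * b $ j)"
      by (rule sum.swap)
    also have "\<dots> = (\<Sum>i\<in>UNIV. \<Sum>j\<in>UNIV. christoffel G x k j i * b $ j * a $ i)"
      using christoffel_torsion_free[OF metric_open assms metric_symmetric]
      by (intro sum.cong refl) (simp add: mult_ac)
    finally show ?thesis
      by (simp add: matrix_vector_mult_def conn_def sum_distrib_right)
  qed
  then show ?thesis by (simp add: vec_eq_iff)
qed

lemma conn_metric:
  assumes x: "x \<in> U"
  shows "Dif G x a = transpose (conn G x a) ** G x + G x ** conn G x a"
proof -
  have d: "(G has_derivative Dif G x) (at x)"
    using smooth_onD[OF metric_smooth x] .
  have c: "((\<lambda>y. G y $ i $ j) has_derivative (\<lambda>h. Dif G x h $ i $ j)) (at x)" for i j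
    by (intro bounded_linear.has_derivative[OF bounded_linear_vec_nth] d)
  have "Dif G x a $ i $ j = (transpose (conn G x a) ** G x + G x ** conn G x a) $ i $ j" for i j
  proof -
    have "Dif G x a $ i $ j = (\<Sum>k\<in>UNIV. partial k (\<lambda>y. G y $ i $ j) x * a $ k)"
      using Dif_axis_expansion[OF c] by (simp add: Dif_eq[OF c])
    also have "\<dots> = (\<Sum>k\<in>UNIV. ((\<Sum>l\<in>UNIV. christoffel G x l k i * G x $ l $ j) +
        (\<Sum>l\<in>UNIV. christoffel G x l k j * G x $ i $ l)) * a $ k)"
      using christoffel_metric[of U x G, OF metric_open x metric_symmetric metric_invertible[OF x]] by simp
    also have "\<dots> = (\<Sum>k\<in>UNIV. \<Sum>l\<in>UNIV. christoffel G x l k i * a $ k * G x $ l $ j) +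
        (\<Sum>k\<in>UNIV. \<Sum>l\<in>UNIV. G x $ i $ l * (christoffel G x l k j * a $ k))"
      by (simp add: sum.distrib distrib_left distrib_right sum_distrib_left sum_distrib_right mult_ac)
    also have "\<dots> = (\<Sum>l\<in>UNIV. \<Sum>k\<in>UNIV. christoffel G x l k i * a $ k * G x $ l $ j) +
        (\<Sum>l\<in>UNIV. \<Sum>k\<in>UNIV. G x $ i $ l * (christoffel G x l k j * a $ k))"
      by (intro arg_cong2[where f = "(+)"] sum.swap)
    finally show ?thesis
      by (simp add: matrix_matrix_mult_def transpose_def conn_def sum_distrib_right sum_distrib_left)
  qed
  then show ?thesis by (simp add: vec_eq_iff)
qed

text \<open>Turns the index formula into the structure equation for the connection matrix; the
  bracket term is absent because \<open>a\<close> and \<open>b\<close> are constant fields.\<close>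

lemma curv_conn:
  assumes x: "x \<in> U"
  shows "curv G x a b = Dif (\<lambda>y. conn G y b) x a - Dif (\<lambda>y. conn G y a) x b +
    conn G x a ** conn G x b - conn G x b ** conn G x a"
proof -
  have c: "((\<lambda>y. christoffel G y k i j) has_derivative Dif (\<lambda>y. christoffel G y k i j) x) (at x)" for k i j
    using smooth_onD[OF smooth_on_christoffel x] .
  have D: "Dif (\<lambda>y. conn G y b) x a $ l $ k =
      (\<Sum>i\<in>UNIV. \<Sum>j\<in>UNIV. partial i (\<lambda>y. christoffel G y l j k) x * a $ i * b $ j)" for a b l k
  proof -
    have "((\<lambda>y. conn G y b) has_derivative
        (\<lambda>h. \<chi> k j. \<Sum>i\<in>UNIV. Dif (\<lambda>y. christoffel G y k i j) x h * b $ i)) (at x)"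
      unfolding conn_def
      by (intro has_derivative_vec_lambda has_derivative_sum has_derivative_mult_left c)
    then have "Dif (\<lambda>y. conn G y b) x a $ l $ k = (\<Sum>j\<in>UNIV. Dif (\<lambda>y. christoffel G y l j k) x a * b $ j)"
      by (simp add: Dif_eq)
    also have "\<dots> = (\<Sum>j\<in>UNIV. \<Sum>i\<in>UNIV. partial i (\<lambda>y. christoffel G y l j k) x * a $ i * b $ j)"
      by (simp add: Dif_axis_expansion[OF c] sum_distrib_right)
    finally show ?thesis
      using sum.swap by (rule trans)
  qed
  have D': "Dif (\<lambda>y. conn G y a) x b $ l $ k =
      (\<Sum>i\<in>UNIV. \<Sum>j\<in>UNIV. partial j (\<lambda>y. christoffel G y l i k) x * a $ i * b $ j)" for l k
    unfolding D by (subst sum.swap) (simp add: mult_ac)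
  have P: "(conn G x a ** conn G x b) $ l $ k =
      (\<Sum>i\<in>UNIV. \<Sum>j\<in>UNIV. (\<Sum>p\<in>UNIV. christoffel G x l i p * christoffel G x p j k) * a $ i * b $ j)"
    for a b l k
  proof -
    have "(conn G x a ** conn G x b) $ l $ k = (\<Sum>p\<in>UNIV. \<Sum>i\<in>UNIV. \<Sum>j\<in>UNIV.
        (christoffel G x l i p * christoffel G x p j k) * a $ i * b $ j)"
      by (simp add: matrix_matrix_mult_def conn_def sum_product mult_ac)
    also have "\<dots> = (\<Sum>i\<in>UNIV. \<Sum>p\<in>UNIV. \<Sum>j\<in>UNIV.
        (christoffel G x l i p * christoffel G x p j k) * a $ i * b $ j)"
      by (rule sum.swap)
    also have "\<dots> = (\<Sum>i\<in>UNIV. \<Sum>j\<in>UNIV. \<Sum>p\<in>UNIV.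
        (christoffel G x l i p * christoffel G x p j k) * a $ i * b $ j)"
      by (rule sum.cong[OF refl]) (rule sum.swap)
    finally show ?thesis by (simp add: sum_distrib_right)
  qed
  have P': "(conn G x b ** conn G x a) $ l $ k =
      (\<Sum>i\<in>UNIV. \<Sum>j\<in>UNIV. (\<Sum>p\<in>UNIV. christoffel G x l j p * christoffel G x p i k) * a $ i * b $ j)"
    for l k
    unfolding P by (subst sum.swap) (simp add: mult_ac)
  show ?thesis
    unfolding vec_eq_iff curv_def riemann_def vec_lambda_beta vector_add_component vector_minus_component
      D[where a = a and b = b] D' P[where a = a and b = b] P'
    by (simp add: sum.distrib sum_subtractf distrib_right left_diff_distrib)
qed

lemma conn_bounded_linear: "bounded_linear (conn G x)"
proof -
  have "linear (conn G x)"
    by (rule linearI) (simp_all add: conn_def vec_eq_iff algebra_simps sum.distrib sum_distrib_left)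
  then show ?thesis by (simp add: linear_conv_bounded_linear)
qed

text \<open>Differentiating metric compatibility once more gives the second derivatives of
  \<open>G\<close> in terms of \<open>conn\<close>. As these commute, the curvature is skew with
  respect to \<open>G\<close>.\<close>

lemma curv_skew:
  assumes x: "x \<in> U"
  shows "w \<bullet> (G x *v (curv G x a b *v w)) = 0"
proof -
  let ?\<Gamma> = "conn G"
  have s: "Dif (\<lambda>y. Dif G y a) x b = Dif (\<lambda>y. Dif G y b) x a"
    by (rule symmetric_second_derivative[OF metric_open x metric_smooth])
  have d: "(G has_derivative Dif G x) (at x)"
    using smooth_onD[OF metric_smooth x] .
  have dG: "((\<lambda>y. conn G y c) has_derivative Dif (\<lambda>y. conn G y c) x) (at x)" for c
    using smooth_onD[OF smooth_on_conn x] .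
  have *: "Dif (\<lambda>y. Dif G y a) x b =
      transpose (?\<Gamma> x a) ** Dif G x b + transpose (Dif (\<lambda>y. ?\<Gamma> y a) x b) ** G x +
      (G x ** Dif (\<lambda>y. ?\<Gamma> y a) x b + Dif G x b ** ?\<Gamma> x a)" for a b
  proof -
    have "Dif (\<lambda>y. Dif G y a) x = Dif (\<lambda>y. transpose (?\<Gamma> y a) ** G y + G y ** ?\<Gamma> y a) x"
      by (rule Dif_cong_open[OF metric_open x conn_metric])
    also have "\<dots> = (\<lambda>b. transpose (?\<Gamma> x a) ** Dif G x b + transpose (Dif (\<lambda>y. ?\<Gamma> y a) x b) ** G x +
      (G x ** Dif (\<lambda>y. ?\<Gamma> y a) x b + Dif G x b ** ?\<Gamma> x a))"
      by (intro Dif_eq has_derivative_add has_derivative_matrix_mult has_derivative_transpose d dG)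
    finally show ?thesis by simp
  qed
  define R where "R = curv G x a b"
  have tr: "transpose (A + B) = transpose A + transpose B" "transpose (A - B) = transpose A - transpose B"
    for A B :: "real^'n^'n"
    by (simp_all add: transpose_def vec_eq_iff)
  \<comment> \<open>The mixed terms transpose(\<Gamma>(a)) G \<Gamma>(b) + transpose(\<Gamma>(b)) G
    \<Gamma>(a) are symmetric in \<open>a\<close> and \<open>b\<close> and cancel; what is left is
    the curvature and its transpose.\<close>
  have "transpose R ** G x + G x ** R = 0"
    using s unfolding *[of a b] *[of b a] R_def curv_conn[OF x] conn_metric[OF x]
    by (simp add: matrix_mult_simps tr matrix_transpose_mul matrix_mul_assoc algebra_simps)
  then have "w \<bullet> ((transpose R ** G x + G x ** R) *v w) = 0" by simp
  then have "w \<bullet> (transpose R *v (G x *v w)) + w \<bullet> (G x *v (R *v w)) = 0"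
    by (simp add: matrix_vector_mult_add_rdistrib inner_add_right matrix_vector_mul_assoc)
  moreover have "w \<bullet> (transpose R *v (G x *v w)) = w \<bullet> (G x *v (R *v w))"
    by (metis inner_matrix_transpose metric_inner_commute[OF x])
  ultimately show ?thesis by (simp add: R_def)
qed

lemma ricci_trace:
  "a \<bullet> (ricci G x *v b) = trace (matrix (\<lambda>X. curv G x X a *v b))"
proof -
  have "matrix (\<lambda>X. curv G x X a *v b) $ i $ i = (\<Sum>k\<in>UNIV. \<Sum>j\<in>UNIV. riemann G x i k i j * a $ j * b $ k)" for i
  proof -
    have *: "(\<Sum>j\<in>UNIV. riemann G x i k l j * axis i 1 $ l * a $ j) =
        (if l = i then \<Sum>j\<in>UNIV. riemann G x i k i j * a $ j else 0)" for k l
      by (auto simp: axis_def)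
    show ?thesis
      unfolding matrix_def matrix_vector_mult_def curv_def vec_lambda_beta *
      by (simp add: sum_distrib_right)
  qed
  then have "trace (matrix (\<lambda>X. curv G x X a *v b)) =
      (\<Sum>i\<in>UNIV. \<Sum>k\<in>UNIV. \<Sum>j\<in>UNIV. riemann G x i k i j * a $ j * b $ k)"
    by (simp add: trace_def)
  also have "\<dots> = (\<Sum>k\<in>UNIV. \<Sum>i\<in>UNIV. \<Sum>j\<in>UNIV. riemann G x i k i j * a $ j * b $ k)"
    by (rule sum.swap)
  also have "\<dots> = (\<Sum>k\<in>UNIV. \<Sum>j\<in>UNIV. \<Sum>i\<in>UNIV. riemann G x i k i j * a $ j * b $ k)"
    by (rule sum.cong[OF refl]) (rule sum.swap)
  also have "\<dots> = (\<Sum>j\<in>UNIV. \<Sum>k\<in>UNIV. \<Sum>i\<in>UNIV. riemann G x i k i j * a $ j * b $ k)"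
    by (rule sum.swap)
  also have "\<dots> = a \<bullet> (ricci G x *v b)"
    by (simp add: ricci_def inner_vec_def matrix_vector_mult_def sum_distrib_left sum_distrib_right mult_ac)
  finally show ?thesis by simp
qed

text \<open>The alternating sum of three instances of metric compatibility, in which
  torsion-freeness cancels all but one connection term. It recovers \<open>conn\<close> from the
  first derivatives of the metric, which is the way to its transformation law.\<close>

lemma koszul:
  assumes x: "x \<in> U"
  shows "2 * (z \<bullet> (G x *v (conn G x a *v b))) =
    b \<bullet> (Dif G x a *v z) + a \<bullet> (Dif G x b *v z) - a \<bullet> (Dif G x z *v b)"
proof -
  have e: "u \<bullet> (Dif G x c *v w) = w \<bullet> (G x *v (conn G x c *v u)) + u \<bullet> (G x *v (conn G x c *v w))" for u c w
  proof -
    have "u \<bullet> (transpose (conn G x c) *v (G x *v w)) = w \<bullet> (G x *v (conn G x c *v u))"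
      by (metis inner_matrix_transpose metric_inner_commute[OF x])
    then show ?thesis
      by (simp add: conn_metric[OF x] matrix_vector_mult_add_rdistrib inner_add_right
          matrix_vector_mul_assoc)
  qed
  show ?thesis
    unfolding e conn_torsion_free[OF x, of b a] conn_torsion_free[OF x, of z a]
      conn_torsion_free[OF x, of z b] by simp
qed

end

text \<open>Differentiating the pullback relation of the metrics produces Hessian terms of \<tau>.
  Inserted into the Koszul formula for both metrics, these collapse by symmetry of the Hessian to
  the single inhomogeneous term.\<close>

lemma conn_transform:
  fixes G G' :: "real^'n::finite \<Rightarrow> real^'n^'n"
  assumes G: "metric_on G U" and G': "metric_on G' U'"
    and \<tau>: "smooth_on \<tau> W" "open W" "W \<subseteq> U" "\<tau> ` W \<subseteq> U'" and x: "x \<in> W"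
    and pull: "\<And>y X Y. y \<in> W \<Longrightarrow> X \<bullet> (G y *v Y) = Dif \<tau> y X \<bullet> (G' (\<tau> y) *v Dif \<tau> y Y)"
  shows "Dif \<tau> x (conn G x a *v b) =
    conn G' (\<tau> x) (Dif \<tau> x a) *v Dif \<tau> x b + Dif (\<lambda>y. Dif \<tau> y b) x a"
proof -
  have xU: "x \<in> U" and xU': "\<tau> x \<in> U'" using \<tau> x by auto
  note d\<tau> = smooth_onD[OF \<tau>(1)]
  define T where "T = Dif \<tau> x"
  define H where "H a b = Dif (\<lambda>y. Dif \<tau> y b) x a" for a b
  have Hs: "H a b = H b a" for a b
    unfolding H_def by (rule symmetric_second_derivative[OF \<tau>(2) x \<tau>(1)])
  have T: "linear T" unfolding T_def using d\<tau>[OF x] has_derivative_linear by blast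
  have dH: "((\<lambda>y. Dif \<tau> y b) has_derivative (\<lambda>a. H a b)) (at x)" for b
    unfolding H_def by (rule smooth_onD[OF smooth_on_Dif[OF \<tau>(2,1)] x])
  have dG: "(G has_derivative Dif G x) (at x)"
    using smooth_onD[OF metric_smooth[OF G] xU] .
  have dG': "((\<lambda>y. G' (\<tau> y)) has_derivative (\<lambda>a. Dif G' (\<tau> x) (T a))) (at x)"
    unfolding T_def
    by (rule has_derivative_compose[OF d\<tau>[OF x] smooth_onD[OF metric_smooth[OF G'] xU']])
  have D: "u \<bullet> (Dif G x c *v w) = T u \<bullet> (Dif G' (\<tau> x) (T c) *v T w) + H c u \<bullet> (G' (\<tau> x) *v T w)
      + T u \<bullet> (G' (\<tau> x) *v H c w)" for u c w
  proof -
    have "((\<lambda>y. u \<bullet> (G y *v w)) has_derivative (\<lambda>c. u \<bullet> (Dif G x c *v w))) (at x)"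
      by (intro has_derivative_inner_right bounded_linear.has_derivative[OF
            bounded_bilinear.bounded_linear_left[OF bounded_bilinear_matrix_vector_mult]] dG)
    moreover have "((\<lambda>y. Dif \<tau> y u \<bullet> (G' (\<tau> y) *v Dif \<tau> y w)) has_derivative
        (\<lambda>c. T u \<bullet> (G' (\<tau> x) *v H c w + Dif G' (\<tau> x) (T c) *v T w) + H c u \<bullet> (G' (\<tau> x) *v T w))) (at x)"
      unfolding T_def by (intro has_derivative_inner has_derivative_matrix_vector_mult dH dG'[unfolded T_def])
    ultimately have "(\<lambda>c. u \<bullet> (Dif G x c *v w)) =
        (\<lambda>c. T u \<bullet> (G' (\<tau> x) *v H c w + Dif G' (\<tau> x) (T c) *v T w) + H c u \<bullet> (G' (\<tau> x) *v T w))"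
      using has_derivative_cong_open[OF \<tau>(2) x, of "\<lambda>y. u \<bullet> (G y *v w)" "\<lambda>y. Dif \<tau> y u \<bullet> (G' (\<tau> y) *v Dif \<tau> y w)"]
        pull has_derivative_unique by blast
    then have "u \<bullet> (Dif G x c *v w) = T u \<bullet> (G' (\<tau> x) *v H c w + Dif G' (\<tau> x) (T c) *v T w) + H c u \<bullet> (G' (\<tau> x) *v T w)"
      by (rule fun_cong)
    then show ?thesis by (simp add: inner_add_right)
  qed
  \<comment> \<open>The pulled-back metric is positive, so \<open>T\<close> has no kernel. It is
    then surjective, and testing against the vectors \<open>T z\<close> determines a vector.\<close>
  have inj: "inj T"
  proof -
    have "X = 0" if "T X = 0" for X
      using pull[OF x, of X X] metric_pos[OF G xU, of X] that by (cases "X = 0") (auto simp: T_def)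
    then show ?thesis using T by (simp add: linear_injective_0)
  qed
  then have surj: "surj T" using T linear_injective_imp_surjective by blast
  have "T z \<bullet> (G' (\<tau> x) *v T (conn G x a *v b)) =
      T z \<bullet> (G' (\<tau> x) *v (conn G' (\<tau> x) (T a) *v T b + H a b))" for z
  proof -
    have "2 * (T z \<bullet> (G' (\<tau> x) *v T (conn G x a *v b))) = 2 * (z \<bullet> (G x *v (conn G x a *v b)))"
      using pull[OF x] by (simp add: T_def)
    also have "\<dots> = 2 * (T z \<bullet> (G' (\<tau> x) *v (conn G' (\<tau> x) (T a) *v T b + H a b)))"
      unfolding koszul[OF G xU] D
      using koszul[OF G' xU', of "T z" "T a" "T b"] Hs[of a z] Hs[of b z] Hs[of b a]
        metric_inner_commute[OF G' xU', of "T b"] metric_inner_commute[OF G' xU', of "T a"]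
        metric_inner_commute[OF G' xU', of "T z"]
      by (simp add: matrix_vector_right_distrib inner_add_right)
    finally show ?thesis by simp
  qed
  then have "y \<bullet> (G' (\<tau> x) *v T (conn G x a *v b)) =
      y \<bullet> (G' (\<tau> x) *v (conn G' (\<tau> x) (T a) *v T b + H a b))" for y
    using surj by (metis surjD)
  then have "G' (\<tau> x) *v T (conn G x a *v b) = G' (\<tau> x) *v (conn G' (\<tau> x) (T a) *v T b + H a b)"
    by (metis vector_eq_ldot)
  then have "T (conn G x a *v b) = conn G' (\<tau> x) (T a) *v T b + H a b"
    using metric_invertible[OF G' xU'] by (metis matrix_inv_mult(2) matrix_vector_mul_assoc matrix_vector_mul_lid)
  then show ?thesis by (simp add: T_def H_def)
qed

text \<open>Covariant derivatives in the direction \<open>d\<close> of vector fields along \<open>F\<close>; \<open>covm\<close> acts on the columns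
  of a matrix.\<close>

definition cov :: "(real^'n \<Rightarrow> real^'n^'n) \<Rightarrow> ('p::real_normed_vector \<Rightarrow> real^'n) \<Rightarrow> ('p \<Rightarrow> real^'n) \<Rightarrow> 'p \<Rightarrow> 'p \<Rightarrow> real^'n" where
  "cov G F Z d z = Dif Z z d + conn G (F z) (Dif F z d) *v Z z"

definition covm :: "(real^'n \<Rightarrow> real^'n^'n) \<Rightarrow> ('p::real_normed_vector \<Rightarrow> real^'n) \<Rightarrow> ('p \<Rightarrow> real^'m^'n) \<Rightarrow> 'p \<Rightarrow> 'p \<Rightarrow> real^'m^'n" where
  "covm G F Z d z = Dif Z z d + conn G (F z) (Dif F z d) ** Z z"

text \<open>Differentiating \<open>Z'\<close> by the product rule yields a second derivative of
  \<tau>, and the inhomogeneous term of \<open>conn_transform\<close> cancels exactly this.\<close>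

lemma cov_transform:
  fixes G G' :: "real^'n::finite \<Rightarrow> real^'n^'n" and F :: "'p::euclidean_space \<Rightarrow> real^'n"
  assumes G: "metric_on G U" and G': "metric_on G' U'"
    and \<tau>: "smooth_on \<tau> W" "open W" "W \<subseteq> U" "\<tau> ` W \<subseteq> U'"
    and pull: "\<And>y X Y. y \<in> W \<Longrightarrow> X \<bullet> (G y *v Y) = Dif \<tau> y X \<bullet> (G' (\<tau> y) *v Dif \<tau> y Y)"
    and O: "open \<Omega>" "z \<in> \<Omega>" "F ` \<Omega> \<subseteq> W" "smooth_on F \<Omega>" "smooth_on Z \<Omega>"
    and F': "\<And>y. y \<in> \<Omega> \<Longrightarrow> F' y = \<tau> (F y)" and Z': "\<And>y. y \<in> \<Omega> \<Longrightarrow> Z' y = Dif \<tau> (F y) (Z y)"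
  shows "cov G' F' Z' d z = Dif \<tau> (F z) (cov G F Z d z)"
proof -
  have Fz: "F z \<in> W" using O by auto
  note d\<tau> = smooth_onD[OF \<tau>(1) Fz]
  note dF = smooth_onD[OF O(4,2)] and dZ = smooth_onD[OF O(5,2)]
  have DF': "Dif F' z d = Dif \<tau> (F z) (Dif F z d)"
    using Dif_cong_open[OF O(1,2) F'] Dif_eq[OF has_derivative_compose[OF dF d\<tau>]] by simp
  \<comment> \<open>As matrices, the differentials of \<tau> at a moving point are accessible to the
    product rule for the bilinear matrix-vector product.\<close>
  let ?m = "\<lambda>y. matrix (Dif \<tau> y)"
  have lin: "linear (Dif \<tau> y)" if "y \<in> W" for y
    using smooth_onD[OF \<tau>(1) that] has_derivative_linear by blast
  have m: "?m y *v w = Dif \<tau> y w" if "y \<in> W" for y w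
    using matrix_works[OF lin[OF that, unfolded linear_matrix_vector_mul_eq[symmetric]]] lin[OF that]
    by (simp add: matrix_works)
  have sm: "smooth_on ?m W"
    by (intro smooth_on_matrix smooth_on_Dif \<tau>)
  have dm: "((\<lambda>y. ?m (F y)) has_derivative (\<lambda>d. Dif ?m (F z) (Dif F z d))) (at z)"
    by (rule has_derivative_compose[OF dF smooth_onD[OF sm Fz]])
  have Dm: "Dif ?m (F z) a *v w = Dif (\<lambda>y. Dif \<tau> y w) (F z) a" for a w
  proof -
    have "Dif (\<lambda>y. Dif \<tau> y w) (F z) = Dif (\<lambda>y. ?m y *v w) (F z)"
      by (rule Dif_cong_open[OF \<tau>(2) Fz]) (simp add: m)
    also have "\<dots> = (\<lambda>a. Dif ?m (F z) a *v w)"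
      by (rule Dif_bounded_linear[OF bounded_bilinear.bounded_linear_left[OF bounded_bilinear_matrix_vector_mult]
            smooth_onD[OF sm Fz]])
    finally show ?thesis by simp
  qed
  have "Dif Z' z = Dif (\<lambda>y. ?m (F y) *v Z y) z"
    by (rule Dif_cong_open[OF O(1,2)]) (use O m Z' in auto)
  also have "\<dots> = (\<lambda>d. ?m (F z) *v Dif Z z d + Dif ?m (F z) (Dif F z d) *v Z z)"
    by (intro Dif_eq has_derivative_matrix_vector_mult dm dZ)
  finally have DZ': "Dif Z' z d = Dif \<tau> (F z) (Dif Z z d) + Dif (\<lambda>y. Dif \<tau> y (Z z)) (F z) (Dif F z d)"
    by (simp add: m Fz Dm)
  have "Dif \<tau> (F z) (conn G (F z) (Dif F z d) *v Z z) = conn G' (\<tau> (F z)) (Dif \<tau> (F z) (Dif F z d)) *v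
      Dif \<tau> (F z) (Z z) + Dif (\<lambda>y. Dif \<tau> y (Z z)) (F z) (Dif F z d)"
    by (rule conn_transform[OF G G' \<tau> Fz pull])
  then show ?thesis
    unfolding cov_def DF' DZ' F'[OF O(2)] Z'[OF O(2)] linear_add[OF lin[OF Fz]] by simp
qed

lemma covm_vector: "(Z has_derivative Z') (at z) \<Longrightarrow> covm G F Z d z *v w = cov G F (\<lambda>y. Z y *v w) d z"
  unfolding cov_def covm_def
  by (simp add: Dif_bounded_linear[OF bounded_bilinear.bounded_linear_left[OF bounded_bilinear_matrix_vector_mult]]
      Dif_eq matrix_vector_mult_add_rdistrib matrix_vector_mul_assoc)

section \<open>Covariant derivatives along a map into an open set\<close>

context
  fixes G :: "real^'n::finite \<Rightarrow> real^'n^'n" and U :: "(real^'n) set"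
    and F :: "'p::euclidean_space \<Rightarrow> real^'n" and \<Omega> :: "'p set"
  assumes G: "metric_on G U" and O: "open \<Omega>" and FU: "F ` \<Omega> \<subseteq> U" and F: "smooth_on F \<Omega>"
begin

lemma FU': "z \<in> \<Omega> \<Longrightarrow> F z \<in> U" using FU by auto

lemma has_derivative_along_metric:
  "z \<in> \<Omega> \<Longrightarrow> ((\<lambda>z. G (F z)) has_derivative (\<lambda>d. transpose (conn G (F z) (Dif F z d)) ** G (F z) +
      G (F z) ** conn G (F z) (Dif F z d))) (at z)"
  using has_derivative_compose[OF smooth_onD[OF F] smooth_onD[OF metric_smooth[OF G] FU']]
  by (simp add: conn_metric[OF G FU'])

text \<open>Metric compatibility splits the derivative of \<open>G\<close> along \<open>F\<close>
  into two connection terms, one completing each ordinary derivative to a covariant one.\<close>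

lemma has_derivative_inner_along:
  assumes z: "z \<in> \<Omega>" and Z: "(Z has_derivative Z') (at z)" and W: "(W has_derivative W') (at z)"
  shows "((\<lambda>y. Z y \<bullet> (G (F y) *v W y)) has_derivative
    (\<lambda>d. cov G F Z d z \<bullet> (G (F z) *v W z) + Z z \<bullet> (G (F z) *v cov G F W d z))) (at z)"
proof -
  have "((\<lambda>y. Z y \<bullet> (G (F y) *v W y)) has_derivative (\<lambda>d. Z z \<bullet> (G (F z) *v W' d +
      (transpose (conn G (F z) (Dif F z d)) ** G (F z) + G (F z) ** conn G (F z) (Dif F z d)) *v W z)
      + Z' d \<bullet> (G (F z) *v W z))) (at z)"
    by (intro has_derivative_inner has_derivative_matrix_vector_mult has_derivative_along_metric z Z W)
  moreover have "a \<bullet> (transpose B *v c) = (B *v a) \<bullet> c" for a c and B :: "real^'n^'n"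
    using inner_matrix_transpose[of B a c] by simp
  ultimately show ?thesis
    by (simp add: cov_def Dif_eq[OF Z] Dif_eq[OF W] inner_add_right inner_add_left add_ac
        matrix_vector_right_distrib matrix_vector_mult_add_rdistrib
        flip: matrix_vector_mul_assoc)
qed

lemma has_derivative_matrix_along:
  fixes Z :: "'p \<Rightarrow> real^'k^'n" and W :: "'p \<Rightarrow> real^'l^'n"
  assumes z: "z \<in> \<Omega>" and Z: "(Z has_derivative Z') (at z)" and W: "(W has_derivative W') (at z)"
  shows "((\<lambda>y. transpose (Z y) ** G (F y) ** W y) has_derivative
    (\<lambda>d. transpose (covm G F Z d z) ** G (F z) ** W z + transpose (Z z) ** G (F z) ** covm G F W d z)) (at z)"
proof -
  have tr: "transpose (A + B) = transpose A + transpose B" for A B :: "real^'k^'n"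
    by (simp_all add: transpose_def vec_eq_iff)
  have "((\<lambda>y. transpose (Z y) ** G (F y) ** W y) has_derivative
    (\<lambda>d. transpose (Z z) ** G (F z) ** W' d + (transpose (Z z) **
      (transpose (conn G (F z) (Dif F z d)) ** G (F z) + G (F z) ** conn G (F z) (Dif F z d)) +
      transpose (Z' d) ** G (F z)) ** W z)) (at z)"
    by (intro has_derivative_matrix_mult has_derivative_transpose has_derivative_along_metric z Z W)
  then show ?thesis
    by (simp add: covm_def Dif_eq[OF Z] Dif_eq[OF W] matrix_mult_simps tr matrix_transpose_mul
        matrix_mul_assoc add_ac)
qed

lemma smooth_on_conn_along:
  assumes c: "smooth_on c \<Omega>"
  shows "smooth_on (\<lambda>z. conn G (F z) (c z)) \<Omega>"
  unfolding conn_def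
  by (intro smooth_on_vec_lambda smooth_on_sum smooth_on_mult smooth_on_nth c O
      smooth_on_compose[OF O metric_open[OF G] FU F smooth_on_christoffel[OF G]])

lemma smooth_on_cov: "smooth_on Z \<Omega> \<Longrightarrow> smooth_on (\<lambda>z. cov G F Z d z) \<Omega>"
  unfolding cov_def
  by (intro smooth_on_add smooth_on_matrix_vector_mult smooth_on_Dif smooth_on_conn_along O F)

text \<open>The second derivatives of \<open>Z\<close> and of \<open>F\<close> are symmetric and
  drop out of the commutator; the remaining terms are those of \<open>curv_conn\<close>.\<close>

lemma cov_commute:
  assumes z: "z \<in> \<Omega>" and Z: "smooth_on Z \<Omega>"
  shows "cov G F (\<lambda>z. cov G F Z e z) d z - cov G F (\<lambda>z. cov G F Z d z) e z =
    curv G (F z) (Dif F z d) (Dif F z e) *v Z z"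
proof -
  let ?T = "\<lambda>d z. Dif F z d"
  note Uz = FU'[OF z]
  note dF = smooth_onD[OF F z]
  have dT: "((\<lambda>z. ?T e z) has_derivative (\<lambda>d. Dif (?T e) z d)) (at z)" for e
    by (rule smooth_onD[OF smooth_on_Dif[OF O F] z])
  have dZ: "((\<lambda>z. Dif Z z e) has_derivative (\<lambda>d. Dif (\<lambda>z. Dif Z z e) z d)) (at z)" for e
    by (rule smooth_onD[OF smooth_on_Dif[OF O Z] z])
  \<comment> \<open>Both arguments of \<open>conn\<close> move. As it is linear in the direction, it
    is expanded over the axes, where only the base point varies.\<close>
  have gam: "((\<lambda>y. conn G (F y) (c y)) has_derivative
      (\<lambda>d. Dif (\<lambda>x. conn G x (c z)) (F z) (Dif F z d) + conn G (F z) (c' d))) (at z)"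
    if c: "(c has_derivative c') (at z)" for c c'
  proof -
    have ax: "conn G x a = (\<Sum>i\<in>UNIV. a $ i *\<^sub>R conn G x (axis i 1))" for x a
    proof -
      have "conn G x (\<Sum>i\<in>UNIV. a $ i *\<^sub>R axis i 1) = (\<Sum>i\<in>UNIV. a $ i *\<^sub>R conn G x (axis i 1))"
        using bounded_linear.linear[OF conn_bounded_linear[OF G]] by (simp add: linear_sum linear_scale)
      then show ?thesis by (simp add: basis_expansion[of a, unfolded scalar_mult_eq_scaleR])
    qed
    have dg: "((\<lambda>y. conn G y a) has_derivative Dif (\<lambda>y. conn G y a) (F z)) (at (F z))" for a
      by (rule smooth_onD[OF smooth_on_conn[OF G] Uz])
    have "((\<lambda>y. \<Sum>i\<in>UNIV. c y $ i *\<^sub>R conn G (F y) (axis i 1)) has_derivative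
        (\<lambda>d. \<Sum>i\<in>UNIV. c z $ i *\<^sub>R Dif (\<lambda>x. conn G x (axis i 1)) (F z) (Dif F z d) +
           c' d $ i *\<^sub>R conn G (F z) (axis i 1))) (at z)"
      by (intro has_derivative_sum has_derivative_scaleR bounded_linear.has_derivative[OF bounded_linear_vec_nth] c
          has_derivative_compose[OF dF dg])
    moreover have "Dif (\<lambda>x. conn G x (c z)) (F z) b = (\<Sum>i\<in>UNIV. c z $ i *\<^sub>R Dif (\<lambda>x. conn G x (axis i 1)) (F z) b)" for b
    proof -
      have "((\<lambda>x. \<Sum>i\<in>UNIV. c z $ i *\<^sub>R conn G x (axis i 1)) has_derivative
          (\<lambda>b. \<Sum>i\<in>UNIV. c z $ i *\<^sub>R Dif (\<lambda>x. conn G x (axis i 1)) (F z) b)) (at (F z))"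
        by (intro has_derivative_sum has_derivative_scaleR_right dg)
      then show ?thesis by (simp add: Dif_eq flip: ax)
    qed
    ultimately show ?thesis
      by (simp add: sum.distrib flip: ax)
  qed
  have "Dif (\<lambda>z. cov G F Z e z) z = (\<lambda>d. Dif (\<lambda>z. Dif Z z e) z d +
      (conn G (F z) (?T e z) *v Dif Z z d + (Dif (\<lambda>x. conn G x (?T e z)) (F z) (?T d z) +
         conn G (F z) (Dif (?T e) z d)) *v Z z))" for e
    unfolding cov_def
    by (intro Dif_eq has_derivative_add dZ has_derivative_matrix_vector_mult
        smooth_onD[OF Z z] gam dT)
  then have 1: "cov G F (\<lambda>z. cov G F Z e z) d z = Dif (\<lambda>z. Dif Z z e) z d +
      (conn G (F z) (?T e z) *v Dif Z z d + (Dif (\<lambda>x. conn G x (?T e z)) (F z) (?T d z) +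
         conn G (F z) (Dif (?T e) z d)) *v Z z) +
      conn G (F z) (?T d z) *v (Dif Z z e + conn G (F z) (?T e z) *v Z z)" for d e
    unfolding cov_def[of G F "\<lambda>z. cov G F Z e z" d z] unfolding cov_def[of G F Z e z] by simp
  show ?thesis
    unfolding 1 curv_conn[OF G Uz] symmetric_second_derivative[OF O z F, of e d]
      symmetric_second_derivative[OF O z Z, of e d]
    by (simp add: matrix_vector_right_distrib matrix_vector_mult_add_rdistrib
        matrix_vector_mult_diff_rdistrib matrix_vector_mul_assoc)
qed

text \<open>The symmetry lemma for parametrised maps. It yields the symmetry of the second
  fundamental form and, in the divergence of Y, the exchange of a direction with the field.\<close>

lemma cov_torsion_free:
  assumes z: "z \<in> \<Omega>"
  shows "cov G F (\<lambda>z. Dif F z e) d z = cov G F (\<lambda>z. Dif F z d) e z"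
  unfolding cov_def symmetric_second_derivative[OF O z F, of e d]
    conn_torsion_free[OF G FU'[OF z], of "Dif F z e"] ..

end

section \<open>Tangential projection\<close>

lemma matrix_works_real: "linear f \<Longrightarrow> matrix f *v x = f x" for f :: "real^'a \<Rightarrow> real^'b"
  by (simp add: matrix_works linear_matrix_vector_mul_eq)

lemma transpose_add: "transpose (A + B) = transpose A + transpose B" for A B :: "real^'a^'b"
  by (simp add: transpose_def vec_eq_iff)

lemma trace_minus: "trace (- A) = - trace A" for A :: "real^'a^'a"
  by (simp add: trace_def sum_negf)

lemma trace_transpose: "trace (transpose A) = trace A"
  by (simp add: trace_def transpose_def)

text \<open>The coordinates, with respect to the columns of \<open>E\<close>, of the \<open>g\<close>-orthogonal projection onto
  the span of these columns.\<close>

definition tproj :: "real^'n^'n \<Rightarrow> real^'m^'n \<Rightarrow> real^'n^'m" where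
  "tproj g E = matrix_inv (transpose E ** g ** E) ** transpose E ** g"

lemma matrix_inv_unique: "A ** B = mat 1 \<Longrightarrow> matrix_inv A = B" for A B :: "real^'a^'a"
  by (metis invertible_right_inverse matrix_inv_mult(2) matrix_mul_assoc matrix_mul_lid matrix_mul_rid)

lemma matrix_inv_mult_distrib:
  fixes A B :: "real^'a^'a"
  assumes "invertible A" "invertible B"
  shows "matrix_inv (A ** B) = matrix_inv B ** matrix_inv A"
proof (rule matrix_inv_unique)
  have "A ** B ** (matrix_inv B ** matrix_inv A) = A ** (B ** matrix_inv B) ** matrix_inv A"
    by (simp add: matrix_mul_assoc)
  then show "A ** B ** (matrix_inv B ** matrix_inv A) = mat 1"
    by (simp add: matrix_inv_mult[OF assms(1)] matrix_inv_mult[OF assms(2)])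
qed

lemma invertible_transpose: "invertible A \<Longrightarrow> invertible (transpose A)" for A :: "real^'a^'a"
  by (simp add: invertible_det_nz)

lemma matrix_inv_symmetric:
  fixes A :: "real^'a^'a"
  assumes "invertible A" "transpose A = A"
  shows "transpose (matrix_inv A) = matrix_inv A"
proof -
  have "A ** transpose (matrix_inv A) = transpose (matrix_inv A ** A)"
    by (simp add: matrix_transpose_mul assms(2))
  then show ?thesis
    using matrix_inv_mult[OF assms(1)] by (metis matrix_inv_unique transpose_mat)
qed

lemma gram_invertible:
  fixes E :: "real^'m^'n"
  assumes "\<And>X. X \<noteq> 0 \<Longrightarrow> X \<bullet> (g *v X) > 0" "inj ((*v) E)"
  shows "invertible (transpose E ** g ** E)"
    and "X \<noteq> 0 \<Longrightarrow> X \<bullet> ((transpose E ** g ** E) *v X) > 0"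
proof -
  show *: "X \<bullet> ((transpose E ** g ** E) *v X) > 0" if "X \<noteq> 0" for X
  proof -
    have "E *v X \<noteq> 0"
      using assms(2) that by (metis inj_eq matrix_vector_mult_0_right)
    then have "(E *v X) \<bullet> (g *v (E *v X)) > 0" by (rule assms(1))
    then show ?thesis
      by (simp add: inner_matrix_transpose matrix_vector_mul_assoc matrix_mul_assoc)
  qed
  show "invertible (transpose E ** g ** E)"
    by (rule posdef_invertible) (rule *)
qed

lemma tproj_left_inverse:
  fixes E :: "real^'m^'n"
  assumes "\<And>X. X \<noteq> 0 \<Longrightarrow> X \<bullet> (g *v X) > 0" "inj ((*v) E)"
  shows "tproj g E ** E = mat 1"
  using matrix_inv_mult(2)[OF gram_invertible(1)[OF assms]]
  by (simp add: tproj_def flip: matrix_mul_assoc)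

text \<open>The remainder \<open>r\<close> is orthogonal to the columns of \<open>E\<close> and to
  \<nu>. By dimension these span the whole space, so \<open>r\<close> is orthogonal to
  itself.\<close>

lemma tangent_normal_decomposition:
  fixes E :: "real^'m::finite^'n::finite"
  assumes card: "CARD('n) = CARD('m) + 1"
    and pos: "\<And>X. X \<noteq> 0 \<Longrightarrow> X \<bullet> (g *v X) > 0" and sym: "transpose g = g"
    and inj: "inj ((*v) E)"
    and normal: "\<And>X. (E *v X) \<bullet> (g *v \<nu>) = 0" and unit: "\<nu> \<bullet> (g *v \<nu>) = 1"
  shows "E *v (tproj g E *v w) + (w \<bullet> (g *v \<nu>)) *\<^sub>R \<nu> = w"
proof -
  define r where "r = w - E *v (tproj g E *v w) - (w \<bullet> (g *v \<nu>)) *\<^sub>R \<nu>"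
  have comm: "a \<bullet> (g *v b) = b \<bullet> (g *v a)" for a b
    by (metis inner_commute inner_matrix_transpose sym)
  have rN: "\<nu> \<bullet> (g *v r) = 0"
    unfolding r_def by (subst comm) (simp add: inner_diff_left normal unit)
  have rE: "(E *v X) \<bullet> (g *v r) = 0" for X
  proof -
    have "(transpose E ** g ** E) ** (matrix_inv (transpose E ** g ** E) ** transpose E ** g) = transpose E ** g"
      using matrix_inv_mult(1)[OF gram_invertible(1)[OF pos inj]] by (simp add: matrix_mul_assoc)
    then have "(transpose E ** g) *v (w - E *v (tproj g E *v w)) = 0"
      by (simp add: tproj_def matrix_vector_mult_diff_distrib matrix_vector_mul_assoc matrix_mul_assoc)
    then have "X \<bullet> ((transpose E ** g) *v (w - E *v (tproj g E *v w))) = 0" by simp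
    then have "(E *v X) \<bullet> (g *v (w - E *v (tproj g E *v w))) = 0"
      by (simp add: inner_matrix_transpose matrix_vector_mul_assoc)
    then show ?thesis
      using normal[of X]
      by (simp add: r_def matrix_vector_mult_diff_distrib matrix_vector_mult_scaleR inner_diff_right)
  qed
  \<comment> \<open>An injective linear map between spaces of dimensions m + 1 and CARD('n); by
    \<open>card\<close> it is onto.\<close>
  define L where "L = (\<lambda>(X, t). E *v X + t *\<^sub>R \<nu>)"
  have L: "linear L"
    unfolding L_def by (rule linearI)
      (auto simp: algebra_simps matrix_vector_right_distrib matrix_vector_mult_scaleR scaleR_add_left)
  have "inj L"
  proof -
    have "x = 0" if "L x = 0" for x
    proof -
      obtain X t where x: "x = (X, t)" by force
      then have e: "E *v X + t *\<^sub>R \<nu> = 0" using that by (simp add: L_def)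
      then have "(E *v X + t *\<^sub>R \<nu>) \<bullet> (g *v \<nu>) = 0" by simp
      then have t: "t = 0" by (simp add: inner_add_left normal unit)
      then have "E *v X = E *v 0" using e by simp
      then have "X = 0" by (rule injD[OF inj])
      with t x show ?thesis by (simp add: zero_prod_def)
    qed
    then show ?thesis using L by (simp add: linear_injective_0)
  qed
  then have "dim (range L) = DIM((real^'m) \<times> real)"
    using dim_image_eq[OF L, of UNIV] by (simp add: dim_UNIV inj_on_subset)
  then have "dim (range L) = DIM(real^'n)" by (simp add: card)
  then have "range L = UNIV"
    using L by (metis dim_eq_full span_eq_iff linear_subspace_image subspace_UNIV)
  then obtain X t where "r = E *v X + t *\<^sub>R \<nu>"
    by (metis L_def case_prod_conv surjD surj_pair)
  then have "r \<bullet> (g *v r) = 0"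
    using rN rE[of X] by (metis add.right_neutral inner_add_left inner_scaleR_left mult_zero_right)
  then have "r = 0" using pos[of r] by (cases "r = 0") auto
  then show ?thesis by (simp add: r_def algebra_simps)
qed

text \<open>A change of chart on the hypersurface multiplies the frame by an invertible
  \<open>P\<close> on the right. The projected vector stays the same, so its coordinates change by
  the inverse of \<open>P\<close>.\<close>

lemma tproj_reparametrize:
  fixes E :: "real^'m^'n" and P :: "real^'m^'m"
  assumes pos: "\<And>X. X \<noteq> 0 \<Longrightarrow> X \<bullet> (g *v X) > 0" and inj: "inj ((*v) E)" and P: "invertible P"
  shows "P ** tproj g (E ** P) = tproj g E"
proof -
  let ?I = "transpose E ** g ** E"
  have I: "invertible ?I" by (rule gram_invertible(1)[OF pos inj])
  have "transpose (E ** P) ** g ** (E ** P) = transpose P ** (?I ** P)"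
    by (simp add: matrix_transpose_mul matrix_mul_assoc)
  then have "matrix_inv (transpose (E ** P) ** g ** (E ** P)) = matrix_inv P ** matrix_inv ?I ** matrix_inv (transpose P)"
    by (simp only: matrix_inv_mult_distrib[OF invertible_transpose[OF P] invertible_mult[OF I P]]
        matrix_inv_mult_distrib[OF I P])
  then have "P ** tproj g (E ** P) = (P ** matrix_inv P) ** matrix_inv ?I ** (matrix_inv (transpose P) ** transpose P) ** transpose E ** g"
    by (simp add: tproj_def matrix_transpose_mul matrix_mul_assoc)
  then show ?thesis
    by (simp add: matrix_inv_mult P invertible_transpose tproj_def)
qed

text \<open>For a change of chart in the ambient manifold with differential \<open>T\<close>:
  pulling back the metric amounts to pushing the frame forward.\<close>

lemma tproj_change_chart:
  "tproj (transpose T ** g ** T) E = tproj g (T ** E) ** T"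
  by (simp add: tproj_def matrix_transpose_mul matrix_mul_assoc)

text \<open>Brings the fourfold sum into a form to which transposition and cyclic permutation under
  the trace apply.\<close>

lemma tensor_inner_trace:
  "tensor_inner g h k = trace (transpose h ** (matrix_inv g ** k ** transpose (matrix_inv g)))"
proof -
  let ?J = "matrix_inv g"
  have "tensor_inner g h k = (\<Sum>i\<in>UNIV. \<Sum>j\<in>UNIV. h $ i $ j * (?J ** k ** transpose ?J) $ i $ j)"
  proof -
    have "(\<Sum>a\<in>UNIV. \<Sum>b\<in>UNIV. ?J $ i $ a * ?J $ j $ b * h $ i $ j * k $ a $ b) =
        h $ i $ j * (?J ** k ** transpose ?J) $ i $ j" for i j
    proof -
      have "(?J ** k ** transpose ?J) $ i $ j = (\<Sum>b\<in>UNIV. \<Sum>a\<in>UNIV. ?J $ i $ a * k $ a $ b * ?J $ j $ b)"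
        by (simp add: matrix_matrix_mult_def transpose_def sum_distrib_right)
      also have "\<dots> = (\<Sum>a\<in>UNIV. \<Sum>b\<in>UNIV. ?J $ i $ a * k $ a $ b * ?J $ j $ b)"
        by (rule sum.swap)
      finally show ?thesis by (simp add: sum_distrib_left mult_ac)
    qed
    then show ?thesis by (simp add: tensor_inner_def)
  qed
  also have "\<dots> = (\<Sum>j\<in>UNIV. \<Sum>i\<in>UNIV. h $ i $ j * (?J ** k ** transpose ?J) $ i $ j)"
    by (rule sum.swap)
  finally show ?thesis
    by (simp add: trace_def matrix_matrix_mult_def[of "transpose h"]) (simp add: transpose_def)
qed

section \<open>Families of immersed hypersurfaces in coordinates\<close>

text \<open>One fixed chart on either side, with time as the first parameter.
  \<open>\<Omega>\<close> is a general open set because the times for which a point stays in the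
  ambient chart depend on the point.\<close>

locale immersed_family =
  fixes G :: "real^'n::finite \<Rightarrow> real^'n^'n" and U :: "(real^'n) set"
    and \<Phi> N :: "real \<times> (real^'m::finite) \<Rightarrow> real^'n" and \<Omega> :: "(real \<times> (real^'m)) set"
  assumes card: "CARD('n) = CARD('m) + 1"
    and G: "metric_on G U" and O: "open \<Omega>" and \<Phi>U: "\<Phi> ` \<Omega> \<subseteq> U"
    and \<Phi>: "smooth_on \<Phi> \<Omega>" and N: "smooth_on N \<Omega>"
    and inj: "z \<in> \<Omega> \<Longrightarrow> inj (\<lambda>X. Dif \<Phi> z (0, X))"
    and normal: "z \<in> \<Omega> \<Longrightarrow> Dif \<Phi> z (0, X) \<bullet> (G (\<Phi> z) *v N z) = 0"
    and unit: "z \<in> \<Omega> \<Longrightarrow> N z \<bullet> (G (\<Phi> z) *v N z) = 1"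
begin

text \<open>A parameter \<open>z = (s, x)\<close> consists of time and position. \<open>Y\<close> is the covariant time derivative of the
  normal, and \<open>y\<close> is its coordinate vector.\<close>

definition "frame z = matrix (\<lambda>X. Dif \<Phi> z (0, X))"
definition "gram z = transpose (frame z) ** G (\<Phi> z) ** frame z"
definition "proj z = tproj (G (\<Phi> z)) (frame z)"
definition "DN z = matrix (\<lambda>X. cov G \<Phi> N (0, X) z)"
text \<open>The projection gives an explicit formula, from which smoothness in time and position is
  read off. That it is the shape operator is \<open>frame_shape\<close>.\<close>

definition "shape z = - (proj z ** DN z)"
definition "Y z = cov G \<Phi> N (1, 0) z"
definition "y z = proj z *v Y z"
definition "DY z = matrix (\<lambda>X. cov G \<Phi> Y (0, X) z)"

lemma linear_Dif: "smooth_on f \<Omega> \<Longrightarrow> z \<in> \<Omega> \<Longrightarrow> linear (Dif f z)"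
  using smooth_onD has_derivative_linear by blast

lemma linear_cov:
  assumes "smooth_on Z \<Omega>" "z \<in> \<Omega>"
  shows "linear (\<lambda>d. cov G \<Phi> Z d z)"
proof -
  note 1 = linear_Dif[OF assms] and 2 = linear_Dif[OF \<Phi> assms(2)]
    and 3 = bounded_linear.linear[OF conn_bounded_linear[OF G]]
  show ?thesis
    unfolding cov_def
    by (rule linearI) (simp_all add: linear_add[OF 1] linear_add[OF 2] linear_add[OF 3]
        linear_scale[OF 1] linear_scale[OF 2] linear_scale[OF 3] matrix_vector_mult_add_rdistrib
        scaleR_matrix_vector_assoc scaleR_add_right)
qed

lemma linear_snd:
  assumes "linear f"
  shows "linear (\<lambda>X. f (0, X))"
proof (rule linearI)
  show "f (0, a + b) = f (0, a) + f (0, b)" for a b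
    using linear_add[OF assms, of "(0, a)" "(0, b)"] by simp
  show "f (0, c *\<^sub>R a) = c *\<^sub>R f (0, a)" for c a
    using linear_scale[OF assms, of c "(0, a)"] by simp
qed

lemma frame_apply: "z \<in> \<Omega> \<Longrightarrow> frame z *v X = Dif \<Phi> z (0, X)"
  unfolding frame_def by (intro matrix_works_real linear_snd linear_Dif \<Phi>)

lemma DN_apply: "z \<in> \<Omega> \<Longrightarrow> DN z *v X = cov G \<Phi> N (0, X) z"
  unfolding DN_def by (rule matrix_works_real) (rule linear_snd[OF linear_cov[OF N]])

lemma metric_at:
  assumes "z \<in> \<Omega>"
  shows "\<Phi> z \<in> U" "X \<noteq> 0 \<Longrightarrow> X \<bullet> (G (\<Phi> z) *v X) > 0" "transpose (G (\<Phi> z)) = G (\<Phi> z)"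
    "a \<bullet> (G (\<Phi> z) *v b) = b \<bullet> (G (\<Phi> z) *v a)"
proof -
  show U: "\<Phi> z \<in> U" using assms \<Phi>U by auto
  show "X \<noteq> 0 \<Longrightarrow> X \<bullet> (G (\<Phi> z) *v X) > 0" "transpose (G (\<Phi> z)) = G (\<Phi> z)"
    "a \<bullet> (G (\<Phi> z) *v b) = b \<bullet> (G (\<Phi> z) *v a)"
    using metric_pos[OF G U] metric_symmetric[OF G U] metric_inner_commute[OF G U] by auto
qed

lemma frame_inj:
  assumes "z \<in> \<Omega>"
  shows "inj ((*v) (frame z))"
proof -
  have "(*v) (frame z) = (\<lambda>X. Dif \<Phi> z (0, X))"
    by (rule ext) (rule frame_apply[OF assms])
  then show ?thesis using inj[OF assms] by simp
qed

lemma gram_inv: "z \<in> \<Omega> \<Longrightarrow> invertible (gram z)"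
  and gram_pos: "z \<in> \<Omega> \<Longrightarrow> X \<noteq> 0 \<Longrightarrow> X \<bullet> (gram z *v X) > 0"
  unfolding gram_def using gram_invertible[OF metric_at(2) frame_inj] by blast+

lemma gram_symmetric: "z \<in> \<Omega> \<Longrightarrow> transpose (gram z) = gram z"
  unfolding gram_def by (simp add: matrix_transpose_mul metric_at(3) matrix_mul_assoc)

lemma proj_frame: "z \<in> \<Omega> \<Longrightarrow> proj z ** frame z = mat 1"
  unfolding proj_def using tproj_left_inverse[OF metric_at(2) frame_inj] by blast

lemma decomposition:
  assumes "z \<in> \<Omega>"
  shows "frame z *v (proj z *v w) + (w \<bullet> (G (\<Phi> z) *v N z)) *\<^sub>R N z = w"
  unfolding proj_def
  by (rule tangent_normal_decomposition[OF card metric_at(2)[OF assms] metric_at(3)[OF assms] frame_inj[OF assms]])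
    (use normal[OF assms] unit[OF assms] frame_apply[OF assms] in auto)

lemma tangential: "z \<in> \<Omega> \<Longrightarrow> w \<bullet> (G (\<Phi> z) *v N z) = 0 \<Longrightarrow> frame z *v (proj z *v w) = w"
  using decomposition[of z w] by simp

text \<open>Differentiate <N, N> = 1. With arbitrary \<open>d\<close> this covers both the
  derivatives along the hypersurface and the time derivative Y.\<close>

lemma cov_N_tangential:
  assumes z: "z \<in> \<Omega>"
  shows "cov G \<Phi> N d z \<bullet> (G (\<Phi> z) *v N z) = 0"
proof -
  note dN = smooth_onD[OF N z]
  have "((\<lambda>z. N z \<bullet> (G (\<Phi> z) *v N z)) has_derivative (\<lambda>d. 0)) (at z)"
    using has_derivative_cong_open[OF O z, of "\<lambda>z. N z \<bullet> (G (\<Phi> z) *v N z)" "\<lambda>_. 1"] unit by simp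
  then have "(\<lambda>d. cov G \<Phi> N d z \<bullet> (G (\<Phi> z) *v N z) + N z \<bullet> (G (\<Phi> z) *v cov G \<Phi> N d z)) = (\<lambda>d. 0)"
    using has_derivative_inner_along[OF G O \<Phi>U \<Phi> z dN dN] has_derivative_unique by blast
  then have "cov G \<Phi> N d z \<bullet> (G (\<Phi> z) *v N z) + N z \<bullet> (G (\<Phi> z) *v cov G \<Phi> N d z) = 0"
    by (rule fun_cong)
  then show ?thesis by (simp add: metric_at(4)[OF z, of "N z"])
qed

text \<open>The derivatives of N have no normal part, so the tangential projection recovers them
  completely.\<close>

lemma frame_shape: "z \<in> \<Omega> \<Longrightarrow> frame z ** shape z = - DN z"
proof (rule matrix_eq_columns)
  fix i assume z: "z \<in> \<Omega>"
  have "frame z *v (proj z *v (DN z *v axis i 1)) = DN z *v axis i 1"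
    by (rule tangential[OF z]) (simp add: DN_apply[OF z] cov_N_tangential[OF z])
  then show "frame z ** shape z *v axis i 1 = - DN z *v axis i 1"
    unfolding shape_def
    by (simp add: matrix_mult_simps matrix_vector_mul_assoc matrix_mul_assoc
        bounded_bilinear.minus_left[OF bounded_bilinear_matrix_vector_mult])
qed

lemma frame_y: "z \<in> \<Omega> \<Longrightarrow> frame z *v y z = Y z"
  unfolding y_def Y_def using tangential cov_N_tangential by blast

lemma smooth_frame: "smooth_on frame \<Omega>"
  unfolding frame_def[abs_def] by (intro smooth_on_matrix smooth_on_Dif O \<Phi>)

lemma smooth_metric: "smooth_on (\<lambda>z. G (\<Phi> z)) \<Omega>"
  by (rule smooth_on_compose[OF O metric_open[OF G] \<Phi>U \<Phi> metric_smooth[OF G]])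

lemma smooth_gram: "smooth_on gram \<Omega>"
  unfolding gram_def[abs_def]
  by (intro smooth_on_matrix_mult smooth_on_transpose smooth_frame smooth_metric O)

lemma smooth_proj: "smooth_on proj \<Omega>"
  unfolding proj_def[abs_def] tproj_def
  by (intro smooth_on_matrix_mult smooth_on_matrix_inv smooth_on_transpose smooth_frame smooth_metric O
      gram_inv[unfolded gram_def])

lemma smooth_DN: "smooth_on DN \<Omega>"
  unfolding DN_def[abs_def] by (intro smooth_on_matrix smooth_on_cov[OF G O \<Phi>U \<Phi>] O N)

lemma smooth_shape: "smooth_on shape \<Omega>"
  unfolding shape_def[abs_def]
  by (intro smooth_on_minus smooth_on_matrix_mult smooth_proj smooth_DN O)

lemma smooth_Y: "smooth_on Y \<Omega>"
  unfolding Y_def[abs_def] by (rule smooth_on_cov[OF G O \<Phi>U \<Phi> N])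

lemma smooth_y: "smooth_on y \<Omega>"
  unfolding y_def[abs_def] by (intro smooth_on_matrix_vector_mult smooth_proj smooth_Y O)

lemma DY_apply: "z \<in> \<Omega> \<Longrightarrow> DY z *v X = cov G \<Phi> Y (0, X) z"
  unfolding DY_def by (rule matrix_works_real) (rule linear_snd[OF linear_cov[OF smooth_Y]])

lemma cov_cong: "z \<in> \<Omega> \<Longrightarrow> (\<And>z. z \<in> \<Omega> \<Longrightarrow> Z z = W z) \<Longrightarrow> cov G \<Phi> Z d z = cov G \<Phi> W d z"
  unfolding cov_def using Dif_cong_open[OF O, of z Z W] by simp

lemma covm_frame_apply:
  assumes z: "z \<in> \<Omega>"
  shows "covm G \<Phi> frame d z *v X = cov G \<Phi> (\<lambda>z. Dif \<Phi> z (0, X)) d z"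
  using covm_vector[OF smooth_onD[OF smooth_frame z], of G \<Phi> d X]
    cov_cong[OF z, of "\<lambda>z. frame z *v X" "\<lambda>z. Dif \<Phi> z (0, X)"] frame_apply by simp

text \<open>Differentiating <d\<Phi>(a), N> = 0 along \<open>b\<close> gives II(a, b) = <D_b
  d\<Phi>(a), N>, which is symmetric by \<open>cov_torsion_free\<close>.\<close>

lemma second_fundamental_form_symmetric:
  assumes z: "z \<in> \<Omega>"
  shows "transpose (gram z ** shape z) = gram z ** shape z"
proof -
  have A: "a \<bullet> ((gram z ** shape z) *v b) = cov G \<Phi> (\<lambda>z. Dif \<Phi> z (0, a)) (0, b) z \<bullet> (G (\<Phi> z) *v N z)" for a b
  proof -
    have dE: "((\<lambda>z. Dif \<Phi> z (0, a)) has_derivative Dif (\<lambda>z. Dif \<Phi> z (0, a)) z) (at z)"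
      by (rule smooth_onD[OF smooth_on_Dif[OF O \<Phi>] z])
    have "((\<lambda>z. Dif \<Phi> z (0, a) \<bullet> (G (\<Phi> z) *v N z)) has_derivative (\<lambda>d. 0)) (at z)"
      using has_derivative_cong_open[OF O z, of "\<lambda>z. Dif \<Phi> z (0, a) \<bullet> (G (\<Phi> z) *v N z)" "\<lambda>_. 0"] normal by simp
    then have "(\<lambda>d. cov G \<Phi> (\<lambda>z. Dif \<Phi> z (0, a)) d z \<bullet> (G (\<Phi> z) *v N z) +
        Dif \<Phi> z (0, a) \<bullet> (G (\<Phi> z) *v cov G \<Phi> N d z)) = (\<lambda>d. 0)"
      using has_derivative_inner_along[OF G O \<Phi>U \<Phi> z dE smooth_onD[OF N z]]
        has_derivative_unique by blast
    then have 1: "cov G \<Phi> (\<lambda>z. Dif \<Phi> z (0, a)) (0, b) z \<bullet> (G (\<Phi> z) *v N z) +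
        Dif \<Phi> z (0, a) \<bullet> (G (\<Phi> z) *v cov G \<Phi> N (0, b) z) = 0"
      by (rule fun_cong)
    have "gram z ** shape z = - (transpose (frame z) ** G (\<Phi> z) ** DN z)"
      unfolding gram_def by (simp add: frame_shape[OF z] matrix_mult_simps flip: matrix_mul_assoc)
    then have "a \<bullet> ((gram z ** shape z) *v b) = - (a \<bullet> (transpose (frame z) *v (G (\<Phi> z) *v (DN z *v b))))"
      by (simp add: matrix_vector_mul_assoc matrix_mul_assoc
          bounded_bilinear.minus_left[OF bounded_bilinear_matrix_vector_mult])
    also have "\<dots> = - (Dif \<Phi> z (0, a) \<bullet> (G (\<Phi> z) *v cov G \<Phi> N (0, b) z))"
      by (simp add: DN_apply[OF z] frame_apply[OF z] flip: inner_matrix_transpose)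
    finally show ?thesis using 1 by simp
  qed
  show ?thesis
  proof (rule matrix_eq_inner)
    fix a b
    have "a \<bullet> (transpose (gram z ** shape z) *v b) = b \<bullet> ((gram z ** shape z) *v a)"
      by (metis inner_matrix_transpose inner_commute)
    then show "a \<bullet> (transpose (gram z ** shape z) *v b) = a \<bullet> ((gram z ** shape z) *v b)"
      unfolding A cov_torsion_free[OF G O \<Phi>U \<Phi> z, of "(0, b)" "(0, a)"] .
  qed
qed

lemma Dif_gram:
  assumes z: "z \<in> \<Omega>"
  shows "Dif gram z d = transpose (transpose (frame z) ** G (\<Phi> z) ** covm G \<Phi> frame d z) +
    transpose (frame z) ** G (\<Phi> z) ** covm G \<Phi> frame d z"
proof -
  note dE = smooth_onD[OF smooth_frame z]
  have "Dif gram z = (\<lambda>d. transpose (covm G \<Phi> frame d z) ** G (\<Phi> z) ** frame z +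
      transpose (frame z) ** G (\<Phi> z) ** covm G \<Phi> frame d z)"
    unfolding gram_def[abs_def]
    by (rule Dif_eq[OF has_derivative_matrix_along[OF G O \<Phi>U \<Phi> z dE dE]])
  then show ?thesis
    by (simp add: matrix_transpose_mul metric_at(3)[OF z] matrix_mul_assoc)
qed

lemma shape_variation:
  assumes z: "z \<in> \<Omega>"
  defines "v \<equiv> Dif \<Phi> z (1, 0)"
  shows "trace (Dif shape z (1, 0)) + 1/2 * tensor_inner (gram z) (Dif gram z (1, 0)) (gram z ** shape z) =
    v \<bullet> (ricci G (\<Phi> z) *v N z) - trace (proj z ** DY z)"
proof -
  let ?J = "matrix_inv (gram z)" and ?S = "shape z" and ?P = "proj z" and ?E = "frame z"
  let ?CE = "covm G \<Phi> frame (1, 0) z" and ?A = "gram z ** shape z"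
  \<comment> \<open>By the symmetry lemma \<open>?CE\<close> is X |-> D_X v, so
    \<open>?J ** K\<close> represents its tangential part; multiplied with the shape operator it is
    the term that the metric variation cancels.\<close>
  define K where "K = transpose (frame z) ** G (\<Phi> z) ** ?CE"
  note dE = smooth_onD[OF smooth_frame z]
    and dS = smooth_onD[OF smooth_shape z]
    and dDN = smooth_onD[OF smooth_DN z]
  have Jsym: "transpose ?J = ?J"
    by (rule matrix_inv_symmetric[OF gram_inv[OF z] gram_symmetric[OF z]])
  have S: "?S = ?J ** ?A"
    using matrix_inv_mult(2)[OF gram_inv[OF z]] by (simp add: matrix_mul_assoc)
  have PCE: "?P ** ?CE = ?J ** K"
    by (simp add: K_def proj_def tproj_def gram_def matrix_mul_assoc)

  have lin: "linear (\<lambda>w. curv G (\<Phi> z) v w *v N z)"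
      by (rule linearI) (simp_all add: curv_def vec_eq_iff matrix_vector_mult_def algebra_simps
          sum.distrib sum_distrib_left)
  have cov_DN: "covm G \<Phi> DN (1, 0) z = DY z + matrix (\<lambda>w. curv G (\<Phi> z) v w *v N z) ** ?E"
  proof (rule matrix_eq_columns)
    fix i
    let ?X = "axis i 1 :: real^'m"
    have "covm G \<Phi> DN (1, 0) z *v ?X = cov G \<Phi> (\<lambda>z. cov G \<Phi> N (0, ?X) z) (1, 0) z"
      using covm_vector[OF dDN, of G \<Phi> "(1, 0)" ?X] cov_cong[OF z, of "\<lambda>z. DN z *v ?X" "\<lambda>z. cov G \<Phi> N (0, ?X) z"]
        DN_apply by simp
    also have "\<dots> = cov G \<Phi> (\<lambda>z. cov G \<Phi> N (1, 0) z) (0, ?X) z + curv G (\<Phi> z) v (Dif \<Phi> z (0, ?X)) *v N z"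
      using cov_commute[OF G O \<Phi>U \<Phi> z N, of "(0, ?X)" "(1, 0)"] by (simp add: v_def algebra_simps)
    finally have "covm G \<Phi> DN (1, 0) z *v ?X = DY z *v ?X + curv G (\<Phi> z) v (Dif \<Phi> z (0, ?X)) *v N z"
      by (simp add: DY_apply[OF z] Y_def[abs_def])
    then show "covm G \<Phi> DN (1, 0) z *v ?X = (DY z + matrix (\<lambda>w. curv G (\<Phi> z) v w *v N z) ** ?E) *v ?X"
      by (simp add: matrix_vector_mult_add_rdistrib frame_apply[OF z] matrix_works_real[OF lin]
          flip: matrix_vector_mul_assoc)
  qed
  \<comment> \<open>Product rule for \<open>frame_shape\<close>. Since \<open>?P ** ?E\<close> is
    the identity, applying the projection afterwards isolates the derivative of the shape
    operator.\<close>
  have "covm G \<Phi> (\<lambda>z. frame z ** shape z) (1, 0) z = ?CE ** ?S + ?E ** Dif shape z (1, 0)"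
    unfolding covm_def Dif_eq[OF has_derivative_matrix_mult[OF dE dS]]
    by (simp add: matrix_mult_simps matrix_mul_assoc)
  moreover have "covm G \<Phi> (\<lambda>z. frame z ** shape z) (1, 0) z = - covm G \<Phi> DN (1, 0) z"
  proof -
    have "Dif (\<lambda>z. frame z ** shape z) z = Dif (\<lambda>z. - DN z) z"
      by (rule Dif_cong_open[OF O z frame_shape])
    then show ?thesis
      unfolding covm_def
      by (simp add: frame_shape[OF z] matrix_mult_simps Dif_eq[OF has_derivative_minus[OF dDN]])
  qed
  ultimately have "?E ** Dif shape z (1, 0) = - covm G \<Phi> DN (1, 0) z - ?CE ** ?S"
    by (simp add: algebra_simps)
  then have "?P ** (?E ** Dif shape z (1, 0)) = ?P ** (- covm G \<Phi> DN (1, 0) z - ?CE ** ?S)"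
    by simp
  then have "Dif shape z (1, 0) = - (?P ** DY z) - ?P ** matrix (\<lambda>w. curv G (\<Phi> z) v w *v N z) ** ?E - ?J ** K ** ?S"
    by (simp add: matrix_mul_assoc proj_frame[OF z] matrix_mult_simps cov_DN flip: PCE)
  then have trS: "trace (Dif shape z (1, 0)) = - trace (?P ** DY z) -
      trace (?P ** matrix (\<lambda>w. curv G (\<Phi> z) v w *v N z) ** ?E) - trace (?J ** K ** ?S)"
    by (simp add: trace_sub trace_minus)

  have "trace (?P ** matrix (\<lambda>w. curv G (\<Phi> z) v w *v N z) ** ?E) = - (v \<bullet> (ricci G (\<Phi> z) *v N z))"
  proof -
    let ?R = "matrix (\<lambda>w. curv G (\<Phi> z) v w *v N z)"
    have "trace (?P ** ?R ** ?E) = trace (?R ** (?E ** ?P))"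
      by (metis matrix_mul_assoc trace_mul_sym)
    \<comment> \<open>The identity is \<open>?E ** ?P\<close> plus the projection onto N.
      \<open>?Q\<close> is the resulting rank one matrix, w |-> <w, N> R(v, N) N, whose trace is
      <R(v, N) N, N>.\<close>
    moreover have "?R = ?R ** (?E ** ?P) + (\<chi> i j. (?R *v N z) $ i * (G (\<Phi> z) *v N z) $ j)" (is "_ = _ + ?Q")
    proof (rule matrix_eq_columns)
      fix i
      let ?w = "axis i 1 :: real^'n"
      have "?R *v ?w = ?R *v (?E *v (?P *v ?w) + (?w \<bullet> (G (\<Phi> z) *v N z)) *\<^sub>R N z)"
        by (simp add: decomposition[OF z])
      also have "\<dots> = ?R *v (?E *v (?P *v ?w)) + (?w \<bullet> (G (\<Phi> z) *v N z)) *\<^sub>R (?R *v N z)"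
        by (simp add: matrix_vector_right_distrib matrix_vector_mult_scaleR)
      also have "(?w \<bullet> (G (\<Phi> z) *v N z)) *\<^sub>R (?R *v N z) = ?Q *v ?w"
        by (simp add: matrix_vector_mult_basis column_def inner_axis' vec_eq_iff)
      finally show "?R *v ?w = (?R ** (?E ** ?P) + ?Q) *v ?w"
        by (simp add: matrix_vector_mult_add_rdistrib matrix_vector_mul_assoc matrix_mul_assoc)
    qed
    then have "trace ?R = trace (?R ** (?E ** ?P)) + trace ?Q"
      by (metis trace_add)
    moreover have "trace ?Q = 0"
    proof -
      have "trace ?Q = (?R *v N z) \<bullet> (G (\<Phi> z) *v N z)"
        by (simp add: trace_def inner_vec_def)
      also have "\<dots> = N z \<bullet> (G (\<Phi> z) *v (curv G (\<Phi> z) v (N z) *v N z))"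
        by (simp add: matrix_works_real[OF lin] metric_at(4)[OF z, of _ "N z"])
      finally show ?thesis using curv_skew[OF G metric_at(1)[OF z]] by simp
    qed
    \<comment> \<open>The Ricci tensor is a trace over the first argument of the curvature, whereas
      \<open>w\<close> stands in the second one here; hence the sign.\<close>
    moreover have "trace ?R = - trace (matrix (\<lambda>w. curv G (\<Phi> z) w v *v N z))"
    proof -
      have "curv G (\<Phi> z) v w = - curv G (\<Phi> z) w v" for w
        unfolding curv_conn[OF G metric_at(1)[OF z]] by simp
      then have "curv G (\<Phi> z) v w *v N z = - (curv G (\<Phi> z) w v *v N z)" for w
        by (metis bounded_bilinear.minus_left[OF bounded_bilinear_matrix_vector_mult])
      then have "?R = - matrix (\<lambda>w. curv G (\<Phi> z) w v *v N z)"
        by (simp add: matrix_def vec_eq_iff)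
      then show ?thesis by (simp add: trace_minus)
    qed
    ultimately show ?thesis
      using ricci_trace[OF G, of v "\<Phi> z" "N z"] by simp
  qed
  moreover have "tensor_inner (gram z) (Dif gram z (1, 0)) ?A = 2 * trace (?J ** K ** ?S)"
  proof -
    have Asym: "transpose ?A = ?A" by (rule second_fundamental_form_symmetric[OF z])
    have "transpose (Dif gram z (1, 0)) = K + transpose K"
      by (simp add: Dif_gram[OF z] transpose_add K_def)
    then have "tensor_inner (gram z) (Dif gram z (1, 0)) ?A = trace ((K + transpose K) ** (?J ** ?A ** ?J))"
      by (simp add: tensor_inner_trace Jsym)
    also have "\<dots> = trace (K ** (?J ** ?A ** ?J)) + trace (transpose K ** (?J ** ?A ** ?J))"
      by (simp add: matrix_mult_simps trace_add)
    \<comment> \<open>Symmetry of \<open>?A\<close> and \<open>?J\<close> makes the two halves of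
      the metric variation contribute equally, which produces the factor 2.\<close>
    also have "trace (transpose K ** (?J ** ?A ** ?J)) = trace (transpose (transpose K ** (?J ** ?A ** ?J)))"
      by (simp add: trace_transpose)
    also have "transpose (transpose K ** (?J ** ?A ** ?J)) = ?J ** ?A ** ?J ** K"
      using Asym Jsym by (simp add: matrix_transpose_mul matrix_mul_assoc)
    also have "trace (?J ** ?A ** ?J ** K) = trace (K ** (?J ** ?A ** ?J))"
      by (rule trace_mul_sym)
    also have "trace (K ** (?J ** ?A ** ?J)) = trace (?J ** K ** ?S)"
      by (metis S matrix_mul_assoc trace_mul_sym)
    finally show ?thesis by simp
  qed
  ultimately show ?thesis
    unfolding trS by simp
qed

text \<open>With Y = E y, the product rule gives D_X Y = (D_X E) y + E dy(X), and by the symmetry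
  lemma (D_X E) y = (D_y E) X. The tangential trace of the latter is half the logarithmic derivative
  of det I along y, so the right-hand side is the divergence of y in coordinates.\<close>

lemma trace_DY:
  assumes z: "z \<in> \<Omega>"
  shows "trace (proj z ** DY z) = trace (matrix (\<lambda>X. Dif y z (0, X))) +
    1/2 * trace (matrix_inv (gram z) ** Dif gram z (0, y z))"
proof -
  let ?J = "matrix_inv (gram z)" and ?Dy = "matrix (\<lambda>X. Dif y z (0, X))"
  let ?CE = "covm G \<Phi> frame (0, y z) z"
  define K where "K = transpose (frame z) ** G (\<Phi> z) ** ?CE"
  note dE = smooth_onD[OF smooth_frame z] and dy = smooth_onD[OF smooth_y z]
  have Jsym: "transpose ?J = ?J"
    by (rule matrix_inv_symmetric[OF gram_inv[OF z] gram_symmetric[OF z]])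
  have "DY z = ?CE + frame z ** ?Dy"
  proof (rule matrix_eq_columns)
    fix i
    let ?X = "axis i 1 :: real^'m"
    have "DY z *v ?X = cov G \<Phi> (\<lambda>z. frame z *v y z) (0, ?X) z"
      unfolding DY_apply[OF z] by (rule cov_cong[OF z]) (simp add: frame_y)
    also have "\<dots> = covm G \<Phi> frame (0, ?X) z *v y z + frame z *v Dif y z (0, ?X)"
      unfolding cov_def covm_def Dif_eq[OF has_derivative_matrix_vector_mult[OF dE dy]]
      by (simp add: matrix_vector_mult_add_rdistrib matrix_vector_mul_assoc)
    also have "covm G \<Phi> frame (0, ?X) z *v y z = ?CE *v ?X"
      unfolding covm_frame_apply[OF z] by (rule cov_torsion_free[OF G O \<Phi>U \<Phi> z])
    also have "Dif y z (0, ?X) = ?Dy *v ?X"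
      by (rule matrix_works_real[symmetric]) (rule linear_snd[OF linear_Dif[OF smooth_y z]])
    finally show "DY z *v ?X = (?CE + frame z ** ?Dy) *v ?X"
      by (simp add: matrix_vector_mult_add_rdistrib matrix_vector_mul_assoc)
  qed
  then have "proj z ** DY z = ?J ** K + ?Dy"
    by (simp add: matrix_mult_simps matrix_mul_assoc proj_frame[OF z])
      (simp add: K_def proj_def tproj_def gram_def matrix_mul_assoc)
  moreover have "trace (?J ** Dif gram z (0, y z)) = 2 * trace (?J ** K)"
  proof -
    have "trace (?J ** transpose K) = trace (transpose (?J ** transpose K))"
      by (simp add: trace_transpose)
    also have "\<dots> = trace (?J ** K)"
      by (metis Jsym matrix_transpose_mul trace_mul_sym transpose_transpose)
    finally show ?thesis
      by (simp add: Dif_gram[OF z] K_def[symmetric] matrix_mult_simps trace_add)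
  qed
  ultimately show ?thesis by (simp add: trace_add)
qed

end

section \<open>The divergence theorem on a compact manifold\<close>

lemma Ck_on_local:
  assumes "\<And>x. x \<in> V \<Longrightarrow> \<exists>W. open W \<and> x \<in> W \<and> Ck_on k f W"
  shows "Ck_on k f V"
  using assms
proof (induction k arbitrary: f)
  case 0
  then have "\<forall>x\<in>V. continuous (at x) f"
    using continuous_on_eq_continuous_at by (metis Ck_on.simps(1))
  then show ?case by (simp add: continuous_at_imp_continuous_on)
next
  case (Suc k)
  have "Ck_on k (\<lambda>x. Dif f x e) V" if "e \<in> Basis" for e
    by (rule Suc.IH) (use Suc.prems that in \<open>force simp: Ball_def\<close>)
  moreover have "f differentiable (at x)" if "x \<in> V" for x
    using Suc.prems[OF that] by auto
  ultimately show ?case by simp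
qed

lemma Ck_on_1_continuous:
  assumes "Ck_on 1 f U"
  shows "continuous_on U f"
proof -
  have "Ck_on (Suc 0) f U" using assms by simp
  then have "Ck_on 0 f U" by (rule Ck_on_Suc_imp)
  then show ?thesis by simp
qed

text \<open>By translation invariance the difference quotients of \<open>h\<close> integrate to 0.\<close>

lemma integral_directional_derivative_zero:
  fixes h :: "'a::euclidean_space \<Rightarrow> real"
  assumes der: "\<And>x. (h has_derivative h' x) (at x)" and cont: "continuous_on UNIV (\<lambda>x. h' x e)"
    and K: "compact K" and zero: "\<And>x. x \<notin> K \<Longrightarrow> h x = 0"
  shows "integrable lborel (\<lambda>x. h' x e)" "(\<integral>x. h' x e \<partial>lborel) = 0"
proof -
  have zero': "h' x e = 0" if "x \<notin> K" for x
  proof -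
    have "open (- K)" using K compact_imp_closed by blast
    then have "((\<lambda>_. 0) has_derivative h' x) (at x)"
      using has_derivative_cong_open[of "- K" x h "\<lambda>_. 0"] that zero der by auto
    then have "h' x = (\<lambda>_. 0)"
      using has_derivative_unique has_derivative_const by blast
    then show ?thesis by simp
  qed
  have "(\<lambda>x. indicator K x *\<^sub>R h' x e) = (\<lambda>x. h' x e)"
    by (rule ext) (use zero' in \<open>auto simp: indicator_def\<close>)
  then show int: "integrable lborel (\<lambda>x. h' x e)"
    using borel_integrable_compact[OF K continuous_on_subset[OF cont subset_UNIV]] by (simp only:)
  have hc: "continuous_on S h" for S
    using der by (meson continuous_at_imp_continuous_on has_derivative_continuous)
  have "(\<lambda>x. indicator K x *\<^sub>R h x) = h"
    by (rule ext) (use zero in \<open>auto simp: indicator_def\<close>)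
  then have inth: "integrable lborel h"
    using borel_integrable_compact[OF K hc] by (simp only:)
  obtain C where C: "\<And>x. x \<in> K \<Longrightarrow> \<bar>h' x e\<bar> \<le> C"
    using compact_imp_bounded[OF compact_continuous_image[OF continuous_on_subset[OF cont] K]]
    by (auto simp: bounded_iff)
  \<comment> \<open>\<open>K\<close> may be empty, and then \<open>C\<close> may be negative; the
    dominating function has to be nonnegative.\<close>
  define C' where "C' = max C 0"
  have C': "\<bar>h' x e\<bar> \<le> C'" for x
    using C[of x] zero'[of x] by (cases "x \<in> K") (auto simp: C'_def)
  obtain R where R: "\<And>x. x \<in> K \<Longrightarrow> norm x \<le> R"
    using compact_imp_bounded[OF K] by (auto simp: bounded_iff)
  define t where "t n = inverse (real (Suc n))" for n
  have t: "0 < t n" "t n \<le> 1" for n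
    by (auto simp: t_def field_simps)
  define q where "q n x = (h (x + t n *\<^sub>R e) - h x) / t n" for n x
  have trans: "integrable lborel (\<lambda>x. h (x + c))" "(\<integral>x. h (x + c) \<partial>lborel) = (\<integral>x. h x \<partial>lborel)" for c
  proof -
    have d: "distr lborel borel ((+) c) = lborel" by (rule lborel_distr_plus)
    show "(\<integral>x. h (x + c) \<partial>lborel) = (\<integral>x. h x \<partial>lborel)"
      using integral_distr[of "(+) c" lborel borel h] hc[of UNIV] d
      by (simp add: add.commute borel_measurable_continuous_onI)
    show "integrable lborel (\<lambda>x. h (x + c))"
      using integrable_distr_eq[of "(+) c" lborel borel h] hc[of UNIV] d inth
      by (simp add: add.commute borel_measurable_continuous_onI)
  qed
  have q0: "(\<integral>x. q n x \<partial>lborel) = 0" for n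
    unfolding q_def using trans inth by simp
  have line: "((\<lambda>s. h (x + s *\<^sub>R e)) has_real_derivative h' (x + s *\<^sub>R e) e) (at s within T)" for x s T
  proof -
    have "((\<lambda>s. h (x + s *\<^sub>R e)) has_derivative (\<lambda>k. h' (x + s *\<^sub>R e) (k *\<^sub>R e))) (at s within T)"
      by (rule has_derivative_compose[where f = "\<lambda>s. x + s *\<^sub>R e" and g = h, OF _ der])
        (auto intro!: derivative_eq_intros)
    then show ?thesis
      by (simp add: has_field_derivative_def linear_scale[OF has_derivative_linear[OF der]] mult_commute_abs)
  qed
  \<comment> \<open>The steps \<open>t n\<close> are at most 1, so all difference quotients vanish
    outside one ball; inside it the mean value theorem bounds them uniformly. This is the domination
    needed to pass to the limit.\<close>
  have bound: "\<bar>q n x\<bar> \<le> C' * indicator (cball 0 (R + norm e)) x" for n x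
  proof (cases "x \<in> cball 0 (R + norm e)")
    case True
    have "\<exists>s. 0 < s \<and> s < t n \<and> h (x + t n *\<^sub>R e) - h (x + 0 *\<^sub>R e) = (t n - 0) * h' (x + s *\<^sub>R e) e"
      by (rule MVT2[OF t(1)]) (rule line)
    then obtain s where "h (x + t n *\<^sub>R e) - h x = t n * h' (x + s *\<^sub>R e) e" by auto
    then have "q n x = h' (x + s *\<^sub>R e) e" using t[of n] by (simp add: q_def)
    then show ?thesis using C' True by simp
  next
    case False
    have "x \<notin> K" using False R[of x] by (auto simp: dist_norm) (smt (verit) norm_ge_zero)
    moreover have "x + t n *\<^sub>R e \<notin> K"
    proof
      assume "x + t n *\<^sub>R e \<in> K"
      then have "norm (x + t n *\<^sub>R e) \<le> R" by (rule R)
      moreover have "norm x \<le> norm (x + t n *\<^sub>R e) + norm (t n *\<^sub>R e)"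
        using norm_triangle_ineq4[of "x + t n *\<^sub>R e" "t n *\<^sub>R e"] by simp
      moreover have "norm (t n *\<^sub>R e) \<le> norm e"
        using t[of n] by (simp add: mult_left_le_one_le)
      ultimately show False using False by (simp add: dist_norm)
    qed
    ultimately show ?thesis using zero by (simp add: q_def C'_def)
  qed
  have tend: "(\<lambda>n. q n x) \<longlonglongrightarrow> h' x e" for x
  proof -
    have "((\<lambda>s. (h (x + s *\<^sub>R e) - h x) / s) \<longlongrightarrow> h' x e) (at 0)"
      using line[of x 0 UNIV] by (simp add: has_field_derivative_iff)
    moreover have "filterlim t (at 0) sequentially"
      unfolding t_def filterlim_at using LIMSEQ_inverse_real_of_nat by (auto intro!: always_eventually)
    ultimately show ?thesis
      unfolding q_def by (rule filterlim_compose)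
  qed
  have "(\<lambda>n. \<integral>x. q n x \<partial>lborel) \<longlonglongrightarrow> (\<integral>x. h' x e \<partial>lborel)"
  proof (rule integral_dominated_convergence[where w = "\<lambda>x. C' * indicator (cball 0 (R + norm e)) x"])
    show "q n \<in> borel_measurable lborel" for n
      unfolding q_def using trans inth by (intro borel_measurable_divide borel_measurable_diff) auto
    show "integrable lborel (\<lambda>x. C' * indicator (cball 0 (R + norm e)) x :: real)"
      using emeasure_bounded_finite[OF bounded_cball] by (intro integrable_mult_right integrable_real_indicator) auto
  qed (use int tend bound in auto)
  then show "(\<integral>x. h' x e \<partial>lborel) = 0"
    unfolding q0 using LIMSEQ_const_iff by (metis (full_types))
qed

text \<open>Only \<open>C\<^sup>1\<close>, which is all that the divergence theorem needs.\<close>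

definition bump :: "'a::euclidean_space \<Rightarrow> real \<Rightarrow> 'a \<Rightarrow> real" where
  "bump a r x = (max 0 (r\<^sup>2 - (x - a) \<bullet> (x - a)))\<^sup>2"

text \<open>Squaring smooths the kink at 0, where the difference quotient is bounded by the absolute
  value of the increment. This makes \<open>bump\<close> continuously differentiable across the
  boundary of its ball.\<close>

lemma has_derivative_max0_square:
  "((\<lambda>t::real. (max 0 t)\<^sup>2) has_derivative (\<lambda>k. 2 * max 0 t * k)) (at t)"
proof -
  consider "t > 0" | "t < 0" | "t = 0" by linarith
  then show ?thesis
  proof cases
    case 1
    have "((\<lambda>t::real. (max 0 t)\<^sup>2) has_derivative f) (at t) \<longleftrightarrow> ((\<lambda>t. t\<^sup>2) has_derivative f) (at t)" for f
      by (rule has_derivative_cong_open[of "{0<..}"]) (use 1 in auto)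
    then show ?thesis using 1 by (auto intro!: derivative_eq_intros)
  next
    case 2
    have "((\<lambda>t::real. (max 0 t)\<^sup>2) has_derivative f) (at t) \<longleftrightarrow> ((\<lambda>t. 0) has_derivative f) (at t)" for f
      by (rule has_derivative_cong_open[of "{..<0}"]) (use 2 in auto)
    then show ?thesis using 2 by auto
  next
    case 3
    have "((\<lambda>h. (max 0 h)\<^sup>2 / h) \<longlongrightarrow> 0) (at (0::real))"
    proof (rule Lim_null_comparison)
      show "\<forall>\<^sub>F h in at 0. norm ((max 0 h)\<^sup>2 / h) \<le> \<bar>h::real\<bar>"
        by (auto intro!: always_eventually simp: max_def power2_eq_square)
      show "((\<lambda>h::real. \<bar>h\<bar>) \<longlongrightarrow> 0) (at 0)"
        using tendsto_rabs[OF tendsto_ident_at[of "0::real" UNIV]] by simp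
    qed
    then have "((\<lambda>t::real. (max 0 t)\<^sup>2) has_field_derivative 0) (at 0)"
      by (simp add: has_field_derivative_iff)
    moreover have "(*) (0::real) = (\<lambda>k. 0)" by auto
    ultimately show ?thesis using 3 by (simp add: has_field_derivative_def)
  qed
qed

lemma bump_C1: "Ck_on 1 (bump a r) UNIV"
proof -
  have inner: "((\<lambda>x. r\<^sup>2 - (x - a) \<bullet> (x - a)) has_derivative (\<lambda>e. - 2 * ((x - a) \<bullet> e))) (at x)" for x
    by (auto intro!: derivative_eq_intros simp: inner_commute)
  have "Ck_on (Suc 0) (bump a r) UNIV"
  proof (rule Ck_on_SucI)
    show "(bump a r has_derivative (\<lambda>e. 2 * max 0 (r\<^sup>2 - (x - a) \<bullet> (x - a)) * (- 2 * ((x - a) \<bullet> e)))) (at x)" for x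
      unfolding bump_def
      by (rule has_derivative_compose[OF inner has_derivative_max0_square])
    show "Ck_on 0 (\<lambda>x. 2 * max 0 (r\<^sup>2 - (x - a) \<bullet> (x - a)) * (- 2 * ((x - a) \<bullet> e))) UNIV" for e
      by (auto intro!: continuous_intros)
  qed auto
  then show ?thesis by simp
qed

lemma bump_nonneg: "bump a r x \<ge> 0" and bump_pos_iff: "r > 0 \<Longrightarrow> bump a r x > 0 \<longleftrightarrow> dist x a < r"
proof -
  show "bump a r x \<ge> 0" by (simp add: bump_def)
  assume r: "r > 0"
  have "(x - a) \<bullet> (x - a) = (dist x a)\<^sup>2"
    by (simp add: dist_norm power2_norm_eq_inner)
  moreover have "(dist x a)\<^sup>2 < r\<^sup>2 \<longleftrightarrow> dist x a < r"
    using r by (meson less_imp_le pos2 power2_less_imp_less power_strict_mono zero_le_dist)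
  ultimately show "bump a r x > 0 \<longleftrightarrow> dist x a < r"
    by (auto simp: bump_def max_def)
qed

section \<open>Charts, transition maps and partitions of unity\<close>

context
  fixes M :: "'a::{t2_space,second_countable_topology} set" and A :: "('a, 'n::finite) chart set"
  assumes M: "smooth_manifold M A"
begin

lemma chart_at:
  assumes "p \<in> M"
  shows "chart_at A p \<in> A \<and> p \<in> fst (chart_at A p)"
proof -
  have "(\<Union>c\<in>A. fst c) = M" using M unfolding smooth_manifold_def by blast
  then have "\<exists>c. c \<in> A \<and> p \<in> fst c" using assms by blast
  then show ?thesis unfolding chart_at_def by (rule someI_ex)
qed

context
  fixes c assumes c: "c \<in> A"
begin

lemma chart_openin: "openin (top_of_set M) (fst c)"
  and chart_range_open: "open (chart_range c)"
  and chart_homeomorphism: "homeomorphism (fst c) (chart_range c) (snd c) (chart_inv c)"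
  using M c by (auto simp: smooth_manifold_def)

lemma chart_subset: "fst c \<subseteq> M"
  using chart_openin openin_imp_subset by blast

lemma chart_inv_in: "x \<in> chart_range c \<Longrightarrow> chart_inv c x \<in> fst c"
  and chart_chart_inv: "x \<in> chart_range c \<Longrightarrow> snd c (chart_inv c x) = x"
  and chart_in: "p \<in> fst c \<Longrightarrow> snd c p \<in> chart_range c"
  and chart_inv_chart: "p \<in> fst c \<Longrightarrow> chart_inv c (snd c p) = p"
  using chart_homeomorphism by (auto simp: homeomorphism_def)

lemma chart_inv_in_manifold: "x \<in> chart_range c \<Longrightarrow> chart_inv c x \<in> M"
  using chart_inv_in chart_subset by blast

lemma chart_continuous: "continuous_on (fst c) (snd c)"
  and chart_inv_continuous: "continuous_on (chart_range c) (chart_inv c)"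
  using chart_homeomorphism by (auto simp: homeomorphism_def)

lemma open_chart_preimage:
  assumes "openin (top_of_set M) T"
  shows "open {x \<in> chart_range c. chart_inv c x \<in> T}"
proof -
  obtain S where S: "open S" "T = M \<inter> S" using assms by (auto simp: openin_open)
  have "{x \<in> chart_range c. chart_inv c x \<in> T} = chart_range c \<inter> chart_inv c -` S"
    using S chart_inv_in_manifold by auto
  then show ?thesis
    using continuous_open_preimage[OF chart_inv_continuous chart_range_open S(1)] by simp
qed

lemma chart_image: "snd c ` {p \<in> fst c. P p} = {x \<in> chart_range c. P (chart_inv c x)}"
  using chart_inv_in chart_chart_inv chart_in chart_inv_chart by (force simp: image_iff)

end

lemma overlap_eq:
  assumes "c \<in> A"
  shows "overlap c c' = {x \<in> chart_range c. chart_inv c x \<in> fst c'}"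
  using chart_image[OF assms, of "\<lambda>p. p \<in> fst c'"] by (simp add: overlap_def Int_def)

lemma overlap_open: "c \<in> A \<Longrightarrow> c' \<in> A \<Longrightarrow> open (overlap c c')"
  using open_chart_preimage chart_openin overlap_eq by metis

lemma transition_smooth: "c \<in> A \<Longrightarrow> c' \<in> A \<Longrightarrow> smooth_on (transition c c') (overlap c c')"
  using M by (auto simp: smooth_manifold_def)

lemma transition_in:
  "c \<in> A \<Longrightarrow> c' \<in> A \<Longrightarrow> transition c c' ` overlap c c' \<subseteq> chart_range c'"
  using chart_in[of c'] by (auto simp: overlap_eq transition_def)

lemma chart_inv_transition:
  "c \<in> A \<Longrightarrow> c' \<in> A \<Longrightarrow> x \<in> overlap c c' \<Longrightarrow> chart_inv c' (transition c c' x) = chart_inv c x"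
  using chart_inv_chart by (auto simp: overlap_eq transition_def)

lemma transition_linear:
  "c \<in> A \<Longrightarrow> c' \<in> A \<Longrightarrow> x \<in> overlap c c' \<Longrightarrow> linear (Dif (transition c c') x)"
  using smooth_onD[OF transition_smooth] has_derivative_linear by blast

lemma transition_inverse:
  assumes "c \<in> A" "c' \<in> A" "x \<in> overlap c c'"
  shows "Dif (transition c' c) (transition c c' x) (Dif (transition c c') x X) = X"
proof -
  have x: "x \<in> chart_range c" "chart_inv c x \<in> fst c'" using assms by (auto simp: overlap_eq)
  have x': "transition c c' x \<in> overlap c' c"
    using x assms transition_in[OF assms(1,2)] chart_inv_transition[OF assms] chart_inv_in[OF assms(1)]
    by (auto simp: overlap_eq)
  have "((\<lambda>y. transition c' c (transition c c' y)) has_derivative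
      (\<lambda>X. Dif (transition c' c) (transition c c' x) (Dif (transition c c') x X))) (at x)"
    by (rule has_derivative_compose[OF smooth_onD[OF transition_smooth[OF assms(1,2)] assms(3)]
          smooth_onD[OF transition_smooth[OF assms(2,1)] x']])
  moreover have "transition c' c (transition c c' y) = y" if "y \<in> overlap c c'" for y
    using that assms chart_inv_transition[OF assms(1,2) that] chart_chart_inv[OF assms(1)]
    by (simp add: transition_def[of c' c]) (simp add: overlap_eq)
  ultimately have "((\<lambda>y. y) has_derivative
      (\<lambda>X. Dif (transition c' c) (transition c c' x) (Dif (transition c c') x X))) (at x)"
    using has_derivative_cong_open[OF overlap_open[OF assms(1,2)] assms(3), of "\<lambda>y. transition c' c (transition c c' y)" "\<lambda>y. y"]
    by simp
  then show ?thesis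
    using has_derivative_unique[OF _ has_derivative_ident] by metis
qed

lemma chart_change_derivative:
  fixes u :: "'a \<Rightarrow> real"
  assumes "c \<in> A" "c' \<in> A" "x \<in> overlap c c'"
    and u: "(u \<circ> chart_inv c' has_derivative u') (at (transition c c' x))"
  shows "(u \<circ> chart_inv c has_derivative (\<lambda>X. u' (Dif (transition c c') x X))) (at x)"
proof -
  have "((\<lambda>y. (u \<circ> chart_inv c') (transition c c' y)) has_derivative (\<lambda>X. u' (Dif (transition c c') x X))) (at x)"
    by (rule has_derivative_compose[OF smooth_onD[OF transition_smooth[OF assms(1,2)] assms(3)] u])
  then show ?thesis
    using has_derivative_cong_open[OF overlap_open[OF assms(1,2)] assms(3),
        of "\<lambda>y. (u \<circ> chart_inv c') (transition c c' y)" "u \<circ> chart_inv c"]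
      chart_inv_transition[OF assms(1,2)] by simp
qed

text \<open>The supports are controlled in coordinates, by compact sets in the chart ranges, because
  integration takes place there. Differentiability is demanded in every chart, thus also across the
  boundary of the domain of \<open>c i\<close>.\<close>

definition partition_of_unity where
  "partition_of_unity I c K \<psi> \<longleftrightarrow> finite I \<and>
    (\<forall>i\<in>I. c i \<in> A \<and> compact (K i) \<and> K i \<subseteq> chart_range (c i) \<and>
      (\<forall>p\<in>M. \<psi> i p \<noteq> 0 \<longrightarrow> p \<in> fst (c i) \<and> snd (c i) p \<in> K i) \<and>
      (\<forall>b\<in>A. Ck_on 1 (\<psi> i \<circ> chart_inv b) (chart_range b))) \<and>
    (\<forall>p\<in>M. (\<Sum>i\<in>I. \<psi> i p) = (1::real))"

lemma partition_of_unityD: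
  assumes "partition_of_unity I c K \<psi>"
  shows "finite I" "\<And>i. i \<in> I \<Longrightarrow> c i \<in> A" "\<And>i. i \<in> I \<Longrightarrow> compact (K i)"
    "\<And>i. i \<in> I \<Longrightarrow> K i \<subseteq> chart_range (c i)"
    "\<And>i p. i \<in> I \<Longrightarrow> p \<in> M \<Longrightarrow> \<psi> i p \<noteq> 0 \<Longrightarrow> p \<in> fst (c i) \<and> snd (c i) p \<in> K i"
    "\<And>i b. i \<in> I \<Longrightarrow> b \<in> A \<Longrightarrow> Ck_on 1 (\<psi> i \<circ> chart_inv b) (chart_range b)"
    "\<And>p. p \<in> M \<Longrightarrow> (\<Sum>i\<in>I. \<psi> i p) = 1"
  using assms unfolding partition_of_unity_def by blast+

text \<open>Bumps on coordinate balls, indexed by their centres and normalised over a finite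
  subcover. Each bump is positive exactly on the open ball \<open>V p\<close> and supported in the
  closed ball \<open>K p\<close>, which still lies in the chart range.\<close>

lemma partition_of_unity_exists:
  assumes comp: "compact M"
  obtains I :: "'a set" and c K \<psi> where "partition_of_unity I c K \<psi>"
proof -
  have "\<exists>c r. c \<in> A \<and> p \<in> fst c \<and> r > 0 \<and> cball (snd c p) r \<subseteq> chart_range c" if "p \<in> M" for p
    using chart_at[OF that] chart_in chart_range_open open_contains_cball by metis
  then obtain c r where cr: "\<And>p. p \<in> M \<Longrightarrow> c p \<in> A \<and> p \<in> fst (c p) \<and> r p > 0 \<and>
      cball (snd (c p) p) (r p) \<subseteq> chart_range (c p)"
    by metis
  define K where "K p = cball (snd (c p) p) (r p)" for p
  define \<theta> where "\<theta> p q = (if q \<in> fst (c p) then bump (snd (c p) p) (r p) (snd (c p) q) else 0)" for p q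
  define V where "V p = {q \<in> fst (c p). snd (c p) q \<in> ball (snd (c p) p) (r p)}" for p
  have \<theta>_pos: "\<theta> p q > 0 \<longleftrightarrow> q \<in> V p" if "p \<in> M" for p q
    using cr[OF that] by (auto simp: \<theta>_def V_def bump_pos_iff dist_commute)
  have \<theta>_nonneg: "\<theta> p q \<ge> 0" for p q by (simp add: \<theta>_def bump_nonneg)
  have Vopen: "openin (top_of_set M) (V p)" if "p \<in> M" for p
  proof -
    have "openin (top_of_set (fst (c p))) (fst (c p) \<inter> snd (c p) -` ball (snd (c p) p) (r p))"
      using cr[OF that] continuous_openin_preimage_gen[OF chart_continuous open_ball] by blast
    moreover have "V p = fst (c p) \<inter> snd (c p) -` ball (snd (c p) p) (r p)" by (auto simp: V_def)
    ultimately show ?thesis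
      using cr[OF that] chart_openin openin_trans by metis
  qed
  have "\<exists>I\<subseteq>M. finite I \<and> M \<subseteq> (\<Union>p\<in>I. V p)"
  proof -
    have "\<exists>T. open T \<and> V p = M \<inter> T" if "p \<in> M" for p
      using Vopen[OF that] by (auto simp: openin_open)
    then obtain T where T: "\<And>p. p \<in> M \<Longrightarrow> open (T p) \<and> V p = M \<inter> T p" by metis
    have "p \<in> V p" if "p \<in> M" for p using cr[OF that] by (auto simp: V_def)
    then have "M \<subseteq> (\<Union>p\<in>M. T p)" using T by blast
    then obtain I where "I \<subseteq> M" "finite I" "M \<subseteq> (\<Union>p\<in>I. T p)"
      using compactE_image[OF comp, of M T] T by blast
    then show ?thesis using T by (intro exI[of _ I]) blast
  qed
  then obtain I where I: "I \<subseteq> M" "finite I" "M \<subseteq> (\<Union>p\<in>I. V p)" by blast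
  have sum_pos: "(\<Sum>i\<in>I. \<theta> i q) > 0" if q: "q \<in> M" for q
  proof -
    obtain p where "p \<in> I" "q \<in> V p" using I q by blast
    then show ?thesis using I \<theta>_pos \<theta>_nonneg by (intro sum_pos2[of I p]) auto
  qed
  have K: "compact (K p)" "K p \<subseteq> chart_range (c p)" if "p \<in> M" for p
    using cr[OF that] by (auto simp: K_def)
  have \<theta>_C1: "Ck_on 1 (\<theta> p \<circ> chart_inv b) (chart_range b)" if p: "p \<in> M" and b: "b \<in> A" for p b
  proof (rule Ck_on_local)
    fix x assume x: "x \<in> chart_range b"
    have cp: "c p \<in> A" using cr[OF p] by blast
    show "\<exists>W. open W \<and> x \<in> W \<and> Ck_on 1 (\<theta> p \<circ> chart_inv b) W"
    proof (cases "chart_inv b x \<in> fst (c p)")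
      case True
      have "Ck_on 1 (\<lambda>y. bump (snd (c p) p) (r p) (transition b (c p) y)) (overlap b (c p))"
        using transition_smooth[OF b cp]
        by (intro Ck_on_compose[OF overlap_open[OF b cp] open_UNIV _ _ bump_C1]) (auto simp: smooth_on_def)
      then have "Ck_on 1 (\<theta> p \<circ> chart_inv b) (overlap b (c p))"
        by (rule Ck_on_cong[OF overlap_open[OF b cp], rotated])
          (auto simp: \<theta>_def overlap_eq[OF b] transition_def)
      then show ?thesis
        using True x overlap_open[OF b cp] by (intro exI[of _ "overlap b (c p)"]) (auto simp: overlap_eq[OF b])
    next
      case False
      \<comment> \<open>A compact set in a Hausdorff space is closed, so near a point outside the
        chart domain the extension by zero is identically zero.\<close>
      let ?C = "chart_inv (c p) ` K p"
      have "compact ?C"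
        by (rule compact_continuous_image[OF continuous_on_subset[OF chart_inv_continuous[OF cp] K(2)[OF p]] K(1)[OF p]])
      then have "openin (top_of_set M) (M \<inter> - ?C)"
        using compact_imp_closed by (intro openin_open_Int) blast
      then have W: "open {y \<in> chart_range b. chart_inv b y \<in> M \<inter> - ?C}"
        by (rule open_chart_preimage[OF b])
      have "chart_inv b x \<notin> ?C"
        using False chart_inv_in[OF cp] K(2)[OF p] by auto
      then have xW: "x \<in> {y \<in> chart_range b. chart_inv b y \<in> M \<inter> - ?C}"
        using x chart_inv_in_manifold[OF b] by auto
      have "\<theta> p q = 0" if "q \<notin> ?C" for q
      proof (rule ccontr)
        assume "\<theta> p q \<noteq> 0"
        then have "q \<in> V p" using \<theta>_pos[OF p, of q] \<theta>_nonneg[of p q] by auto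
        then have "q = chart_inv (c p) (snd (c p) q)" "snd (c p) q \<in> K p"
          using chart_inv_chart[OF cp] by (auto simp: V_def K_def)
        then show False using that by blast
      qed
      then have "Ck_on 1 (\<theta> p \<circ> chart_inv b) {y \<in> chart_range b. chart_inv b y \<in> M \<inter> - ?C}"
        by (intro Ck_on_cong[OF W _ Ck_on_const[OF W, of 1 0]]) auto
      then show ?thesis using W xW by blast
    qed
  qed
  define \<psi> where "\<psi> p q = \<theta> p q * inverse (\<Sum>i\<in>I. \<theta> i q)" for p q
  have 1: "c i \<in> A \<and> compact (K i) \<and> K i \<subseteq> chart_range (c i)" if "i \<in> I" for i
    using that I K cr by blast
  have 2: "p \<in> fst (c i) \<and> snd (c i) p \<in> K i" if "i \<in> I" "p \<in> M" "\<psi> i p \<noteq> 0" for i p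
  proof -
    have "\<theta> i p > 0" using that(3) \<theta>_nonneg[of i p] by (auto simp: \<psi>_def)
    then have "p \<in> V i" using \<theta>_pos that(1) I by blast
    then show ?thesis by (auto simp: V_def K_def)
  qed
  have 3: "Ck_on 1 (\<psi> i \<circ> chart_inv b) (chart_range b)" if "i \<in> I" "b \<in> A" for i b
  proof -
    note o = chart_range_open[OF that(2)]
    have nz: "(\<Sum>j\<in>I. \<theta> j (chart_inv b x)) \<noteq> 0" if "x \<in> chart_range b" for x
      using sum_pos[OF chart_inv_in_manifold[OF \<open>b \<in> A\<close> that]] by simp
    have *: "Ck_on 1 (\<lambda>x. \<theta> j (chart_inv b x)) (chart_range b)" if "j \<in> I" for j
      using \<theta>_C1[of j b] that I \<open>b \<in> A\<close> by (auto simp: o_def)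
    have "Ck_on 1 (\<lambda>x. \<theta> i (chart_inv b x) * inverse (\<Sum>j\<in>I. \<theta> j (chart_inv b x))) (chart_range b)"
      by (intro Ck_on_bilinear[OF o bounded_bilinear_mult] Ck_on_inverse[OF o] Ck_on_sum[OF o] * that nz)
    then show ?thesis by (simp add: \<psi>_def o_def)
  qed
  have 4: "(\<Sum>i\<in>I. \<psi> i p) = 1" if "p \<in> M" for p
    using sum_pos[OF that] by (simp add: \<psi>_def flip: sum_distrib_right)
  show ?thesis
    using that[of I c K \<psi>] 1 2 3 4 I(2) unfolding partition_of_unity_def by blast
qed

section \<open>Integration against the area element\<close>

context
  fixes h :: "('a, 'n) metric" and \<mu> :: "'a measure"
  assumes comp: "compact M" and h: "\<And>b. b \<in> A \<Longrightarrow> metric_on (h b) (chart_range b)"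
    and \<mu>: "area_element M A h \<mu>"
begin

definition "dens b x = sqrt (det (h b x))"

text \<open>The segment from the identity to the metric consists of positive definite matrices, on
  which the determinant has no zero, and it starts with the value 1.\<close>

lemma det_metric_pos:
  assumes "b \<in> A" "x \<in> chart_range b"
  shows "det (h b x) > 0"
proof -
  let ?g = "h b x"
  have pos: "X \<bullet> (?g *v X) > 0" if "X \<noteq> 0" for X
    using metric_pos[OF h[OF assms(1)] assms(2) that] .
  define L where "L t = (1 - t) *\<^sub>R mat 1 + t *\<^sub>R ?g" for t :: real
  have L: "det (L t) \<noteq> 0" if "0 \<le> t" "t \<le> 1" for t
  proof -
    have "X \<bullet> (L t *v X) > 0" if "X \<noteq> 0" for X
    proof -
      have e: "X \<bullet> (L t *v X) = (1 - t) * (X \<bullet> X) + t * (X \<bullet> (?g *v X))"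
        by (simp add: L_def matrix_vector_mult_add_rdistrib inner_add_right flip: scaleR_matrix_vector_assoc)
      show ?thesis
      proof (cases "t = 0")
        case False
        then have "t * (X \<bullet> (?g *v X)) > 0" using pos[OF that] \<open>0 \<le> t\<close> by simp
        moreover have "(1 - t) * (X \<bullet> X) \<ge> 0" using \<open>t \<le> 1\<close> by simp
        ultimately show ?thesis unfolding e by linarith
      next
        case True
        then show ?thesis using that unfolding e by simp
      qed
    qed
    then show ?thesis using posdef_invertible invertible_det_nz by blast
  qed
  have "continuous_on {0..1} (\<lambda>t. det (L t))"
    unfolding det_def L_def by (intro continuous_intros)
  moreover have "det (L 0) = 1" by (simp add: L_def)
  ultimately have "det (L 1) > 0"
    using IVT2'[of "\<lambda>t. det (L t)" 1 0 0] L by (metis linorder_not_le zero_less_one_class.zero_le_one order_refl zero_le_one)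
  then show ?thesis by (simp add: L_def)
qed

lemma dens_pos: "b \<in> A \<Longrightarrow> x \<in> chart_range b \<Longrightarrow> dens b x > 0"
  using det_metric_pos by (simp add: dens_def)

lemma dens_smooth: "b \<in> A \<Longrightarrow> smooth_on (dens b) (chart_range b)"
  unfolding dens_def[abs_def]
  using det_metric_pos h chart_range_open
  by (intro smooth_on_sqrt smooth_on_det metric_smooth[of "h b"]) auto

text \<open>\<open>area_element\<close> prescribes the measure only of sets inside a chart domain.
  So the restriction of \<mu> to the domain is identified with the image under
  \<open>chart_inv b\<close> of Lebesgue measure with density \<open>dens b\<close>, and the support
  condition confines \<open>u\<close> to that domain.\<close>

lemma integral_in_chart:
  fixes u :: "'a \<Rightarrow> real"
  assumes b: "b \<in> A" and K: "compact K" "K \<subseteq> chart_range b"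
    and u: "continuous_on (chart_range b) (\<lambda>x. u (chart_inv b x))"
    and supp: "\<And>p. p \<in> M \<Longrightarrow> u p \<noteq> 0 \<Longrightarrow> p \<in> fst b \<and> snd b p \<in> K"
  shows "integrable \<mu> u" "integral\<^sup>L \<mu> u = (\<integral>x. indicator K x * (u (chart_inv b x) * dens b x) \<partial>lborel)"
proof -
  let ?V = "chart_range b" and ?N = "restrict_space borel M :: 'a measure"
  have sets\<mu>: "sets \<mu> = sets ?N" using \<mu> by (simp add: area_element_def)
  then have space\<mu>: "space \<mu> = M" using sets_eq_imp_space_eq by (metis space_restrict_space Int_UNIV_right space_borel)
  have Mb: "M \<in> sets borel" using compact_imp_closed[OF comp] by (rule borel_closed)
  have V: "?V \<in> sets borel" using chart_range_open[OF b] by simp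
  have fb: "fst b \<in> sets borel"
    using chart_openin[OF b] Mb by (auto simp: openin_open)
  have fbN: "fst b \<in> sets ?N"
    using fb chart_subset[OF b] by (auto simp: sets_restrict_space_iff Mb)
  have cont: "continuous_on (fst b) u"
  proof -
    have "continuous_on (fst b) (\<lambda>p. u (chart_inv b (snd b p)))"
      by (rule continuous_on_compose2[OF u chart_continuous[OF b]]) (use chart_in[OF b] in auto)
    then show ?thesis
      by (simp add: chart_inv_chart[OF b] cong: continuous_on_cong)
  qed
  have um: "u \<in> borel_measurable ?N"
  proof -
    have "(\<lambda>p. indicator (fst b) p *\<^sub>R u p) \<in> borel_measurable borel"
      using cont fb by (intro borel_measurable_continuous_on_indicator)
    then have "(\<lambda>p. indicator (fst b) p *\<^sub>R u p) \<in> borel_measurable ?N"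
      by (rule measurable_restrict_space1)
    moreover have "indicator (fst b) p *\<^sub>R u p = u p" if "p \<in> space ?N" for p
      using supp[of p] that by (auto simp: indicator_def space_restrict_space)
    ultimately show ?thesis
      using measurable_cong[of ?N "\<lambda>p. indicator (fst b) p *\<^sub>R u p" u] by blast
  qed
  have inv_m: "chart_inv b \<in> measurable (restrict_space lborel ?V) ?N"
  proof (rule measurable_restrict_space2)
    show "chart_inv b \<in> space (restrict_space lborel ?V) \<rightarrow> M"
      using chart_inv_in_manifold[OF b] by (auto simp: space_restrict_space)
    have "chart_inv b \<in> borel_measurable (restrict_space borel ?V)"
      by (rule borel_measurable_continuous_on_restrict[OF chart_inv_continuous[OF b]])
    then show "chart_inv b \<in> borel_measurable (restrict_space lborel ?V)"
      by (simp cong: measurable_cong_sets sets_restrict_space_cong)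
  qed
  have dens_m: "dens b \<in> borel_measurable (restrict_space lborel ?V)"
  proof -
    have "dens b \<in> borel_measurable (restrict_space borel ?V)"
      by (rule borel_measurable_continuous_on_restrict[OF smooth_on_continuous_on[OF dens_smooth[OF b]]])
    then show ?thesis
      by (simp cong: measurable_cong_sets sets_restrict_space_cong)
  qed
  \<comment> \<open>\<open>M1\<close> is the image measure. \<open>M2\<close> is the restriction of
    \<mu>, written as a density so that the rules for integrals against densities apply.\<close>
  define M1 where "M1 = distr (density (restrict_space lborel ?V) (\<lambda>x. ennreal (dens b x))) ?N (chart_inv b)"
  define M2 where "M2 = density \<mu> (\<lambda>p. indicator (fst b) p)"
  have "M1 = M2"
  proof (rule measure_eqI)
    show "sets M1 = sets M2" by (simp add: M1_def M2_def sets\<mu>)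
    fix E assume "E \<in> sets M1"
    then have E: "E \<in> sets ?N" by (simp add: M1_def)
    let ?E' = "chart_inv b -` E \<inter> ?V"
    have im: "snd b ` (E \<inter> fst b) = ?E'"
      using chart_inv_in[OF b] chart_chart_inv[OF b] chart_in[OF b] chart_inv_chart[OF b] by (force simp: image_iff)
    have E': "?E' \<in> sets (restrict_space lborel ?V)"
      using measurable_sets[OF inv_m E] by (simp add: space_restrict_space)
    have "emeasure M1 E = emeasure (density (restrict_space lborel ?V) (\<lambda>x. ennreal (dens b x))) ?E'"
      unfolding M1_def using E inv_m
      by (subst emeasure_distr) (auto simp: space_restrict_space cong: measurable_cong_sets)
    also have "\<dots> = (\<integral>\<^sup>+x. ennreal (dens b x) * indicator ?E' x \<partial>restrict_space lborel ?V)"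
      by (rule emeasure_density) (use dens_m E' in auto)
    also have "\<dots> = (\<integral>\<^sup>+x. ennreal (dens b x) * indicator ?E' x * indicator ?V x \<partial>lborel)"
      by (rule nn_integral_restrict_space) (use V in auto)
    also have "\<dots> = (\<integral>\<^sup>+x\<in>?E'. ennreal (dens b x) \<partial>lborel)"
      by (rule nn_integral_cong) (auto simp: indicator_def)
    also have "\<dots> = emeasure \<mu> (E \<inter> fst b)"
    proof -
      have "E \<inter> fst b \<in> sets \<mu>" using E fbN sets\<mu> by auto
      then show ?thesis using \<mu> b im unfolding area_element_def dens_def by simp
    qed
    also have "\<dots> = emeasure M2 E"
    proof -
      have "emeasure M2 E = (\<integral>\<^sup>+p. indicator (fst b) p * indicator E p \<partial>\<mu>)"
        unfolding M2_def by (rule emeasure_density) (use E fbN sets\<mu> in auto)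
      also have "\<dots> = (\<integral>\<^sup>+p. indicator (E \<inter> fst b) p \<partial>\<mu>)"
        by (rule nn_integral_cong) (auto simp: indicator_def)
      finally show ?thesis using E fbN sets\<mu> by simp
    qed
    finally show "emeasure M1 E = emeasure M2 E" .
  qed
  have um\<mu>: "u \<in> borel_measurable \<mu>"
    using um sets\<mu> by (simp cong: measurable_cong_sets)
  have u_ind: "u p = indicator (fst b) p *\<^sub>R u p" if "p \<in> space \<mu>" for p
    using supp[of p] that by (auto simp: indicator_def space\<mu>)
  have M2d: "M2 = density \<mu> (\<lambda>p. ennreal (indicator (fst b) p))"
    by (simp add: M2_def ennreal_indicator)
  have ind_m: "(\<lambda>p. indicator (fst b) p :: real) \<in> borel_measurable \<mu>"
    using fbN sets\<mu> by auto
  have 2: "integrable \<mu> u \<longleftrightarrow> integrable M2 u" "integral\<^sup>L \<mu> u = integral\<^sup>L M2 u"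
  proof -
    have "integrable M2 u \<longleftrightarrow> integrable \<mu> (\<lambda>p. indicator (fst b) p *\<^sub>R u p)"
      unfolding M2d by (rule integrable_density[OF um\<mu> ind_m]) simp
    also have "\<dots> \<longleftrightarrow> integrable \<mu> u"
      by (rule Bochner_Integration.integrable_cong) (use u_ind in auto)
    finally show "integrable \<mu> u \<longleftrightarrow> integrable M2 u" ..
    have "integral\<^sup>L M2 u = integral\<^sup>L \<mu> (\<lambda>p. indicator (fst b) p *\<^sub>R u p)"
      unfolding M2d by (rule integral_density[OF um\<mu> ind_m]) simp
    also have "\<dots> = integral\<^sup>L \<mu> u"
      by (rule Bochner_Integration.integral_cong) (use u_ind in auto)
    finally show "integral\<^sup>L \<mu> u = integral\<^sup>L M2 u" ..
  qed
  have ui_m: "(\<lambda>x. u (chart_inv b x)) \<in> borel_measurable (restrict_space lborel ?V)"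
    using measurable_compose[OF inv_m um] .
  have d0: "AE x in restrict_space lborel ?V. 0 \<le> dens b x"
    using dens_pos[OF b] by (intro AE_I2) (auto simp: space_restrict_space less_imp_le)
  have inv_m': "chart_inv b \<in> measurable (density (restrict_space lborel ?V) (\<lambda>x. ennreal (dens b x))) ?N"
    using inv_m by (simp cong: measurable_cong_sets)
  let ?w = "\<lambda>x. indicator K x * (u (chart_inv b x) * dens b x)"
  \<comment> \<open>On the chart range \<open>u\<close> vanishes off \<open>K\<close>, so the two
    indicators may be exchanged; with the compact one, integrability follows from
    continuity.\<close>
  have w: "indicator ?V x *\<^sub>R (dens b x *\<^sub>R u (chart_inv b x)) = ?w x" for x
    using supp[of "chart_inv b x"] chart_inv_in_manifold[OF b, of x] chart_chart_inv[OF b, of x] K(2)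
    by (cases "x \<in> ?V") (auto simp: indicator_def)
  have 1: "integrable M1 u \<longleftrightarrow> integrable lborel ?w" "integral\<^sup>L M1 u = integral\<^sup>L lborel ?w"
  proof -
    have "integrable M1 u \<longleftrightarrow> integrable (density (restrict_space lborel ?V) (\<lambda>x. ennreal (dens b x))) (\<lambda>x. u (chart_inv b x))"
      unfolding M1_def by (rule integrable_distr_eq[OF inv_m' um])
    also have "\<dots> \<longleftrightarrow> integrable (restrict_space lborel ?V) (\<lambda>x. dens b x *\<^sub>R u (chart_inv b x))"
      by (rule integrable_density[OF ui_m dens_m d0])
    also have "\<dots> \<longleftrightarrow> integrable lborel (\<lambda>x. indicator ?V x *\<^sub>R (dens b x *\<^sub>R u (chart_inv b x)))"
      by (rule integrable_restrict_space) (use V in auto)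
    finally show "integrable M1 u \<longleftrightarrow> integrable lborel ?w" unfolding w .
    have "integral\<^sup>L M1 u = integral\<^sup>L (density (restrict_space lborel ?V) (\<lambda>x. ennreal (dens b x))) (\<lambda>x. u (chart_inv b x))"
      unfolding M1_def by (rule integral_distr[OF inv_m' um])
    also have "\<dots> = integral\<^sup>L (restrict_space lborel ?V) (\<lambda>x. dens b x *\<^sub>R u (chart_inv b x))"
      by (rule integral_density[OF ui_m dens_m d0])
    also have "\<dots> = integral\<^sup>L lborel (\<lambda>x. indicator ?V x *\<^sub>R (dens b x *\<^sub>R u (chart_inv b x)))"
      by (rule integral_restrict_space) (use V in auto)
    finally show "integral\<^sup>L M1 u = integral\<^sup>L lborel ?w" unfolding w .
  qed
  have "continuous_on K (\<lambda>x. u (chart_inv b x) * dens b x)"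
    using smooth_on_continuous_on[OF dens_smooth[OF b]] u K(2)
    by (intro continuous_on_mult) (auto intro: continuous_on_subset)
  then have "integrable lborel ?w"
    using borel_integrable_compact[OF K(1), of "\<lambda>x. u (chart_inv b x) * dens b x"] by (simp only: real_scaleR_def)
  then show "integrable \<mu> u" using 1 2 \<open>M1 = M2\<close> by simp
  show "integral\<^sup>L \<mu> u = integral\<^sup>L lborel ?w" using 1 2 \<open>M1 = M2\<close> by simp
qed

text \<open>A continuous function may fail to be integrable on a chart range; multiplied by a member
  of the partition of unity it has compact support there.\<close>

lemma continuous_integrable:
  fixes u :: "'a \<Rightarrow> real"
  assumes u: "\<And>b. b \<in> A \<Longrightarrow> continuous_on (chart_range b) (\<lambda>x. u (chart_inv b x))"
  shows "integrable \<mu> u"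
proof -
  obtain I :: "'a set" and c K \<psi> where "partition_of_unity I c K \<psi>"
    using partition_of_unity_exists[OF comp] by blast
  note P = partition_of_unityD[OF this]
  have "integrable \<mu> (\<lambda>p. \<psi> i p * u p)" if i: "i \<in> I" for i
  proof (rule integral_in_chart(1)[OF P(2)[OF i] P(3)[OF i] P(4)[OF i]])
    have "continuous_on (chart_range (c i)) (\<psi> i \<circ> chart_inv (c i))"
      by (rule Ck_on_1_continuous[OF P(6)[OF i P(2)[OF i]]])
    then show "continuous_on (chart_range (c i)) (\<lambda>x. \<psi> i (chart_inv (c i) x) * u (chart_inv (c i) x))"
      using u[OF P(2)[OF i]] by (auto intro!: continuous_on_mult simp: o_def)
  qed (use P(5)[OF i] in auto)
  then have "integrable \<mu> (\<lambda>p. \<Sum>i\<in>I. \<psi> i p * u p)" by auto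
  moreover have "(\<Sum>i\<in>I. \<psi> i p * u p) = u p" if "p \<in> space \<mu>" for p
  proof -
    have "p \<in> M" using that \<mu> sets_eq_imp_space_eq[of \<mu> "restrict_space borel M"]
      by (auto simp: area_element_def space_restrict_space)
    then show ?thesis using P(7) by (simp flip: sum_distrib_right)
  qed
  ultimately show ?thesis
    by (simp cong: Bochner_Integration.integrable_cong)
qed

text \<open>The partition of unity splits \<open>y\<close> into fields with compact support in one
  chart. \<open>W i\<close> is the divergence of the \<open>i\<close>-th one; times the area density
  it is the sum of the partial derivatives of the functions \<open>f j\<close>, each of which has
  integral 0.\<close>

lemma divergence_theorem:
  fixes y :: "('a, 'n) chart \<Rightarrow> real^'n \<Rightarrow> real^'n" and D :: "'a \<Rightarrow> real"
  assumes y: "\<And>b. b \<in> A \<Longrightarrow> smooth_on (y b) (chart_range b)"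
    and y_transform: "\<And>b b' p. b \<in> A \<Longrightarrow> b' \<in> A \<Longrightarrow> p \<in> fst b \<inter> fst b' \<Longrightarrow>
      y b' (snd b' p) = Dif (transition b b') (snd b p) (y b (snd b p))"
    and D: "\<And>b p. b \<in> A \<Longrightarrow> p \<in> fst b \<Longrightarrow> D p = trace (matrix (Dif (y b) (snd b p))) +
      1/2 * trace (matrix_inv (h b (snd b p)) ** Dif (h b) (snd b p) (y b (snd b p)))"
  shows "integrable \<mu> D" "integral\<^sup>L \<mu> D = 0"
proof -
  obtain I :: "'a set" and c K \<psi> where "partition_of_unity I c K \<psi>"
    using partition_of_unity_exists[OF comp] by blast
  note P = partition_of_unityD[OF this]
  have d\<psi>: "(\<psi> i \<circ> chart_inv b has_derivative Dif (\<psi> i \<circ> chart_inv b) x) (at x)"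
    if "i \<in> I" "b \<in> A" "x \<in> chart_range b" for i b x
    using Ck_on_SucD[of 0] P(6)[OF that(1,2)] that(3) by simp
  \<comment> \<open>The derivative of \<open>\<psi> i\<close> along the field, as a function on the
    manifold. By \<open>y_transform\<close> any other chart gives the same value.\<close>
  define Q where "Q i p = Dif (\<psi> i \<circ> chart_inv (chart_at A p)) (snd (chart_at A p) p)
    (y (chart_at A p) (snd (chart_at A p) p))" for i p
  have Q: "Q i p = Dif (\<psi> i \<circ> chart_inv b) (snd b p) (y b (snd b p))"
    if i: "i \<in> I" and b: "b \<in> A" and p: "p \<in> fst b" for i b p
  proof -
    let ?c = "chart_at A p"
    have pM: "p \<in> M" using chart_subset[OF b] p by auto
    note c = chart_at[OF pM]
    have c1: "?c \<in> A" and c2: "p \<in> fst ?c" using c by auto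
    have ov: "snd ?c p \<in> overlap ?c b" using c2 p by (auto simp: overlap_def)
    have tr: "transition ?c b (snd ?c p) = snd b p"
      using chart_inv_chart[OF c1 c2] by (simp add: transition_def)
    have "Dif (\<psi> i \<circ> chart_inv ?c) (snd ?c p) =
        (\<lambda>X. Dif (\<psi> i \<circ> chart_inv b) (snd b p) (Dif (transition ?c b) (snd ?c p) X))"
      using chart_change_derivative[OF c1 b ov, unfolded tr, OF d\<psi>[OF i b chart_in[OF b p]]]
      by (rule Dif_eq)
    then show ?thesis
      unfolding Q_def using y_transform[OF c1 b, of p] c2 p by simp
  qed
  define W where "W i p = \<psi> i p * D p + Q i p" for i p
  have W: "integrable \<mu> (W i) \<and> integral\<^sup>L \<mu> (W i) = 0" if i: "i \<in> I" for i
  proof -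
    let ?b = "c i" and ?V = "chart_range (c i)"
    note b = P(2)[OF i]
    note V = chart_range_open[OF b]
    \<comment> \<open>The extension by zero is differentiable everywhere: the chart range and the
      complement of \<open>K i\<close> are open and cover R^n, and \<open>f j\<close> vanishes on
      the latter.\<close>
    define f where "f j x = (if x \<in> ?V then \<psi> i (chart_inv ?b x) * (y ?b x $ j * dens ?b x) else 0)" for j x
    have Kc: "open (- K i)" using P(3)[OF i] compact_imp_closed by blast
    have \<psi>0: "\<psi> i (chart_inv ?b x) = 0" if "x \<in> ?V" "x \<notin> K i" for x
      using P(5)[OF i chart_inv_in_manifold[OF b that(1)]] chart_chart_inv[OF b that(1)] that(2) by auto
    have f0: "f j x = 0" if "x \<notin> K i" for j x
      using \<psi>0 that by (auto simp: f_def)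
    have fV: "Ck_on 1 (f j) ?V" for j
    proof -
      have "Ck_on 1 (\<lambda>x. y ?b x $ j * dens ?b x) ?V"
        using smooth_on_mult[OF V smooth_on_nth[OF V y[OF b]] dens_smooth[OF b]] by (simp add: smooth_on_def)
      then have "Ck_on 1 (\<lambda>x. (\<psi> i \<circ> chart_inv ?b) x * (y ?b x $ j * dens ?b x)) ?V"
        by (rule Ck_on_bilinear[OF V bounded_bilinear_mult P(6)[OF i b]])
      then show ?thesis
        by (rule Ck_on_cong[OF V, rotated]) (simp add: f_def)
    qed
    have f1: "Ck_on 1 (f j) UNIV" for j
    proof (rule Ck_on_local)
      fix x
      show "\<exists>W. open W \<and> x \<in> W \<and> Ck_on 1 (f j) W"
      proof (cases "x \<in> K i")
        case True
        then show ?thesis using V fV P(4)[OF i] by blast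
      next
        case False
        have "Ck_on 1 (f j) (- K i)"
          by (rule Ck_on_cong[OF Kc _ Ck_on_const[OF Kc, of 1 0]]) (simp add: f0)
        then show ?thesis using False Kc by blast
      qed
    qed
    have df: "(f j has_derivative Dif (f j) x) (at x)" for j x
      using Ck_on_SucD[of 0 "f j" UNIV] f1 by simp
    have cf: "continuous_on UNIV (\<lambda>x. Dif (f j) x (axis j 1))" for j
      using f1[of j] by (simp add: Basis_vec_def)
    note int = integral_directional_derivative_zero[OF df cf P(3)[OF i] f0]
    have sum: "(\<Sum>j\<in>UNIV. Dif (f j) x (axis j 1)) = W i (chart_inv ?b x) * dens ?b x" if x: "x \<in> ?V" for x
    proof -
      let ?p = "chart_inv ?b x"
      have p: "?p \<in> fst ?b" "snd ?b ?p = x" using chart_inv_in[OF b x] chart_chart_inv[OF b x] by auto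
      note h\<psi> = d\<psi>[OF i b x, unfolded o_def]
      \<comment> \<open>Jacobi's formula under a square root gives half the trace; this produces the
        second term of \<open>D\<close>.\<close>
      have dd: "(dens ?b has_derivative (\<lambda>e. dens ?b x * (1/2 * trace (matrix_inv (h ?b x) ** Dif (h ?b) x e)))) (at x)"
      proof -
        have dh: "(h ?b has_derivative Dif (h ?b) x) (at x)"
          by (rule smooth_onD[OF metric_smooth[OF h[OF b]] x])
        have "sqrt (det (h ?b x)) * sqrt (det (h ?b x)) = det (h ?b x)"
          using det_metric_pos[OF b x] by simp
        then show ?thesis
          unfolding dens_def[abs_def] using det_metric_pos[OF b x]
          by (auto intro!: derivative_eq_intros has_derivative_det dh metric_invertible[OF h[OF b] x] simp: field_simps)
      qed
      have dy: "((\<lambda>x. y ?b x $ j) has_derivative (\<lambda>e. Dif (y ?b) x e $ j)) (at x)" for j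
        by (intro bounded_linear.has_derivative[OF bounded_linear_vec_nth] smooth_onD[OF y[OF b] x])
      let ?f' = "\<lambda>j e. \<psi> i ?p * (y ?b x $ j * (dens ?b x * (1/2 * trace (matrix_inv (h ?b x) ** Dif (h ?b) x e))) +
          Dif (y ?b) x e $ j * dens ?b x) + Dif (\<psi> i \<circ> chart_inv ?b) x e * (y ?b x $ j * dens ?b x)"
      have Df: "Dif (f j) x = ?f' j" for j
      proof (rule Dif_eq)
        have "((\<lambda>x. \<psi> i (chart_inv ?b x) * (y ?b x $ j * dens ?b x)) has_derivative ?f' j) (at x)"
          using h\<psi> by (intro has_derivative_mult dd dy) (simp add: o_def)
        then show "(f j has_derivative ?f' j) (at x)"
          using has_derivative_cong_open[OF V x, of "f j" "\<lambda>x. \<psi> i (chart_inv ?b x) * (y ?b x $ j * dens ?b x)"]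
          by (simp add: f_def)
      qed
      have lin: "(\<Sum>j\<in>UNIV. y ?b x $ j * L (axis j 1)) = L (y ?b x)" if "linear L" for L :: "real^'n \<Rightarrow> real"
      proof -
        have "L (\<Sum>j\<in>UNIV. y ?b x $ j *\<^sub>R axis j 1) = (\<Sum>j\<in>UNIV. y ?b x $ j * L (axis j 1))"
          by (simp add: linear_sum[OF that] linear_scale[OF that])
        then show ?thesis by (simp add: basis_expansion[of "y ?b x", unfolded scalar_mult_eq_scaleR])
      qed
      have 1: "linear (\<lambda>e. trace (matrix_inv (h ?b x) ** Dif (h ?b) x e))"
      proof -
        have "bounded_linear (Dif (h ?b) x)"
          by (rule has_derivative_bounded_linear[OF smooth_onD[OF metric_smooth[OF h[OF b]] x]])
        then have "bounded_linear (\<lambda>e. trace (matrix_inv (h ?b x) ** Dif (h ?b) x e))"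
          using bounded_linear_compose[OF bounded_linear_trace bounded_linear_compose[OF
                bounded_bilinear.bounded_linear_right[OF bounded_bilinear_matrix_mult]]] by blast
        then show ?thesis by (rule bounded_linear.linear)
      qed
      have 2: "linear (Dif (\<psi> i \<circ> chart_inv ?b) x)"
        using d\<psi>[OF i b x] has_derivative_linear by blast
      have "(\<Sum>j\<in>UNIV. Dif (f j) x (axis j 1)) =
          \<psi> i ?p * (1/2 * trace (matrix_inv (h ?b x) ** Dif (h ?b) x (y ?b x)) * dens ?b x +
            (\<Sum>j\<in>UNIV. Dif (y ?b) x (axis j 1) $ j) * dens ?b x) +
          Dif (\<psi> i \<circ> chart_inv ?b) x (y ?b x) * dens ?b x"
        unfolding Df lin[OF 1, symmetric] lin[OF 2, symmetric]
        by (simp add: sum.distrib sum_distrib_left sum_distrib_right distrib_left mult_ac)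
      also have "(\<Sum>j\<in>UNIV. Dif (y ?b) x (axis j 1) $ j) = trace (matrix (Dif (y ?b) x))"
        by (simp add: trace_def matrix_def)
      finally show ?thesis
        using D[OF b p(1)] Q[OF i b p(1)] by (simp add: W_def p(2) o_def algebra_simps)
    qed
    have cW: "continuous_on ?V (\<lambda>x. W i (chart_inv ?b x))"
    proof -
      have "continuous_on ?V (\<lambda>x. (\<Sum>j\<in>UNIV. Dif (f j) x (axis j 1)) / dens ?b x)"
        using continuous_on_subset[OF cf] smooth_on_continuous_on[OF dens_smooth[OF b]] dens_pos[OF b]
        by (intro continuous_intros) (auto simp: less_le)
      moreover have "(\<Sum>j\<in>UNIV. Dif (f j) x (axis j 1)) / dens ?b x = W i (chart_inv ?b x)" if "x \<in> ?V" for x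
        using sum[OF that] dens_pos[OF b that] by simp
      ultimately show ?thesis by (simp cong: continuous_on_cong)
    qed
    \<comment> \<open>\<open>Q i\<close> involves a derivative, so it does not suffice that
      \<open>\<psi> i\<close> vanishes at \<open>p\<close>. The image of \<open>K i\<close> is
      closed, hence \<open>\<psi> i\<close> vanishes on a whole neighbourhood of
      \<open>p\<close>.\<close>
    have supp: "p \<in> fst ?b \<and> snd ?b p \<in> K i" if p: "p \<in> M" and "W i p \<noteq> 0" for p
    proof (rule ccontr)
      assume n: "\<not> (p \<in> fst ?b \<and> snd ?b p \<in> K i)"
      let ?C = "chart_inv ?b ` K i" and ?c = "chart_at A p"
      have c1: "?c \<in> A" and c2: "p \<in> fst ?c" using chart_at[OF p] by auto
      have "compact ?C"
        by (rule compact_continuous_image[OF continuous_on_subset[OF chart_inv_continuous[OF b] P(4)[OF i]] P(3)[OF i]])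
      then have "openin (top_of_set M) (M \<inter> - ?C)"
        using compact_imp_closed by (intro openin_open_Int) blast
      then have o: "open {y \<in> chart_range ?c. chart_inv ?c y \<in> M \<inter> - ?C}"
        by (rule open_chart_preimage[OF c1])
      have "p \<notin> ?C"
        using n chart_inv_in[OF b] chart_chart_inv[OF b] P(4)[OF i] by force
      then have x: "snd ?c p \<in> {y \<in> chart_range ?c. chart_inv ?c y \<in> M \<inter> - ?C}"
        using chart_in[OF c1 c2] chart_inv_chart[OF c1 c2] p by auto
      have z: "\<psi> i q = 0" if "q \<in> M \<inter> - ?C" for q
      proof (rule ccontr)
        assume "\<psi> i q \<noteq> 0"
        then have "q \<in> fst ?b" "snd ?b q \<in> K i" using P(5)[OF i, of q] that by auto
        then have "q \<in> ?C" using chart_inv_chart[OF b, of q] by (metis imageI)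
        then show False using that by blast
      qed
      have "Dif (\<psi> i \<circ> chart_inv ?c) (snd ?c p) = Dif (\<lambda>_. 0) (snd ?c p)"
        by (rule Dif_cong_open[OF o x]) (use z in auto)
      then have "Q i p = 0"
        by (simp add: Q_def)
      moreover have "\<psi> i p = 0" using z p \<open>p \<notin> ?C\<close> by blast
      ultimately show False using that(2) by (simp add: W_def)
    qed
    note chart = integral_in_chart[OF b P(3)[OF i] P(4)[OF i] cW supp]
    have "integral\<^sup>L \<mu> (W i) = (\<integral>x. (\<Sum>j\<in>UNIV. Dif (f j) x (axis j 1)) \<partial>lborel)"
    proof -
      have "indicator (K i) x * (W i (chart_inv ?b x) * dens ?b x) = (\<Sum>j\<in>UNIV. Dif (f j) x (axis j 1))" for x
      proof (cases "x \<in> K i")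
        case True
        then show ?thesis using sum[of x] P(4)[OF i] by auto
      next
        case False
        have "Dif (f j) x = Dif (\<lambda>_. 0) x" for j
          by (rule Dif_cong_open[OF Kc]) (use False f0 in auto)
        then show ?thesis using False by simp
      qed
      then show ?thesis using chart(2) by simp
    qed
    also have "\<dots> = 0"
      using int by (simp add: integral_sum)
    finally show ?thesis using chart(1) by simp
  qed
  have M\<mu>: "p \<in> M" if "p \<in> space \<mu>" for p
    using that \<mu> sets_eq_imp_space_eq[of \<mu> "restrict_space borel M"]
    by (auto simp: area_element_def space_restrict_space)
  have eq: "(\<Sum>i\<in>I. W i p) = D p" if "p \<in> space \<mu>" for p
  proof -
    have p: "p \<in> M" using M\<mu>[OF that] .
    let ?c = "chart_at A p"
    have c1: "?c \<in> A" and c2: "p \<in> fst ?c" using chart_at[OF p] by auto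
    note x = chart_in[OF c1 c2]
    \<comment> \<open>The functions \<open>\<psi> i\<close> add up to the constant 1, so their
      derivatives along the field add up to 0 and the corrections \<open>Q i\<close> disappear from
      the sum.\<close>
    have "((\<lambda>x. \<Sum>i\<in>I. (\<psi> i \<circ> chart_inv ?c) x) has_derivative
        (\<lambda>X. \<Sum>i\<in>I. Dif (\<psi> i \<circ> chart_inv ?c) (snd ?c p) X)) (at (snd ?c p))"
      by (intro has_derivative_sum d\<psi> c1 x)
    moreover have "((\<lambda>x. \<Sum>i\<in>I. (\<psi> i \<circ> chart_inv ?c) x) has_derivative (\<lambda>X. 0)) (at (snd ?c p))"
      using has_derivative_cong_open[OF chart_range_open[OF c1] x, of "\<lambda>x. \<Sum>i\<in>I. (\<psi> i \<circ> chart_inv ?c) x" "\<lambda>_. 1"]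
        P(7)[OF chart_inv_in_manifold[OF c1]] by simp
    ultimately have "(\<lambda>X. \<Sum>i\<in>I. Dif (\<psi> i \<circ> chart_inv ?c) (snd ?c p) X) = (\<lambda>X. 0)"
      by (rule has_derivative_unique)
    then have "(\<Sum>i\<in>I. Q i p) = 0"
      unfolding Q_def by (rule fun_cong)
    then show ?thesis
      using P(7)[OF p] by (simp add: W_def sum.distrib flip: sum_distrib_right)
  qed
  have "integrable \<mu> (\<lambda>p. \<Sum>i\<in>I. W i p)" using W by auto
  then show "integrable \<mu> D" by (simp add: eq cong: Bochner_Integration.integrable_cong)
  have "integral\<^sup>L \<mu> D = integral\<^sup>L \<mu> (\<lambda>p. \<Sum>i\<in>I. W i p)"
    by (rule Bochner_Integration.integral_cong) (simp_all add: eq)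
  also have "\<dots> = 0" using W by (simp add: integral_sum)
  finally show "integral\<^sup>L \<mu> D = 0" .
qed

end

end

section \<open>Deformations of a hypersurface\<close>

lemma smooth_on_local:
  assumes "\<And>x. x \<in> V \<Longrightarrow> \<exists>W. open W \<and> x \<in> W \<and> smooth_on f W"
  shows "smooth_on f V"
  unfolding smooth_on_def using Ck_on_local[of V _ f] assms unfolding smooth_on_def by metis

lemma has_derivative_slice:
  assumes "(F has_derivative F') (at (s, x))"
  shows "((\<lambda>x. F (s, x)) has_derivative (\<lambda>X. F' (0, X))) (at x)"
    and "((\<lambda>s. F (s, x)) has_derivative (\<lambda>r. F' (r, 0))) (at s)"
proof -
  show "((\<lambda>x. F (s, x)) has_derivative (\<lambda>X. F' (0, X))) (at x)"
    by (rule has_derivative_compose[where f = "\<lambda>x. (s, x)" and g = F, OF _ assms])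
      (auto intro!: derivative_eq_intros)
  show "((\<lambda>s. F (s, x)) has_derivative (\<lambda>r. F' (r, 0))) (at s)"
    by (rule has_derivative_compose[where f = "\<lambda>s. (s, x)" and g = F, OF _ assms])
      (auto intro!: derivative_eq_intros)
qed

lemma smooth_on_slice:
  fixes F :: "real \<times> 'a::euclidean_space \<Rightarrow> 'b::real_normed_vector"
  assumes "open V" "smooth_on F \<Omega>" "open \<Omega>" "\<And>x. x \<in> V \<Longrightarrow> (s, x) \<in> \<Omega>"
  shows "smooth_on (\<lambda>x. F (s, x)) V"
proof -
  have "smooth_on (\<lambda>x::'a. (s, x)) V"
    unfolding smooth_on_def
  proof
    fix k
    show "Ck_on k (\<lambda>x::'a. (s, x)) V"
    proof (cases k)
      case 0
      then show ?thesis by (auto intro!: continuous_intros)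
    next
      case (Suc l)
      show ?thesis
        unfolding Suc by (rule Ck_on_SucI[OF assms(1), of _ "\<lambda>_ X. (0, X)"])
          (auto intro!: derivative_eq_intros Ck_on_const assms(1))
    qed
  qed
  then show ?thesis
    using smooth_on_compose[where f = "\<lambda>x::'a. (s, x)" and g = F, OF assms(1,3) _ _ assms(2)] assms(4) by auto
qed

lemma conn_mult:
  "conn G x a *v w = (\<chi> k. \<Sum>i\<in>UNIV. \<Sum>j\<in>UNIV. christoffel G x k i j * a $ i * w $ j)"
proof -
  have "(conn G x a *v w) $ k = (\<Sum>i\<in>UNIV. \<Sum>j\<in>UNIV. christoffel G x k i j * a $ i * w $ j)" for k
    unfolding matrix_vector_mult_def conn_def vec_lambda_beta sum_distrib_right by (rule sum.swap)
  then show ?thesis by (simp add: vec_eq_iff)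
qed

lemma gram_matrix:
  fixes E :: "real^'m^'n"
  shows "(\<chi> i j. (E *v axis i 1) \<bullet> (g *v (E *v axis j 1))) = transpose E ** g ** E"
proof -
  have "(E *v axis i 1) \<bullet> (g *v (E *v axis j 1)) = (transpose E ** g ** E) $ i $ j" for i j
  proof -
    have "(E *v axis i 1) \<bullet> (g *v (E *v axis j 1)) = axis i 1 \<bullet> ((transpose E ** g ** E) *v axis j 1)"
      by (simp add: inner_matrix_transpose matrix_vector_mul_assoc matrix_mul_assoc)
    also have "\<dots> = (transpose E ** g ** E) $ i $ j"
      by (simp add: matrix_vector_mult_basis column_def inner_axis')
    finally show ?thesis .
  qed
  then show ?thesis by (simp add: vec_eq_iff)
qed

lemma pullback_matrix:
  fixes T :: "real^'n^'m"
  assumes "\<And>X Y. X \<bullet> (g *v Y) = (T *v X) \<bullet> (g' *v (T *v Y))"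
  shows "g = transpose T ** g' ** T"
  by (rule matrix_eq_inner)
    (simp add: assms inner_matrix_transpose matrix_vector_mul_assoc matrix_mul_assoc)

text \<open>The direction enters both terms of \<open>cov\<close> through derivatives only, so the
  chain rule handles both at once.\<close>

lemma cov_reparametrize:
  assumes \<kappa>: "(\<kappa> has_derivative \<kappa>') (at z)"
    and F: "(F has_derivative F') (at (\<kappa> z))" and Z: "(Z has_derivative Z') (at (\<kappa> z))"
    and W: "open W" "z \<in> W" "\<And>y. y \<in> W \<Longrightarrow> F1 y = F (\<kappa> y)" "\<And>y. y \<in> W \<Longrightarrow> Z1 y = Z (\<kappa> y)"
  shows "cov G F1 Z1 d z = cov G F Z (\<kappa>' d) (\<kappa> z)"
  unfolding cov_def
  using Dif_cong_open[OF W(1-3)] Dif_cong_open[OF W(1,2,4)] Dif_eq[OF has_derivative_compose[OF \<kappa> F]]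
    Dif_eq[OF has_derivative_compose[OF \<kappa> Z]] Dif_eq[OF F] Dif_eq[OF Z] W by simp

locale hypersurface_deformation =
  fixes M \<Sigma> :: "'a::{t2_space,second_countable_topology} set"
    and A :: "('a, 'n::finite) chart set"
    and B :: "('a, 'm::finite) chart set"
    and g :: "('a, 'n) metric"
    and n v :: "('a, 'n) vfield"
    and \<phi> :: "real \<Rightarrow> 'a \<Rightarrow> 'a"
    and \<nu> :: "real \<Rightarrow> ('a, 'n) vfield"
    and \<epsilon> :: real
  assumes card: "CARD('n) = CARD('m) + 1"
    and M: "smooth_manifold M A"
    and g: "riemannian_metric A g"
    and hyp: "hypersurface \<Sigma> B M A"
    and n_smooth: "smooth_vector_field_along \<Sigma> B A (\<lambda>p. p) n"
    and n_unit: "unit_normal_along \<Sigma> B A g (\<lambda>p. p) n"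
    and v_smooth: "smooth_vector_field_along \<Sigma> B A (\<lambda>p. p) v"
    and deform: "deformation \<Sigma> B M A v \<epsilon> \<phi>"
    and normal: "deformed_normal \<Sigma> B A g n \<epsilon> \<phi> \<nu>"
begin

lemma \<Sigma>: "smooth_manifold \<Sigma> B" and \<Sigma>M: "\<Sigma> \<subseteq> M"
  using hyp by (auto simp: hypersurface_def)

lemma eps: "\<epsilon> > 0"
  using deform by (simp add: deformation_def)

lemma metric: "c \<in> A \<Longrightarrow> metric_on (g c) (chart_range c)"
  using g chart_range_open[OF M] unfolding riemannian_metric_def metric_on_def by blast

lemma immersion_at: "\<bar>s\<bar> < \<epsilon> \<Longrightarrow> immersion \<Sigma> B M A (\<phi> s)"
  using deform unfolding deformation_def by (metis abs_less_iff greaterThanLessThan_iff minus_less_iff)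

lemma \<phi>_in: "\<bar>s\<bar> < \<epsilon> \<Longrightarrow> p \<in> \<Sigma> \<Longrightarrow> \<phi> s p \<in> M"
  using immersion_at[of s] by (auto simp: immersion_def smooth_map_def)

lemma \<phi>_0: "p \<in> \<Sigma> \<Longrightarrow> \<phi> 0 p = p"
  using deform by (simp add: deformation_def)

lemma \<nu>_0: "p \<in> \<Sigma> \<Longrightarrow> c \<in> A \<Longrightarrow> p \<in> fst c \<Longrightarrow> \<nu> 0 c p = n c p"
  using normal by (simp add: deformed_normal_def)

lemma \<nu>_unit: "\<bar>s\<bar> < \<epsilon> \<Longrightarrow> unit_normal_along \<Sigma> B A g (\<phi> s) (\<nu> s)"
  using normal unfolding deformed_normal_def
  by (metis abs_less_iff greaterThanLessThan_iff minus_less_iff)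

text \<open>The deformation and its normal in the chart \<open>b\<close> of \<open>\<Sigma>\<close> and the chart \<open>c\<close> of \<open>M\<close>, as functions of
  time and position on the open set \<open>Om b c\<close>.\<close>

definition "Om b c = {(s, x). s \<in> {-\<epsilon><..<\<epsilon>} \<and> x \<in> chart_range b \<and> \<phi> s (chart_inv b x) \<in> fst c}"
definition "Ph b c = (\<lambda>(s, x). local_rep b c (\<phi> s) x)"
definition "Nn b c = (\<lambda>(s, x). \<nu> s c (chart_inv b x))"

lemma Om_iff: "(s, x) \<in> Om b c \<longleftrightarrow> \<bar>s\<bar> < \<epsilon> \<and> x \<in> chart_range b \<and> \<phi> s (chart_inv b x) \<in> fst c"
  by (auto simp: Om_def)

text \<open>Joint continuity of the deformation in time and position enters here.\<close>

lemma Om_open: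
  assumes b: "b \<in> B" and c: "c \<in> A"
  shows "open (Om b c)"
proof -
  let ?D = "{-\<epsilon><..<\<epsilon>} \<times> chart_range b"
  have D: "open ?D" using chart_range_open[OF \<Sigma> b] by (intro open_Times) auto
  have "continuous_on ?D (\<lambda>z. (\<lambda>(s, p). \<phi> s p) (fst z, chart_inv b (snd z)))"
  proof (rule continuous_on_compose2[of "{-\<epsilon><..<\<epsilon>} \<times> \<Sigma>"])
    show "continuous_on ({-\<epsilon><..<\<epsilon>} \<times> \<Sigma>) (\<lambda>(s, p). \<phi> s p)"
      using deform by (simp add: deformation_def)
    have "continuous_on ?D (\<lambda>z. chart_inv b (snd z))"
      by (rule continuous_on_compose2[OF chart_inv_continuous[OF \<Sigma> b]]) (auto intro!: continuous_intros)
    then show "continuous_on ?D (\<lambda>z. (fst z, chart_inv b (snd z)))"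
      by (intro continuous_intros)
    show "(\<lambda>z. (fst z, chart_inv b (snd z))) ` ?D \<subseteq> {-\<epsilon><..<\<epsilon>} \<times> \<Sigma>"
      using chart_inv_in_manifold[OF \<Sigma> b] by auto
  qed
  moreover obtain T where T: "open T" "fst c = M \<inter> T"
    using chart_openin[OF M c] by (auto simp: openin_open)
  ultimately have "open (?D \<inter> (\<lambda>z. (\<lambda>(s, p). \<phi> s p) (fst z, chart_inv b (snd z))) -` T)"
    using continuous_open_preimage[OF _ D] by blast
  moreover have "?D \<inter> (\<lambda>z. (\<lambda>(s, p). \<phi> s p) (fst z, chart_inv b (snd z))) -` T = Om b c"
    using T \<phi>_in chart_inv_in_manifold[OF \<Sigma> b] by (auto simp: Om_def abs_less_iff)
  ultimately show ?thesis by simp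
qed

lemma Ph_smooth: "b \<in> B \<Longrightarrow> c \<in> A \<Longrightarrow> smooth_on (Ph b c) (Om b c)"
  using deform by (simp add: deformation_def Om_def Ph_def)

lemma Nn_smooth: "b \<in> B \<Longrightarrow> c \<in> A \<Longrightarrow> smooth_on (Nn b c) (Om b c)"
  using normal by (simp add: deformed_normal_def Om_def Nn_def)

lemma Dif_local_rep:
  assumes "b \<in> B" "c \<in> A" "(s, x) \<in> Om b c"
  shows "Dif (local_rep b c (\<phi> s)) x = (\<lambda>X. Dif (Ph b c) (s, x) (0, X))"
  using Dif_eq[OF has_derivative_slice(1)[OF smooth_onD[OF Ph_smooth[OF assms(1,2)] assms(3)]]]
  by (simp add: Ph_def)

lemma Dif_normal:
  assumes "b \<in> B" "c \<in> A" "(s, x) \<in> Om b c"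
  shows "Dif (\<nu> s c \<circ> chart_inv b) x = (\<lambda>X. Dif (Nn b c) (s, x) (0, X))"
  using Dif_eq[OF has_derivative_slice(1)[OF smooth_onD[OF Nn_smooth[OF assms(1,2)] assms(3)]]]
  by (simp add: Nn_def o_def)

lemma fam:
  assumes b: "b \<in> B" and c: "c \<in> A"
  shows "immersed_family (g c) (chart_range c) (Ph b c) (Nn b c) (Om b c)"
proof
  show "CARD('n) = CARD('m) + 1" by (rule card)
  show "metric_on (g c) (chart_range c)" by (rule metric[OF c])
  show "open (Om b c)" by (rule Om_open[OF b c])
  show "Ph b c ` Om b c \<subseteq> chart_range c"
    using chart_in[OF M c] by (auto simp: Om_def Ph_def local_rep_def)
  show "smooth_on (Ph b c) (Om b c)" "smooth_on (Nn b c) (Om b c)"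
    using Ph_smooth Nn_smooth b c by auto
  fix z :: "real \<times> (real^'m)" and X :: "real^'m"
  assume "z \<in> Om b c"
  then obtain s x where z: "z = (s, x)" "(s, x) \<in> Om b c" by (cases z) auto
  then have x: "\<bar>s\<bar> < \<epsilon>" "x \<in> chart_range b" "\<phi> s (chart_inv b x) \<in> fst c" by (auto simp: Om_iff)
  have p: "chart_inv b x \<in> fst b" "snd b (chart_inv b x) = x" "chart_inv b x \<in> \<Sigma>"
    using chart_inv_in[OF \<Sigma> b x(2)] chart_chart_inv[OF \<Sigma> b x(2)] chart_inv_in_manifold[OF \<Sigma> b x(2)] by auto
  note d = Dif_local_rep[OF b c z(2)]
  have "inj (Dif (local_rep b c (\<phi> s)) (snd b (chart_inv b x)))"
    using immersion_at[OF x(1)] b c p(1) x(3) unfolding immersion_def by blast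
  then show "inj (\<lambda>X. Dif (Ph b c) z (0, X))" by (simp add: p d z)
  have u: "\<nu> s c (chart_inv b x) \<bullet> (g c (snd c (\<phi> s (chart_inv b x))) *v \<nu> s c (chart_inv b x)) = 1 \<and>
        (\<forall>X. Dif (local_rep b c (\<phi> s)) (snd b (chart_inv b x)) X \<bullet>
               (g c (snd c (\<phi> s (chart_inv b x))) *v \<nu> s c (chart_inv b x)) = 0)"
    using \<nu>_unit[OF x(1)] b c p x(3) unfolding unit_normal_along_def by blast
  then show "Dif (Ph b c) z (0, X) \<bullet> (g c (Ph b c z) *v Nn b c z) = 0"
    by (simp add: p d z) (simp add: Ph_def Nn_def local_rep_def)
  show "Nn b c z \<bullet> (g c (Ph b c z) *v Nn b c z) = 1"
    using u by (simp add: z Ph_def Nn_def local_rep_def)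
qed

abbreviation "fr b c \<equiv> immersed_family.frame (Ph b c)"
abbreviation "gr b c \<equiv> immersed_family.gram (g c) (Ph b c)"
abbreviation "pr b c \<equiv> immersed_family.proj (g c) (Ph b c)"
abbreviation "dn b c \<equiv> immersed_family.DN (g c) (Ph b c) (Nn b c)"
abbreviation "sh b c \<equiv> immersed_family.shape (g c) (Ph b c) (Nn b c)"
abbreviation "Yf b c \<equiv> immersed_family.Y (g c) (Ph b c) (Nn b c)"
abbreviation "yf b c \<equiv> immersed_family.y (g c) (Ph b c) (Nn b c)"
abbreviation "dY b c \<equiv> immersed_family.DY (g c) (Ph b c) (Nn b c)"

lemmas fam_simps = immersed_family.gram_def[OF fam] immersed_family.proj_def[OF fam]
  immersed_family.shape_def[OF fam] immersed_family.Y_def[OF fam] immersed_family.y_def[OF fam]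

subsection \<open>Independence of the ambient chart\<close>

lemma metric_pullback:
  "c \<in> A \<Longrightarrow> c' \<in> A \<Longrightarrow> x \<in> overlap c c' \<Longrightarrow> X \<bullet> (g c x *v Y) =
    Dif (transition c c') x X \<bullet> (g c' (transition c c' x) *v Dif (transition c c') x Y)"
  using g by (simp add: riemannian_metric_def)

text \<open>The differential \<open>T\<close> of the transition map carries the frame and the
  covariant derivatives of the normal to the other chart, while the projection absorbs it.
  Quantities with values on the hypersurface are therefore unchanged.\<close>

lemma chart_change:
  assumes b: "b \<in> B" and c: "c \<in> A" and c': "c' \<in> A" and z: "z \<in> Om b c" "z \<in> Om b c'"
  shows "gr b c' z = gr b c z" "sh b c' z = sh b c z" "yf b c' z = yf b c z"
proof -
  let ?\<tau> = "transition c c'" and ?W = "overlap c c'" and ?O = "Om b c \<inter> Om b c'"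
  have O: "open ?O" using Om_open b c c' by blast
  have zO: "z \<in> ?O" using z by simp
  have PW: "Ph b c y \<in> ?W" "Ph b c' y = ?\<tau> (Ph b c y)" "Nn b c' y = Dif ?\<tau> (Ph b c y) (Nn b c y)"
    if "y \<in> ?O" for y
  proof -
    obtain s x where y: "y = (s, x)" by force
    have x: "\<bar>s\<bar> < \<epsilon>" "x \<in> chart_range b" "\<phi> s (chart_inv b x) \<in> fst c" "\<phi> s (chart_inv b x) \<in> fst c'"
      using that by (auto simp: y Om_iff)
    show 1: "Ph b c y \<in> ?W"
      using x by (auto simp: y Ph_def local_rep_def overlap_def)
    show "Ph b c' y = ?\<tau> (Ph b c y)"
      using chart_inv_chart[OF M c x(3)] by (simp add: y Ph_def local_rep_def transition_def)
    have "vector_field_along \<Sigma> A (\<phi> s) (\<nu> s)"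
      using \<nu>_unit[OF x(1)] by (simp add: unit_normal_along_def)
    then have "\<nu> s c' (chart_inv b x) = Dif ?\<tau> (snd c (\<phi> s (chart_inv b x))) (\<nu> s c (chart_inv b x))"
      using c c' x chart_inv_in_manifold[OF \<Sigma> b x(2)] unfolding vector_field_along_def by blast
    then show "Nn b c' y = Dif ?\<tau> (Ph b c y) (Nn b c y)"
      by (simp add: y Ph_def Nn_def local_rep_def)
  qed
  have im: "Ph b c ` ?O \<subseteq> ?W" using PW by blast
  have W: "?W \<subseteq> chart_range c" "?\<tau> ` ?W \<subseteq> chart_range c'"
    using overlap_eq[OF M c] transition_in[OF M c c'] by auto
  have cov: "cov (g c') (Ph b c') (Nn b c') d y = Dif ?\<tau> (Ph b c y) (cov (g c) (Ph b c) (Nn b c) d y)"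
    if "y \<in> ?O" for d y
    by (rule cov_transform[OF metric[OF c] metric[OF c'] transition_smooth[OF M c c'] overlap_open[OF M c c'] W
          metric_pullback[OF c c'] O that im smooth_on_subset[OF Ph_smooth[OF b c]] smooth_on_subset[OF Nn_smooth[OF b c]]])
      (auto simp: PW)
  define T where "T = matrix (Dif ?\<tau> (Ph b c z))"
  have T: "T *v w = Dif ?\<tau> (Ph b c z) w" for w
    unfolding T_def by (rule matrix_works_real[OF transition_linear[OF M c c' PW(1)[OF zO]]])
  have G: "g c (Ph b c z) = transpose T ** g c' (Ph b c' z) ** T"
    by (rule pullback_matrix) (simp add: T PW(2)[OF zO] metric_pullback[OF c c' PW(1)[OF zO]])
  have dP: "Dif (Ph b c') z d = T *v Dif (Ph b c) z d" for d
  proof -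
    have "Dif (Ph b c') z = Dif (\<lambda>y. ?\<tau> (Ph b c y)) z"
      by (rule Dif_cong_open[OF O zO]) (use PW in auto)
    also have "\<dots> = (\<lambda>d. Dif ?\<tau> (Ph b c z) (Dif (Ph b c) z d))"
      by (rule Dif_eq[OF has_derivative_compose[OF smooth_onD[OF Ph_smooth[OF b c] z(1)]
              smooth_onD[OF transition_smooth[OF M c c'] PW(1)[OF zO]]]])
    finally show ?thesis by (simp add: T)
  qed
  have fr: "fr b c' z = T ** fr b c z"
    by (rule matrix_eq_columns)
      (simp add: immersed_family.frame_apply[OF fam[OF b c'] z(2)] immersed_family.frame_apply[OF fam[OF b c] z(1)]
        dP flip: matrix_vector_mul_assoc)
  have dn: "dn b c' z = T ** dn b c z"
    by (rule matrix_eq_columns)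
      (simp add: immersed_family.DN_apply[OF fam[OF b c'] z(2)] immersed_family.DN_apply[OF fam[OF b c] z(1)]
        cov[OF zO] T flip: matrix_vector_mul_assoc)
  have pr: "pr b c z = pr b c' z ** T"
    unfolding fam_simps(2)[OF b c] fam_simps(2)[OF b c'] G fr by (rule tproj_change_chart)
  show "gr b c' z = gr b c z"
    unfolding fam_simps(1)[OF b c] fam_simps(1)[OF b c'] G fr
    by (simp add: matrix_transpose_mul matrix_mul_assoc)
  show "sh b c' z = sh b c z"
    unfolding fam_simps(3)[OF b c] fam_simps(3)[OF b c'] pr dn by (simp add: matrix_mul_assoc)
  show "yf b c' z = yf b c z"
    unfolding fam_simps(4,5)[OF b c] fam_simps(4,5)[OF b c'] pr
    by (simp add: cov[OF zO] T flip: matrix_vector_mul_assoc)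
qed

subsection \<open>Dependence on the chart of the hypersurface\<close>

text \<open>The differential \<open>P\<close> of the chart change acts on frame and projection by
  mutually inverse factors. So the coordinates of Y transform as a tangent vector, and in the trace
  the factors cancel cyclically.\<close>

lemma parameter_change:
  assumes b: "b \<in> B" and b': "b' \<in> B" and c: "c \<in> A" and x: "(s, x) \<in> Om b c" "x \<in> overlap b b'"
  shows "yf b' c (s, transition b b' x) = Dif (transition b b') x (yf b c (s, x))"
    and "trace (pr b' c (s, transition b b' x) ** dY b' c (s, transition b b' x)) = trace (pr b c (s, x) ** dY b c (s, x))"
proof -
  let ?\<sigma> = "transition b b'"
  \<comment> \<open>The chart change acts on positions only, so time derivatives, and with them Y,
    are the same on both sides.\<close>
  define \<kappa> where "\<kappa> z = (fst z, ?\<sigma> (snd z))" for z :: "real \<times> (real^'m)"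
  let ?O = "Om b c \<inter> (UNIV \<times> overlap b b')"
  have O: "open ?O" using Om_open[OF b c] overlap_open[OF \<Sigma> b b'] by (intro open_Int open_Times) auto
  have \<kappa>O: "\<kappa> z \<in> Om b' c" "Ph b c z = Ph b' c (\<kappa> z)" "Nn b c z = Nn b' c (\<kappa> z)" if "z \<in> ?O" for z
  proof -
    obtain t y where z: "z = (t, y)" by force
    have y: "y \<in> overlap b b'" "\<bar>t\<bar> < \<epsilon>" "\<phi> t (chart_inv b y) \<in> fst c" using that by (auto simp: z Om_iff)
    note i = chart_inv_transition[OF \<Sigma> b b' y(1)]
    show "\<kappa> z \<in> Om b' c"
      using y i transition_in[OF \<Sigma> b b'] by (auto simp: \<kappa>_def z Om_iff)
    show "Ph b c z = Ph b' c (\<kappa> z)" "Nn b c z = Nn b' c (\<kappa> z)"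
      using i by (auto simp: \<kappa>_def z Ph_def Nn_def local_rep_def)
  qed
  have d\<kappa>: "(\<kappa> has_derivative (\<lambda>d. (fst d, Dif ?\<sigma> (snd z) (snd d)))) (at z)" if "z \<in> ?O" for z
  proof -
    have "snd z \<in> overlap b b'" using that by auto
    note d = smooth_onD[OF transition_smooth[OF \<Sigma> b b'] this]
    have "((\<lambda>z. ?\<sigma> (snd z)) has_derivative (\<lambda>d. Dif ?\<sigma> (snd z) (snd d))) (at z)"
      by (rule has_derivative_compose[where f = snd and g = ?\<sigma>, OF _ d]) (auto intro!: derivative_eq_intros)
    then show ?thesis
      unfolding \<kappa>_def[abs_def] by (intro has_derivative_Pair) (auto intro!: derivative_eq_intros)
  qed
  have cov: "cov (g c) (Ph b c) (Nn b c) d z = cov (g c) (Ph b' c) (Nn b' c) (fst d, Dif ?\<sigma> (snd z) (snd d)) (\<kappa> z)"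
    if "z \<in> ?O" for d z
    by (rule cov_reparametrize[OF d\<kappa>[OF that] smooth_onD[OF Ph_smooth[OF b' c] \<kappa>O(1)[OF that]]
          smooth_onD[OF Nn_smooth[OF b' c] \<kappa>O(1)[OF that]] O that \<kappa>O(2,3)])
  have Yf: "Yf b c z = Yf b' c (\<kappa> z)" if "z \<in> ?O" for z
  proof -
    have "linear (Dif ?\<sigma> (snd z))" using transition_linear[OF \<Sigma> b b'] that by auto
    then have "Dif ?\<sigma> (snd z) 0 = 0" by (rule linear_0)
    then show ?thesis unfolding fam_simps(4)[OF b c] fam_simps(4)[OF b' c] using cov[OF that] by simp
  qed
  have covY: "cov (g c) (Ph b c) (Yf b c) d z = cov (g c) (Ph b' c) (Yf b' c) (fst d, Dif ?\<sigma> (snd z) (snd d)) (\<kappa> z)"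
    if "z \<in> ?O" for d z
    by (rule cov_reparametrize[OF d\<kappa>[OF that] smooth_onD[OF Ph_smooth[OF b' c] \<kappa>O(1)[OF that]]
          smooth_onD[OF immersed_family.smooth_Y[OF fam[OF b' c]] \<kappa>O(1)[OF that]] O that \<kappa>O(2) Yf])
  let ?z = "(s, x)"
  have z: "?z \<in> ?O" using x by auto
  note z' = \<kappa>O(1)[OF z]
  define P where "P = matrix (Dif ?\<sigma> x)"
  have P: "P *v w = Dif ?\<sigma> x w" for w
    unfolding P_def by (rule matrix_works_real[OF transition_linear[OF \<Sigma> b b' x(2)]])
  have inv: "invertible P"
  proof -
    have "P *v w = 0 \<Longrightarrow> w = 0" for w
    proof -
      assume "P *v w = 0"
      then have e: "Dif ?\<sigma> x w = 0" by (simp add: P)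
      have "snd b' (chart_inv b x) \<in> overlap b' b"
      proof -
        have "chart_inv b x \<in> fst b' \<inter> fst b"
          using x(2) chart_inv_in[OF \<Sigma> b] unfolding overlap_eq[OF \<Sigma> b] by blast
        then show ?thesis unfolding overlap_def by blast
      qed
      then have "linear (Dif (transition b' b) (?\<sigma> x))"
        using transition_linear[OF \<Sigma> b' b] by (simp add: transition_def)
      then have "Dif (transition b' b) (?\<sigma> x) 0 = 0" by (rule linear_0)
      then show "w = 0" using transition_inverse[OF \<Sigma> b b' x(2), of w] e by simp
    qed
    then show ?thesis by (simp add: invertible_left_inverse matrix_left_invertible_ker)
  qed
  have dP: "Dif (Ph b c) ?z (0, X) = Dif (Ph b' c) (\<kappa> ?z) (0, P *v X)" for X
  proof -
    have "Dif (Ph b c) ?z = Dif (\<lambda>z. Ph b' c (\<kappa> z)) ?z"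
      by (rule Dif_cong_open[OF O z \<kappa>O(2)])
    also have "\<dots> = (\<lambda>d. Dif (Ph b' c) (\<kappa> ?z) (fst d, Dif ?\<sigma> (snd ?z) (snd d)))"
      by (rule Dif_eq[OF has_derivative_compose[OF d\<kappa>[OF z] smooth_onD[OF Ph_smooth[OF b' c] z']]])
    finally show ?thesis by (simp add: P)
  qed
  have fr: "fr b c ?z = fr b' c (\<kappa> ?z) ** P"
    by (rule matrix_eq_columns)
      (simp add: immersed_family.frame_apply[OF fam[OF b c] x(1)] immersed_family.frame_apply[OF fam[OF b' c] z']
        dP flip: matrix_vector_mul_assoc)
  have dY: "dY b c ?z = dY b' c (\<kappa> ?z) ** P"
    by (rule matrix_eq_columns)
      (simp add: immersed_family.DY_apply[OF fam[OF b c] x(1)] immersed_family.DY_apply[OF fam[OF b' c] z']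
        covY[OF z] P flip: matrix_vector_mul_assoc)
  have pr: "P ** pr b c ?z = pr b' c (\<kappa> ?z)"
    unfolding fam_simps(2)[OF b c] fam_simps(2)[OF b' c] fr \<kappa>O(2)[OF z]
    by (rule tproj_reparametrize[OF immersed_family.metric_at(2)[OF fam[OF b' c] z']
          immersed_family.frame_inj[OF fam[OF b' c] z'] inv])
  have \<kappa>z: "\<kappa> ?z = (s, ?\<sigma> x)" by (simp add: \<kappa>_def)
  have "Dif ?\<sigma> x (yf b c ?z) = P *v (pr b c ?z *v Yf b c ?z)"
    by (simp add: P immersed_family.y_def[OF fam[OF b c]])
  also have "\<dots> = yf b' c (\<kappa> ?z)"
    by (simp add: matrix_vector_mul_assoc pr Yf[OF z] immersed_family.y_def[OF fam[OF b' c]])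
  finally show "yf b' c (s, ?\<sigma> x) = Dif ?\<sigma> x (yf b c ?z)" by (simp add: \<kappa>z)
  have "trace (pr b c ?z ** dY b c ?z) = trace (P ** (pr b c ?z ** dY b' c (\<kappa> ?z)))"
    unfolding dY by (metis matrix_mul_assoc trace_mul_sym)
  also have "\<dots> = trace (pr b' c (\<kappa> ?z) ** dY b' c (\<kappa> ?z))"
    by (simp add: matrix_mul_assoc pr)
  finally show "trace (pr b' c (s, ?\<sigma> x) ** dY b' c (s, ?\<sigma> x)) = trace (pr b c ?z ** dY b c ?z)"
    by (simp add: \<kappa>z)
qed

subsection \<open>The invariants in charts\<close>

lemma chart_at_image:
  assumes b: "b \<in> B" and s: "\<bar>s\<bar> < \<epsilon>" and x: "x \<in> chart_range b"
  defines "c \<equiv> chart_at A (\<phi> s (chart_inv b x))"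
  shows "c \<in> A" "(s, x) \<in> Om b c"
  using chart_at[OF M \<phi>_in[OF s chart_inv_in_manifold[OF \<Sigma> b x]]] s x by (auto simp: c_def Om_iff)

text \<open>Replaces the chart chosen by \<open>chart_at\<close>, which may jump with
  \<open>s\<close> and \<open>x\<close>, by a fixed one; in this form the metric can be
  differentiated.\<close>

lemma induced_metric_eq:
  assumes b: "b \<in> B" and c: "c \<in> A" and z: "(s, x) \<in> Om b c"
  shows "induced_metric A g (\<phi> s) b x = gr b c (s, x)"
proof -
  have sx: "\<bar>s\<bar> < \<epsilon>" "x \<in> chart_range b" using z by (auto simp: Om_iff)
  let ?c = "chart_at A (\<phi> s (chart_inv b x))"
  note c0 = chart_at_image[OF b sx]
  have P: "Ph b ?c (s, x) = local_rep b ?c (\<phi> s) x" by (simp add: Ph_def)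
  have "induced_metric A g (\<phi> s) b x = gr b ?c (s, x)"
    unfolding induced_metric_def Let_def Dif_local_rep[OF b c0] fam_simps(1)[OF b c0(1)]
    by (simp add: gram_matrix[symmetric] immersed_family.frame_apply[OF fam[OF b c0(1)] c0(2)] P)
  then show ?thesis
    using chart_change(1)[OF b c c0(1) z c0(2)] by simp
qed

lemma covariant_derivative_along_eq:
  assumes "b \<in> B" "c \<in> A" "(s, x) \<in> Om b c"
  shows "covariant_derivative_along g (\<phi> s) (\<nu> s) b c x X = cov (g c) (Ph b c) (Nn b c) (0, X) (s, x)"
proof -
  have "Ph b c (s, x) = local_rep b c (\<phi> s) x" "Nn b c (s, x) = \<nu> s c (chart_inv b x)"
    by (simp_all add: Ph_def Nn_def)
  then show ?thesis
    unfolding covariant_derivative_along_def cov_def conn_mult Dif_local_rep[OF assms] Dif_normal[OF assms]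
    by simp
qed

text \<open>The defining equation has a unique solution: \<open>frame_shape\<close> provides one,
  and the left inverse \<open>pr\<close> of the frame excludes others. As for the metric, the chart
  then becomes arbitrary.\<close>

lemma shape_operator_eq:
  assumes b: "b \<in> B" and c: "c \<in> A" and z: "(s, x) \<in> Om b c"
  shows "shape_operator A g (\<phi> s) (\<nu> s) b x = sh b c (s, x)"
proof -
  have sx: "\<bar>s\<bar> < \<epsilon>" "x \<in> chart_range b" using z by (auto simp: Om_iff)
  let ?c = "chart_at A (\<phi> s (chart_inv b x))"
  note c0 = chart_at_image[OF b sx]
  let ?E = "fr b ?c (s, x)"
  have *: "(\<forall>X. Dif (local_rep b ?c (\<phi> s)) x (S *v X) = - covariant_derivative_along g (\<phi> s) (\<nu> s) b ?c x X)
      \<longleftrightarrow> ?E ** S = - dn b ?c (s, x)" for S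
    unfolding Dif_local_rep[OF b c0] covariant_derivative_along_eq[OF b c0]
      immersed_family.frame_apply[OF fam[OF b c0(1)] c0(2), symmetric]
      immersed_family.DN_apply[OF fam[OF b c0(1)] c0(2), symmetric]
    by (simp add: matrix_eq matrix_vector_mul_assoc bounded_bilinear.minus_left[OF bounded_bilinear_matrix_vector_mult])
  have "shape_operator A g (\<phi> s) (\<nu> s) b x = (THE S. ?E ** S = - dn b ?c (s, x))"
    unfolding shape_operator_def Let_def * ..
  also have "\<dots> = sh b ?c (s, x)"
  proof (rule the_equality)
    show "?E ** sh b ?c (s, x) = - dn b ?c (s, x)"
      by (rule immersed_family.frame_shape[OF fam[OF b c0(1)] c0(2)])
    then have "pr b ?c (s, x) ** (?E ** S) = pr b ?c (s, x) ** (?E ** sh b ?c (s, x))"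
      if "?E ** S = - dn b ?c (s, x)" for S
      using that by simp
    then show "S = sh b ?c (s, x)" if "?E ** S = - dn b ?c (s, x)" for S
      using that unfolding matrix_mul_assoc immersed_family.proj_frame[OF fam[OF b c0(1)] c0(2)] by simp
  qed
  finally show ?thesis
    using chart_change(2)[OF b c c0(1) z c0(2)] by simp
qed

section \<open>The deformation at time zero\<close>

lemma zero_in_Om: "b \<in> B \<Longrightarrow> x \<in> chart_range b \<Longrightarrow> chart_inv b x \<in> fst c \<Longrightarrow> (0, x) \<in> Om b c"
  using eps \<phi>_0 chart_inv_in_manifold[OF \<Sigma>] by (auto simp: Om_iff)

lemma slice_neighbourhood:
  assumes b: "b \<in> B" and x: "x \<in> chart_range b" and c: "c \<in> A" "chart_inv b x \<in> fst c"
  defines "W \<equiv> Pair 0 -` Om b c"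
  shows "open W" "x \<in> W" "\<And>y. y \<in> W \<Longrightarrow> y \<in> chart_range b \<and> chart_inv b y \<in> fst c \<and> (0, y) \<in> Om b c"
proof -
  show "open W" unfolding W_def
    by (rule open_vimage[OF Om_open[OF b c(1)]]) (auto intro!: continuous_intros)
  show "x \<in> W" using zero_in_Om[OF b x c(2)] by (simp add: W_def)
  show "y \<in> chart_range b \<and> chart_inv b y \<in> fst c \<and> (0, y) \<in> Om b c" if "y \<in> W" for y
    using that \<phi>_0 chart_inv_in_manifold[OF \<Sigma> b, of y] by (auto simp: W_def Om_iff)
qed

lemma ambient_chart:
  assumes "b \<in> B" "x \<in> chart_range b"
  shows "chart_at A (chart_inv b x) \<in> A" "chart_inv b x \<in> fst (chart_at A (chart_inv b x))"
  using chart_at[OF M] \<Sigma>M chart_inv_in_manifold[OF \<Sigma> assms] by auto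

text \<open>\<open>\<phi> 0\<close> agrees with the identity only on \<Sigma>, whereas the theorem
  speaks of the inclusion as the identity map; each quantity is carried over separately.\<close>

lemma local_rep_inclusion:
  fixes c :: "('a, 'n) chart"
  shows "b \<in> B \<Longrightarrow> y \<in> chart_range b \<Longrightarrow> local_rep b c (\<lambda>q. q) y = local_rep b c (\<phi> 0) y"
  using \<phi>_0 chart_inv_in_manifold[OF \<Sigma>] by (simp add: local_rep_def)

lemma Dif_local_rep_inclusion:
  fixes c :: "('a, 'n) chart"
  shows "b \<in> B \<Longrightarrow> x \<in> chart_range b \<Longrightarrow> Dif (local_rep b c (\<lambda>q. q)) x = Dif (local_rep b c (\<phi> 0)) x"
  by (rule Dif_cong_open[OF chart_range_open[OF \<Sigma>]]) (auto intro: local_rep_inclusion)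

lemma induced_metric_inclusion:
  assumes b: "b \<in> B" and x: "x \<in> chart_range b"
  shows "induced_metric A g (\<lambda>q. q) b x = induced_metric A g (\<phi> 0) b x"
  unfolding induced_metric_def
  by (simp add: \<phi>_0 chart_inv_in_manifold[OF \<Sigma> b x] Dif_local_rep_inclusion[OF b x] local_rep_inclusion[OF b x])

lemma shape_operator_inclusion:
  assumes b: "b \<in> B" and x: "x \<in> chart_range b"
  shows "shape_operator A g (\<lambda>q. q) n b x = shape_operator A g (\<phi> 0) (\<nu> 0) b x"
proof -
  let ?p = "chart_inv b x"
  let ?c = "chart_at A ?p"
  have p: "?p \<in> \<Sigma>" by (rule chart_inv_in_manifold[OF \<Sigma> b x])
  note c = ambient_chart[OF b x]
  note O = slice_neighbourhood[OF b x c]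
  \<comment> \<open>\<open>\<nu> 0\<close> and \<open>n\<close> are known to agree only at points
    inside the ambient chart, so their derivatives are compared on the neighbourhood that stays in
    it.\<close>
  have "n ?c (chart_inv b y) = \<nu> 0 ?c (chart_inv b y)" if "y \<in> Pair 0 -` Om b ?c" for y
    using O(3)[OF that] \<nu>_0[OF _ c(1), of "chart_inv b y"] chart_inv_in_manifold[OF \<Sigma> b, of y] by auto
  then have "Dif (n ?c \<circ> chart_inv b) x = Dif (\<nu> 0 ?c \<circ> chart_inv b) x"
    by (intro Dif_cong_open[OF O(1,2)]) auto
  then have "covariant_derivative_along g (\<lambda>q. q) n b ?c x X = covariant_derivative_along g (\<phi> 0) (\<nu> 0) b ?c x X" for X
    unfolding covariant_derivative_along_def
    by (simp add: Dif_local_rep_inclusion[OF b x] local_rep_inclusion[OF b x] \<nu>_0[OF p c])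
  then show ?thesis
    unfolding shape_operator_def by (simp add: \<phi>_0[OF p] Dif_local_rep_inclusion[OF b x])
qed

lemma velocity:
  assumes b: "b \<in> B" and c: "c \<in> A" and x: "x \<in> chart_range b" "chart_inv b x \<in> fst c"
  shows "Dif (Ph b c) (0, x) (1, 0) = v c (chart_inv b x)"
proof -
  have "((\<lambda>s. snd c (\<phi> s (chart_inv b x))) has_vector_derivative v c (chart_inv b x)) (at 0)"
    using deform c x(2) chart_inv_in_manifold[OF \<Sigma> b x(1)] by (simp add: deformation_def)
  moreover have "((\<lambda>s. Ph b c (s, x)) has_derivative (\<lambda>r. Dif (Ph b c) (0, x) (r, 0))) (at 0)"
    by (rule has_derivative_slice(2)[OF smooth_onD[OF Ph_smooth[OF b c] zero_in_Om[OF b x]]])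
  ultimately have "(\<lambda>r. r *\<^sub>R v c (chart_inv b x)) = (\<lambda>r. Dif (Ph b c) (0, x) (r, 0))"
    unfolding has_vector_derivative_def by (intro has_derivative_unique) (auto simp: Ph_def local_rep_def)
  from fun_cong[OF this, of 1] show ?thesis by simp
qed

text \<open>Pairing the decomposition of v with n isolates the coefficient, and the pairing has the
  same value in every ambient chart. This form matches ric(v, n) and makes continuity
  visible.\<close>

lemma normal_component_eq:
  assumes p: "p \<in> \<Sigma>" and c: "c \<in> A" "p \<in> fst c"
  shows "normal_component B A n v p = v c p \<bullet> (g c (snd c p) *v n c p)"
proof -
  let ?b = "chart_at B p" and ?c = "chart_at A p"
  have b: "?b \<in> B" "p \<in> fst ?b" using chart_at[OF \<Sigma> p] by auto
  have c0: "?c \<in> A" "p \<in> fst ?c" using chart_at[OF M] p \<Sigma>M by auto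
  let ?x = "snd ?b p" and ?v = "v ?c p"
  have x: "?x \<in> chart_range ?b" "chart_inv ?b ?x = p"
    using chart_in[OF \<Sigma> b] chart_inv_chart[OF \<Sigma> b] by auto
  have z: "(0, ?x) \<in> Om ?b ?c" by (rule zero_in_Om[OF b(1) x(1)]) (simp add: x c0)
  let ?f = "?v \<bullet> (g ?c (snd ?c p) *v n ?c p)"
  have Nn: "Nn ?b ?c (0, ?x) = n ?c p" and Ph: "Ph ?b ?c (0, ?x) = snd ?c p"
    by (simp_all add: Nn_def Ph_def local_rep_def x \<phi>_0[OF p] \<nu>_0[OF p c0])
  have D: "Dif (local_rep ?b ?c (\<lambda>q. q)) ?x X = fr ?b ?c (0, ?x) *v X" for X
    unfolding Dif_local_rep_inclusion[OF b(1) x(1)] Dif_local_rep[OF b(1) c0(1) z]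
      immersed_family.frame_apply[OF fam[OF b(1) c0(1)] z] ..
  have "normal_component B A n v p = ?f"
    unfolding normal_component_def Let_def D
  proof (rule the_equality)
    show "\<exists>X. ?v = fr ?b ?c (0, ?x) *v X + ?f *\<^sub>R n ?c p"
      using immersed_family.decomposition[OF fam[OF b(1) c0(1)] z, of ?v] by (metis Nn Ph)
    fix a assume "\<exists>X. ?v = fr ?b ?c (0, ?x) *v X + a *\<^sub>R n ?c p"
    then obtain X where "?v = fr ?b ?c (0, ?x) *v X + a *\<^sub>R n ?c p" by blast
    then show "a = ?f"
      using immersed_family.normal[OF fam[OF b(1) c0(1)] z, of X] immersed_family.unit[OF fam[OF b(1) c0(1)] z]
      by (simp add: immersed_family.frame_apply[OF fam[OF b(1) c0(1)] z] inner_add_left Nn Ph)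
  qed
  also have "?f = v c p \<bullet> (g c (snd c p) *v n c p)"
  proof -
    have ov: "snd ?c p \<in> overlap ?c c" using c0 c by (auto simp: overlap_def)
    have "v c p = Dif (transition ?c c) (snd ?c p) ?v"
      using v_smooth c0 c p unfolding smooth_vector_field_along_def vector_field_along_def by blast
    moreover have "n c p = Dif (transition ?c c) (snd ?c p) (n ?c p)"
      using n_unit c0 c p unfolding unit_normal_along_def vector_field_along_def by blast
    moreover have "transition ?c c (snd ?c p) = snd c p"
      using chart_inv_chart[OF M c0] by (simp add: transition_def)
    ultimately show ?thesis
      using metric_pullback[OF c0(1) c(1) ov, of ?v "n ?c p"] by simp
  qed
  finally show ?thesis .
qed

lemma normal_component_continuous:
  assumes b: "b \<in> B"
  shows "continuous_on (chart_range b) (\<lambda>x. normal_component B A n v (chart_inv b x))"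
proof -
  have "smooth_on (\<lambda>x. normal_component B A n v (chart_inv b x)) (chart_range b)"
  proof (rule smooth_on_local)
    fix x assume x: "x \<in> chart_range b"
    let ?c = "chart_at A (chart_inv b x)"
    note c = ambient_chart[OF b x]
    let ?O = "Pair 0 -` Om b ?c"
    note O = slice_neighbourhood(1)[OF b x c]
    have O': "y \<in> chart_range b \<and> chart_inv b y \<in> fst ?c \<and> chart_inv b y \<in> \<Sigma>" if "y \<in> ?O" for y
      using slice_neighbourhood(3)[OF b x c that] chart_inv_in_manifold[OF \<Sigma> b] by blast
    have sub: "?O \<subseteq> snd b ` {p \<in> fst b. p \<in> fst ?c}"
      unfolding chart_image[OF \<Sigma> b] using O' by auto
    have "smooth_on (\<lambda>y. (v ?c \<circ> chart_inv b) y \<bullet> (g ?c (Ph b ?c (0, y)) *v (n ?c \<circ> chart_inv b) y)) ?O"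
    proof (intro smooth_on_inner[OF O] smooth_on_matrix_vector_mult[OF O])
      show "smooth_on (v ?c \<circ> chart_inv b) ?O" "smooth_on (n ?c \<circ> chart_inv b) ?O"
        using v_smooth n_smooth b c(1) smooth_on_subset[OF _ sub]
        unfolding smooth_vector_field_along_def by blast+
      show "smooth_on (\<lambda>y. g ?c (Ph b ?c (0, y))) ?O"
        by (rule smooth_on_slice[OF O immersed_family.smooth_metric[OF fam[OF b c(1)]] Om_open[OF b c(1)]]) simp
    qed
    then have "smooth_on (\<lambda>y. normal_component B A n v (chart_inv b y)) ?O"
    proof (rule smooth_on_cong[OF O, rotated])
      fix y assume "y \<in> ?O"
      then show "(v ?c \<circ> chart_inv b) y \<bullet> (g ?c (Ph b ?c (0, y)) *v (n ?c \<circ> chart_inv b) y) =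
          normal_component B A n v (chart_inv b y)"
        using O'[of y] normal_component_eq[OF _ c(1), of "chart_inv b y"] \<phi>_0 by (simp add: Ph_def local_rep_def)
    qed
    then show "\<exists>W. open W \<and> x \<in> W \<and> smooth_on (\<lambda>x. normal_component B A n v (chart_inv b x)) W"
      using O zero_in_Om[OF b x c(2)] by (intro exI[of _ ?O]) simp
  qed
  then show ?thesis by (rule smooth_on_continuous_on)
qed

text \<open>The divergence on the hypersurface of the tangent field Y, as the trace of X |-> (D_X
  Y)^T at time 0.\<close>

definition "div_Y p = (let b = chart_at B p; c = chart_at A p; z = (0, snd b p) in trace (pr b c z ** dY b c z))"

text \<open>Translates \<open>shape_variation\<close> at time 0 into the quantities of the theorem;
  \<open>k\<close> stands for S/(m+1).\<close>

lemma pointwise_formula: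
  assumes p: "p \<in> \<Sigma>"
    and ein: "\<And>c x. c \<in> A \<Longrightarrow> x \<in> chart_range c \<Longrightarrow> ricci (g c) x = k *\<^sub>R g c x"
  shows "mean_curvature_variation B A g \<phi> \<nu> p + 1/2 * metric_variation_inner_II B A g n \<phi> p =
    k * normal_component B A n v p - div_Y p"
proof -
  let ?b = "chart_at B p" and ?c = "chart_at A p"
  have b: "?b \<in> B" "p \<in> fst ?b" using chart_at[OF \<Sigma> p] by auto
  have c: "?c \<in> A" "p \<in> fst ?c" using chart_at[OF M] p \<Sigma>M by auto
  let ?x = "snd ?b p"
  have x: "?x \<in> chart_range ?b" "chart_inv ?b ?x = p"
    using chart_in[OF \<Sigma> b] chart_inv_chart[OF \<Sigma> b] by auto
  let ?z = "(0, ?x)"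
  have z: "?z \<in> Om ?b ?c" by (rule zero_in_Om[OF b(1) x(1)]) (simp add: x c)
  note F = fam[OF b(1) c(1)]
  \<comment> \<open>The open set of times for which the moving point stays in the ambient chart of
    \<open>p\<close>. There all quantities are expressed in this one chart, so the derivatives at
    time 0 can be taken in it.\<close>
  let ?O = "(\<lambda>s. (s, ?x)) -` Om ?b ?c"
  have O: "open ?O"
    by (rule open_vimage[OF Om_open[OF b(1) c(1)]]) (auto intro!: continuous_intros)
  have O0: "0 \<in> ?O" using z by simp
  have H: "mean_curvature_variation B A g \<phi> \<nu> p = trace (Dif (sh ?b ?c) ?z (1, 0))"
  proof -
    have "((\<lambda>s. trace (sh ?b ?c (s, ?x))) has_derivative (\<lambda>r. trace (Dif (sh ?b ?c) ?z (r, 0)))) (at 0)"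
      by (intro bounded_linear.has_derivative[OF bounded_linear_trace]
          has_derivative_slice(2)[OF smooth_onD[OF immersed_family.smooth_shape[OF F] z]])
    then have d: "((\<lambda>s. mean_curvature B A g (\<phi> s) (\<nu> s) p) has_derivative (\<lambda>r. trace (Dif (sh ?b ?c) ?z (r, 0)))) (at 0)"
      by (subst has_derivative_cong_open[OF O O0, of _ "\<lambda>s. trace (sh ?b ?c (s, ?x))"])
        (auto simp: mean_curvature_def Let_def shape_operator_eq[OF b(1) c(1)])
    have "(\<lambda>r. trace (Dif (sh ?b ?c) ?z (r, 0))) = (*) (trace (Dif (sh ?b ?c) ?z (1, 0)))"
    proof
      fix r
      show "trace (Dif (sh ?b ?c) ?z (r, 0)) = trace (Dif (sh ?b ?c) ?z (1, 0)) * r"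
        using linear_scale[OF has_derivative_linear[OF d], of r 1] by simp
    qed
    then have "((\<lambda>s. mean_curvature B A g (\<phi> s) (\<nu> s) p) has_field_derivative trace (Dif (sh ?b ?c) ?z (1, 0))) (at 0)"
      using d by (simp only: has_field_derivative_def)
    then show ?thesis
      unfolding mean_curvature_variation_def by (rule DERIV_imp_deriv)
  qed
  have I: "metric_variation A g \<phi> ?b ?x = Dif (gr ?b ?c) ?z (1, 0)"
  proof -
    have "((\<lambda>s. gr ?b ?c (s, ?x)) has_derivative (\<lambda>r. Dif (gr ?b ?c) ?z (r, 0))) (at 0)"
      by (rule has_derivative_slice(2)[OF smooth_onD[OF immersed_family.smooth_gram[OF F] z]])
    then have d: "((\<lambda>s. induced_metric A g (\<phi> s) ?b ?x) has_derivative (\<lambda>r. Dif (gr ?b ?c) ?z (r, 0))) (at 0)"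
      by (subst has_derivative_cong_open[OF O O0, of _ "\<lambda>s. gr ?b ?c (s, ?x)"])
        (auto simp: induced_metric_eq[OF b(1) c(1)])
    have "(\<lambda>r. Dif (gr ?b ?c) ?z (r, 0)) = (\<lambda>r. r *\<^sub>R Dif (gr ?b ?c) ?z (1, 0))"
    proof
      fix r
      show "Dif (gr ?b ?c) ?z (r, 0) = r *\<^sub>R Dif (gr ?b ?c) ?z (1, 0)"
        using linear_scale[OF has_derivative_linear[OF d], of r 1] by simp
    qed
    then have "((\<lambda>s. induced_metric A g (\<phi> s) ?b ?x) has_vector_derivative Dif (gr ?b ?c) ?z (1, 0)) (at 0)"
      using d by (simp only: has_vector_derivative_def)
    then show ?thesis
      unfolding metric_variation_def by (rule vector_derivative_at)
  qed
  have II: "metric_variation_inner_II B A g n \<phi> p =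
      tensor_inner (gr ?b ?c ?z) (Dif (gr ?b ?c) ?z (1, 0)) (gr ?b ?c ?z ** sh ?b ?c ?z)"
    unfolding metric_variation_inner_II_def Let_def second_fundamental_form_def I
      induced_metric_inclusion[OF b(1) x(1)] shape_operator_inclusion[OF b(1) x(1)]
      induced_metric_eq[OF b(1) c(1) z] shape_operator_eq[OF b(1) c(1) z] ..
  have N: "Nn ?b ?c ?z = n ?c p" and P: "Ph ?b ?c ?z = snd ?c p"
    by (simp_all add: Nn_def Ph_def local_rep_def x \<phi>_0[OF p] \<nu>_0[OF p c])
  have "Dif (Ph ?b ?c) ?z (1, 0) = v ?c p"
    using velocity[OF b(1) c(1) x(1)] c by (simp add: x)
  then have "Dif (Ph ?b ?c) ?z (1, 0) \<bullet> (ricci (g ?c) (Ph ?b ?c ?z) *v Nn ?b ?c ?z) = k * normal_component B A n v p"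
    using ein[OF c(1) chart_in[OF M c]] normal_component_eq[OF p c]
    by (simp add: N P flip: scaleR_matrix_vector_assoc)
  then show ?thesis
    using immersed_family.shape_variation[OF F z] unfolding H II div_Y_def Let_def by simp
qed

text \<open>The field Y at time 0 in the coordinates of \<open>b\<close>: the vector field to which
  the divergence theorem is applied.\<close>

definition "yv b x = yf b (chart_at A (chart_inv b x)) (0, x)"

lemma yv_eq:
  assumes b: "b \<in> B" and c: "c \<in> A" and x: "x \<in> chart_range b" "chart_inv b x \<in> fst c"
  shows "yv b x = yf b c (0, x)"
proof -
  have "chart_at A (chart_inv b x) \<in> A \<and> chart_inv b x \<in> fst (chart_at A (chart_inv b x))"
    using chart_at[OF M] \<Sigma>M chart_inv_in_manifold[OF \<Sigma> b x(1)] by auto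
  then show ?thesis
    unfolding yv_def using chart_change(3)[OF b c _ zero_in_Om[OF b x] zero_in_Om[OF b x(1)]] by auto
qed

lemma induced_metric_inclusion_eq:
  assumes b: "b \<in> B" and c: "c \<in> A" and x: "x \<in> chart_range b" "chart_inv b x \<in> fst c"
  shows "induced_metric A g (\<lambda>q. q) b x = gr b c (0, x)"
  unfolding induced_metric_inclusion[OF b x(1)] by (rule induced_metric_eq[OF b c zero_in_Om[OF b x]])

text \<open>Smoothness is local, and near \<open>x\<close> the ambient chart chosen at
  \<open>x\<close> may be kept fixed.\<close>

lemma yv_smooth:
  assumes b: "b \<in> B"
  shows "smooth_on (yv b) (chart_range b)" "metric_on (induced_metric A g (\<lambda>q. q) b) (chart_range b)"
proof -
  note c = ambient_chart[OF b]
  show "smooth_on (yv b) (chart_range b)"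
  proof (rule smooth_on_local)
    fix x assume x: "x \<in> chart_range b"
    note O = slice_neighbourhood[OF b x c[OF x]]
    have "smooth_on (\<lambda>y. yf b (chart_at A (chart_inv b x)) (0, y)) (Pair 0 -` Om b (chart_at A (chart_inv b x)))"
      by (rule smooth_on_slice[OF O(1) immersed_family.smooth_y[OF fam[OF b c(1)[OF x]]] Om_open[OF b c(1)[OF x]]]) simp
    then have "smooth_on (yv b) (Pair 0 -` Om b (chart_at A (chart_inv b x)))"
      by (rule smooth_on_cong[OF O(1), rotated]) (use O(3) yv_eq[OF b c(1)[OF x]] in auto)
    then show "\<exists>W. open W \<and> x \<in> W \<and> smooth_on (yv b) W" using O by blast
  qed
  have "smooth_on (induced_metric A g (\<lambda>q. q) b) (chart_range b)"
  proof (rule smooth_on_local)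
    fix x assume x: "x \<in> chart_range b"
    note O = slice_neighbourhood[OF b x c[OF x]]
    have "smooth_on (\<lambda>y. gr b (chart_at A (chart_inv b x)) (0, y)) (Pair 0 -` Om b (chart_at A (chart_inv b x)))"
      by (rule smooth_on_slice[OF O(1) immersed_family.smooth_gram[OF fam[OF b c(1)[OF x]]] Om_open[OF b c(1)[OF x]]]) simp
    then have "smooth_on (induced_metric A g (\<lambda>q. q) b) (Pair 0 -` Om b (chart_at A (chart_inv b x)))"
      by (rule smooth_on_cong[OF O(1), rotated]) (use O(3) induced_metric_inclusion_eq[OF b c(1)[OF x]] in auto)
    then show "\<exists>W. open W \<and> x \<in> W \<and> smooth_on (induced_metric A g (\<lambda>q. q) b) W" using O by blast
  qed
  moreover have "transpose (induced_metric A g (\<lambda>q. q) b x) = induced_metric A g (\<lambda>q. q) b x \<and>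
      (\<forall>X. X \<noteq> 0 \<longrightarrow> X \<bullet> (induced_metric A g (\<lambda>q. q) b x *v X) > 0)" if x: "x \<in> chart_range b" for x
    unfolding induced_metric_inclusion_eq[OF b c(1)[OF x] x c(2)[OF x]]
    using immersed_family.gram_symmetric[OF fam[OF b c(1)[OF x]] zero_in_Om[OF b x c(2)[OF x]]]
      immersed_family.gram_pos[OF fam[OF b c(1)[OF x]] zero_in_Om[OF b x c(2)[OF x]]] by blast
  ultimately show "metric_on (induced_metric A g (\<lambda>q. q) b) (chart_range b)"
    using chart_range_open[OF \<Sigma> b] by (simp add: metric_on_def)
qed

text \<open>The divergence theorem asks for the coordinate formula in every chart.
  \<open>parameter_change\<close> moves the trace from the chart chosen at \<open>p\<close> to
  \<open>b\<close>, where \<open>trace_DY\<close> applies.\<close>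

lemma div_Y_formula:
  assumes b: "b \<in> B" and p: "p \<in> fst b"
  shows "div_Y p = trace (matrix (Dif (yv b) (snd b p))) + 1/2 * trace (matrix_inv (induced_metric A g (\<lambda>q. q) b (snd b p)) **
    Dif (induced_metric A g (\<lambda>q. q) b) (snd b p) (yv b (snd b p)))"
proof -
  have p\<Sigma>: "p \<in> \<Sigma>" using chart_subset[OF \<Sigma> b] p by auto
  let ?b = "chart_at B p" and ?c = "chart_at A p"
  have b0: "?b \<in> B" "p \<in> fst ?b" using chart_at[OF \<Sigma> p\<Sigma>] by auto
  have c: "?c \<in> A" "p \<in> fst ?c" using chart_at[OF M] p\<Sigma> \<Sigma>M by auto
  let ?x = "snd b p"
  have x: "?x \<in> chart_range b" "chart_inv b ?x = p"
    using chart_in[OF \<Sigma> b p] chart_inv_chart[OF \<Sigma> b p] by auto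
  have x0: "snd ?b p \<in> chart_range ?b" "chart_inv ?b (snd ?b p) = p"
    using chart_in[OF \<Sigma> b0] chart_inv_chart[OF \<Sigma> b0] by auto
  have z: "(0, ?x) \<in> Om b ?c" by (rule zero_in_Om[OF b x(1)]) (simp add: x c)
  have z0: "(0, snd ?b p) \<in> Om ?b ?c" by (rule zero_in_Om[OF b0(1) x0(1)]) (simp add: x0 c)
  have ov: "snd ?b p \<in> overlap ?b b" using b0 p by (auto simp: overlap_def)
  have tr: "transition ?b b (snd ?b p) = ?x" by (simp add: transition_def x0)
  have "div_Y p = trace (pr b ?c (0, ?x) ** dY b ?c (0, ?x))"
    using parameter_change(2)[OF b0(1) b c(1) z0 ov] by (simp add: div_Y_def Let_def tr)
  also have "\<dots> = trace (matrix (\<lambda>X. Dif (yf b ?c) (0, ?x) (0, X))) +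
      1/2 * trace (matrix_inv (gr b ?c (0, ?x)) ** Dif (gr b ?c) (0, ?x) (0, yf b ?c (0, ?x)))"
    by (rule immersed_family.trace_DY[OF fam[OF b c(1)] z])
  also have "(\<lambda>X. Dif (yf b ?c) (0, ?x) (0, X)) = Dif (yv b) ?x"
  proof -
    note O = slice_neighbourhood[OF b x(1) c(1)]
    have c': "chart_inv b ?x \<in> fst ?c" by (simp add: x c)
    have "Dif (yv b) ?x = Dif (\<lambda>y. yf b ?c (0, y)) ?x"
      by (rule Dif_cong_open[OF O(1,2)[OF c']]) (use O(3)[OF c'] yv_eq[OF b c(1)] in auto)
    then show ?thesis
      using Dif_eq[OF has_derivative_slice(1)[OF smooth_onD[OF immersed_family.smooth_y[OF fam[OF b c(1)]] z]]]
      by simp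
  qed
  also have "Dif (gr b ?c) (0, ?x) (0, yf b ?c (0, ?x)) = Dif (induced_metric A g (\<lambda>q. q) b) ?x (yv b ?x)"
  proof -
    note O = slice_neighbourhood[OF b x(1) c(1)]
    have c': "chart_inv b ?x \<in> fst ?c" by (simp add: x c)
    have "Dif (induced_metric A g (\<lambda>q. q) b) ?x = Dif (\<lambda>y. gr b ?c (0, y)) ?x"
      by (rule Dif_cong_open[OF O(1,2)[OF c']]) (use O(3)[OF c'] induced_metric_inclusion_eq[OF b c(1)] in auto)
    then show ?thesis
      using Dif_eq[OF has_derivative_slice(1)[OF smooth_onD[OF immersed_family.smooth_gram[OF fam[OF b c(1)]] z]]]
        yv_eq[OF b c(1) x(1) c'] by simp
  qed
  also have "gr b ?c (0, ?x) = induced_metric A g (\<lambda>q. q) b ?x"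
    using induced_metric_inclusion_eq[OF b c(1) x(1)] c(2) by (simp add: x)
  finally show ?thesis .
qed

lemma yv_transform:
  assumes b: "b \<in> B" and b': "b' \<in> B" and p: "p \<in> fst b \<inter> fst b'"
  shows "yv b' (snd b' p) = Dif (transition b b') (snd b p) (yv b (snd b p))"
proof -
  have p1: "p \<in> fst b" "p \<in> fst b'" using p by auto
  have p\<Sigma>: "p \<in> \<Sigma>" using chart_subset[OF \<Sigma> b] p by auto
  let ?c = "chart_at A p"
  have c: "?c \<in> A" "p \<in> fst ?c" using chart_at[OF M] p\<Sigma> \<Sigma>M by auto
  note x = chart_in[OF \<Sigma> b p1(1)] chart_inv_chart[OF \<Sigma> b p1(1)]
  note x' = chart_in[OF \<Sigma> b' p1(2)] chart_inv_chart[OF \<Sigma> b' p1(2)]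
  have z: "(0, snd b p) \<in> Om b ?c" by (rule zero_in_Om[OF b x(1)]) (simp add: x c)
  have ov: "snd b p \<in> overlap b b'" using p1 by (auto simp: overlap_def)
  have tr: "transition b b' (snd b p) = snd b' p" by (simp add: transition_def x)
  show ?thesis
    using parameter_change(1)[OF b b' c(1) z ov] yv_eq[OF b c(1) x(1)] yv_eq[OF b' c(1) x'(1)] c(2)
    by (simp add: tr x x')
qed

text \<open>Splitting the integral of the pointwise identity requires both terms on its right-hand
  side to be integrable: \<open>continuous_integrable\<close> gives this for <v, n>, the divergence
  theorem for \<open>div_Y\<close>.\<close>

lemma integral_formula:
  assumes comp: "compact \<Sigma>" and \<mu>: "area_element \<Sigma> B (induced_metric A g (\<lambda>p. p)) \<mu>"
    and ein: "\<And>c x. c \<in> A \<Longrightarrow> x \<in> chart_range c \<Longrightarrow> ricci (g c) x = k *\<^sub>R g c x"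
  shows "k * volume_variation B A n v \<mu> =
    (\<integral>p. (mean_curvature_variation B A g \<phi> \<nu> p + 1 / 2 * metric_variation_inner_II B A g n \<phi> p) \<partial>\<mu>)"
proof -
  have space: "space \<mu> = \<Sigma>"
    using \<mu> sets_eq_imp_space_eq[of \<mu> "restrict_space borel \<Sigma>"]
    by (auto simp: area_element_def space_restrict_space)
  note div = divergence_theorem[OF \<Sigma> comp yv_smooth(2) \<mu> yv_smooth(1) yv_transform div_Y_formula]
  have f: "integrable \<mu> (normal_component B A n v)"
    by (rule continuous_integrable[OF \<Sigma> comp yv_smooth(2) \<mu> normal_component_continuous])
  have "(\<integral>p. (mean_curvature_variation B A g \<phi> \<nu> p + 1 / 2 * metric_variation_inner_II B A g n \<phi> p) \<partial>\<mu>) =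
      (\<integral>p. (k * normal_component B A n v p - div_Y p) \<partial>\<mu>)"
    by (rule Bochner_Integration.integral_cong[OF refl], rule pointwise_formula[OF _ ein]) (simp_all add: space)
  also have "\<dots> = k * volume_variation B A n v \<mu>"
    using div f by (simp add: volume_variation_def)
  finally show ?thesis ..
qed

end

theorem theorem1:
  fixes M \<Sigma> :: "'a::{t2_space,second_countable_topology} set"
    and A :: "('a, 'n::finite) chart set"
    and B :: "('a, 'm::finite) chart set"
    and g :: "('a, 'n) metric"
    and n v :: "('a, 'n) vfield"
    and \<phi> :: "real \<Rightarrow> 'a \<Rightarrow> 'a"
    and \<nu> :: "real \<Rightarrow> ('a, 'n) vfield"
    and S \<epsilon> :: real
    and dA :: "'a measure"
  assumes "CARD('n) = CARD('m) + 1" and "CARD('m) + 1 \<ge> 3"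
    and "smooth_manifold M A"
    and "riemannian_metric A g"
    and "einstein A g"
    and "\<forall>c\<in>A. \<forall>x\<in>chart_range c. scalar_curvature (g c) x = S"
    and "compact \<Sigma>" and "hypersurface \<Sigma> B M A"
    and "smooth_vector_field_along \<Sigma> B A (\<lambda>p. p) n"
    and "unit_normal_along \<Sigma> B A g (\<lambda>p. p) n"
    and "area_element \<Sigma> B (induced_metric A g (\<lambda>p. p)) dA"
    and "smooth_vector_field_along \<Sigma> B A (\<lambda>p. p) v"
    and "deformation \<Sigma> B M A v \<epsilon> \<phi>"
    and "deformed_normal \<Sigma> B A g n \<epsilon> \<phi> \<nu>"
  shows "S / (real CARD('m) + 1) * volume_variation B A n v dA =
    (\<integral>p. (mean_curvature_variation B A g \<phi> \<nu> p
           + 1 / 2 * metric_variation_inner_II B A g n \<phi> p) \<partial>dA)"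
proof -
  interpret hypersurface_deformation M \<Sigma> A B g n v \<phi> \<nu> \<epsilon>
    by unfold_locales (use assms in auto)
  \<comment> \<open>The dimension in \<open>einstein\<close> is that of M, hence m + 1; since S has
    the same value at all points, the coefficient is a constant that can leave the integral.\<close>
  have "ricci (g c) x = (S / (real CARD('m) + 1)) *\<^sub>R g c x" if "c \<in> A" "x \<in> chart_range c" for c x
    using assms(1,5,6) that by (simp add: einstein_def add.commute)
  then show ?thesis
    by (rule integral_formula[OF assms(7,11)])
qed

end
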